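(* Let $N,k\ge1$ be integers and let $(S_{\mathcal G}(t))_{t\ge0}$ be the family of operators associated with the Grushin operator $\Delta_{\mathcal G}=\frac12(\Delta_x+|x|^2\Delta_y)$ on $\mathbb{R}^{N}\times\mathbb{R}^k$ defined in the context. Then: (i) For every $1\le p\le\infty$, the operators $S_{\mathcal G}(t):L^p(\mathbb{R}^{N+k})\to L^p(\mathbb{R}^{N+k})$, $t\ge0$, form a semigroup, i.e. $S_{\mathcal G}(0)=I$ and $S_{\mathcal G}(t+s)=S_{\mathcal G}(t)S_{\mathcal G}(s)$ for all $t,s\ge0$. (ii) If $1\le p\le r\le\infty$, there is a constant $C>0$ such that for all $\varphi\in L^p(\mathbb{R}^{N+k})$ and all $t>0$, $$\|S_{\mathcal G}(t)\varphi\|_{L^r(\mathbb{R}^{N+k})}\le C\,t^{-\frac{N+2k}{2}\left(\frac1p-\frac1r\right)}\|\varphi\|_{L^p(\mathbb{R}^{N+k})}.$$ (iii) If $1\le p\le r\le\infty$, then for every $t_0>0$ and every $\varphi\in L^p(\mathbb{R}^{N+k})$, $$\|S_{\mathcal G}(t)\varphi-S_{\mathcal G}(t_0)\varphi\|_{L^r(\mathbb{R}^{N+k})}\to0\quad\text{as } t\to t_0 .$$ When $p=r<\infty$, one may also take $t_0=0$ (with $t\to0^+$).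
   Context: For $t>0$, $$S_{\mathcal G}(t)\varphi(x,y)=\int_{\mathbb{R}^{N+k}}K(x,w,y-z;t)\,\varphi(w,z)\,d(w,z),\qquad (x,y)\in\mathbb{R}^N\times\mathbb{R}^k,$$ and $S_{\mathcal G}(0)=I$, where for $x,w\in\mathbb{R}^N$, $y\in\mathbb{R}^k$, $t>0$, $$K(x,w,y;t)=\frac{1}{(2\pi)^{\frac{N+2k}{2}}}\int_{\mathbb{R}^k}\left(\frac{|\xi|}{\sinh(|\xi|t)}\right)^{\frac N2}e^{\,i\xi\cdot y-\frac{|\xi|}{2}\left((|x|^2+|w|^2)\coth(|\xi|t)-2x\cdot w\,\operatorname{csch}(|\xi|t)\right)}\,d\xi ,$$ with $\operatorname{csch}=1/\sinh$. *)

theory Defs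
  imports "HOL-Analysis.Analysis" "HOL-Probability.Essential_Supremum"
begin

text \<open>
  Elements of \<open>L\<^sup>p\<close> are represented by measurable functions; equality in \<open>L\<^sup>p\<close> is equality
  almost everywhere. The exponent ranges over \<open>ennreal\<close>, so \<open>p = \<infinity>\<close> is included, and
  \<open>inverse \<infinity> = 0\<close> gives the usual convention \<open>1/\<infinity> = 0\<close>.
\<close>

definition Lp_space :: "'a measure \<Rightarrow> ennreal \<Rightarrow> ('a \<Rightarrow> complex) set" where
  "Lp_space M p = {f \<in> borel_measurable M.
     if p = \<infinity> then esssup M (\<lambda>u. ennreal (norm (f u))) < \<infinity>
     else integrable M (\<lambda>u. norm (f u) powr enn2real p)}"

text \<open>The real number below is the norm only for members of \<^term>\<open>Lp_space M p\<close>.\<close>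

definition Lp_norm :: "'a measure \<Rightarrow> ennreal \<Rightarrow> ('a \<Rightarrow> complex) \<Rightarrow> real" where
  "Lp_norm M p f =
     (if p = \<infinity> then enn2real (esssup M (\<lambda>u. ennreal (norm (f u))))
      else (\<integral>u. norm (f u) powr enn2real p \<partial>M) powr (1 / enn2real p))"

text \<open>\<open>T\<close> induces a linear map on the quotient of \<^term>\<open>Lp_space M p\<close> by a.e. equality.\<close>

definition Lp_operator :: "'a measure \<Rightarrow> ennreal \<Rightarrow> (('a \<Rightarrow> complex) \<Rightarrow> ('a \<Rightarrow> complex)) \<Rightarrow> bool" where
  "Lp_operator M p T \<longleftrightarrow>
     (\<forall>f \<in> Lp_space M p. T f \<in> Lp_space M p) \<and>
     (\<forall>f \<in> Lp_space M p. \<forall>g \<in> Lp_space M p.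
        (AE u in M. f u = g u) \<longrightarrow> (AE u in M. T f u = T g u)) \<and>
     (\<forall>f \<in> Lp_space M p. \<forall>g \<in> Lp_space M p. \<forall>a b.
        AE u in M. T (\<lambda>v. a * f v + b * g v) u = a * T f u + b * T g u)"

text \<open>
  The integrand is meant for \<open>t > 0\<close>. At \<open>\<xi> = 0\<close>, a null set, \<open>|\<xi>| / sinh (|\<xi>| t)\<close> evaluates to
  \<open>0\<close> instead of its limit \<open>1/t\<close>.
\<close>

definition grushin_kernel :: "real^'n \<Rightarrow> real^'n \<Rightarrow> real^'k \<Rightarrow> real \<Rightarrow> complex" where
  "grushin_kernel x w y t =
     of_real (1 / (2 * pi) powr ((real CARD('n) + 2 * real CARD('k)) / 2)) *
     (\<integral>\<xi>. of_real ((norm \<xi> / sinh (norm \<xi> * t)) powr (real CARD('n) / 2)) *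
          exp (\<i> * of_real (\<xi> \<bullet> y) -
               of_real (norm \<xi> / 2 *
                 (((norm x)\<^sup>2 + (norm w)\<^sup>2) * (cosh (norm \<xi> * t) / sinh (norm \<xi> * t))
                  - 2 * (x \<bullet> w) * (1 / sinh (norm \<xi> * t)))))
        \<partial>(lebesgue :: (real^'k) measure))"

definition grushin_integrand ::
  "real \<Rightarrow> ((real^'n) \<times> (real^'k) \<Rightarrow> complex) \<Rightarrow> (real^'n) \<times> (real^'k) \<Rightarrow> (real^'n) \<times> (real^'k) \<Rightarrow> complex" where
  "grushin_integrand t \<phi> = (\<lambda>(x, y) (w, z). grushin_kernel x w (y - z) t * \<phi> (w, z))"

definition grushin_semigroup ::
  "real \<Rightarrow> ((real^'n) \<times> (real^'k) \<Rightarrow> complex) \<Rightarrow> (real^'n) \<times> (real^'k) \<Rightarrow> complex" where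
  "grushin_semigroup t \<phi> =
     (if t = 0 then \<phi> else (\<lambda>u. \<integral>v. grushin_integrand t \<phi> u v \<partial>lebesgue))"

end

(*
  After a Fourier transform in y the kernel is the Mehler kernel of (1/2) (Laplacian - |xi|^2 |x|^2).
  Once the kernel K is known to be nonnegative, everything is soft: the inversion formula turns its
  values at xi = 0 into total mass one (in either variable, by symmetry), the semigroup law of the Mehler
  kernel into the Chapman-Kolmogorov equation, and K <= C t^{-(N+2k)/2} is the trivial bound, so that
  Jensen's inequality yields contraction on every L^p and smoothing from L^p to L^r.

  Nonnegativity: the product formulas for sinh and cosh exhibit the Mehler kernel, as a function of xi, as
  a limit of products of the factors (1 + c |xi|^2)^{-1/2} and (1 + a |xi|^2) / (1 + b |xi|^2), a <= b,
  which are mixtures of Gaussians in xi.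

  Strong continuity at 0 holds for indicators because the mass concentrates near the diagonal, hence on
  L^p for p < oo; the semigroup law and smoothing move it to t_0 > 0 and to r >= p.  For p = r = oo one
  needs K(t, u, .) -> K(t_0, u, .) in L^1 uniformly in u = (x, y): rescaling the second variable by 1 + |x|
  compactifies the parameter x, and Scheffe's lemma applies along convergent sequences of parameters.
*)

theory Submission
  imports Defs "HOL-Probability.Characteristic_Functions"
begin

section \<open>Gaussian integrals\<close>

text \<open>Why the products reach the exponent: the quadratic form of the Mehler kernel at
  frequency a = |xi| is diagonal in x + w and x - w, with coefficients a tanh(t a / 2) and a coth(t
  a / 2). These are logarithmic derivatives in time of cosh and sinh, so their exponentials are
  limits of powers of quotients T(t) / T(t + h), and the product formulas split such a quotient into
  the rational factors. The coth has a pole 1/t that survives at a = 0; it is split off as a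
  Gaussian in x - w. Positivity then yields integrability in y through Fourier inversion, so no
  pointwise decay of K in y is estimated. Why a rescaling at exponent infinity: the mass started at
  x spreads in y on the scale 1 + |x|, so the kernels for different x are not comparable as they
  stand. With s = 1 / (1 + |x|) and e = x / (1 + |x|) the parameters stay in a compact set. At s = 0
  the limit is a product of Gaussians, still of mass one, so no mass escapes.\<close>

lemma has_bochner_integral_prod_Basis:
  fixes f :: "'a::euclidean_space \<Rightarrow> real \<Rightarrow> 'b::{real_normed_field,banach,second_countable_topology}"
  assumes "\<And>b. b \<in> Basis \<Longrightarrow> has_bochner_integral lborel (f b) (I b)"
  shows "has_bochner_integral lborel (\<lambda>x. \<Prod>b\<in>Basis. f b (x \<bullet> b)) (\<Prod>b\<in>Basis. I b)"
proof -
  interpret product_sigma_finite "\<lambda>_::'a. lborel :: real measure"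
    by standard
  have int: "integrable lborel (f b)" and I: "integral\<^sup>L lborel (f b) = I b" if "b \<in> Basis" for b
    using assms[OF that] by (auto simp: has_bochner_integral_iff)
  have m[measurable]: "f b \<in> borel_measurable borel" if "b \<in> Basis" for b
    using int[OF that] by simp
  have L: "(lborel :: 'a measure) = distr (\<Pi>\<^sub>M b\<in>Basis. lborel) borel (\<lambda>f. \<Sum>b\<in>Basis. f b *\<^sub>R b)"
    by (rule lborel_eq)
  have T: "(\<lambda>f. \<Sum>b\<in>Basis. f b *\<^sub>R b) \<in> (\<Pi>\<^sub>M b\<in>Basis. lborel) \<rightarrow>\<^sub>M (borel :: 'a measure)"
    by measurable
  have eq: "(\<Prod>b\<in>Basis. f b ((\<Sum>c\<in>Basis. g c *\<^sub>R c) \<bullet> b)) = (\<Prod>b\<in>Basis. f b (g b))" for g :: "'a \<Rightarrow> real"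
    by (intro prod.cong refl) (simp add: inner_sum_left inner_Basis if_distrib cong: if_cong)
  have F: "(\<lambda>x. \<Prod>b\<in>Basis. f b (x \<bullet> b)) \<in> borel_measurable borel"
    by measurable
  show ?thesis
    unfolding has_bochner_integral_iff L
    using product_integrable_prod[OF finite_Basis int] product_integral_prod[OF finite_Basis int]
    by (simp add: integrable_distr_eq[OF T F] integral_distr[OF T F] eq I)
qed

text \<open>Completing the square makes the integrand a multiple of the normal density with mean
  \<open>b / A\<close> and standard deviation \<open>1 / sqrt A\<close>.\<close>

lemma has_bochner_integral_gaussian_real:
  fixes A b :: real
  assumes A: "A > 0"
  shows "has_bochner_integral lborel (\<lambda>s. exp (b * s - A / 2 * s\<^sup>2)) (sqrt (2 * pi / A) * exp (b\<^sup>2 / (2 * A)))"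
proof -
  have "has_bochner_integral lborel (normal_density (b / A) (1 / sqrt A)) 1"
    using A by (simp add: has_bochner_integral_iff)
  then have "has_bochner_integral lborel
      (\<lambda>s. (sqrt (2 * pi / A) * exp (b\<^sup>2 / (2 * A))) * normal_density (b / A) (1 / sqrt A) s)
      ((sqrt (2 * pi / A) * exp (b\<^sup>2 / (2 * A))) * 1)"
    by (rule has_bochner_integral_mult_right)
  moreover have "(sqrt (2 * pi / A) * exp (b\<^sup>2 / (2 * A))) * normal_density (b / A) (1 / sqrt A) s
      = exp (b * s - A / 2 * s\<^sup>2)" for s
  proof -
    have "exp (b * s - A / 2 * s\<^sup>2) = exp (b\<^sup>2 / (2 * A)) * exp (- (s - b / A)\<^sup>2 / (2 * (1 / A)))"
      using A by (simp add: exp_add[symmetric] power2_eq_square field_simps)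
    then show ?thesis
      using A by (simp add: normal_density_def real_sqrt_divide power_divide)
  qed
  ultimately show ?thesis by simp
qed

text \<open>The characteristic function of the standard normal law, after scaling the variable by
  \<open>sqrt A\<close>.\<close>

lemma has_bochner_integral_gaussian_cis_real:
  fixes A y :: real
  assumes A: "A > 0"
  shows "has_bochner_integral lborel (\<lambda>s. of_real (exp (- (A / 2 * s\<^sup>2))) * cis (s * y))
           (complex_of_real (sqrt (2 * pi / A) * exp (- (y\<^sup>2 / (2 * A)))))"
proof -
  have int: "integrable lborel (\<lambda>s. of_real (exp (- (B / 2 * s\<^sup>2))) * cis (s * z))" if "B > 0" for B z :: real
  proof (rule Bochner_Integration.integrable_bound)
    show "integrable lborel (\<lambda>s::real. exp (- (B / 2 * s\<^sup>2)))"
      using has_bochner_integral_gaussian_real[OF that, of 0] by (simp add: has_bochner_integral_iff)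
  qed (auto simp: norm_mult cis_conv_exp)
  have "(\<integral>s. of_real (std_normal_density s) * cis (z * s) \<partial>lborel) = complex_of_real (exp (- z\<^sup>2 / 2))" for z
    using char_std_normal_distribution[THEN fun_cong, of z]
    by (simp add: char_def integral_density normal_density_nonneg cis_conv_exp scaleR_conv_of_real)
  then have std0: "(\<integral>s. of_real (1 / sqrt (2 * pi)) * (of_real (exp (- s\<^sup>2 / 2)) * cis (z * s)) \<partial>lborel)
      = complex_of_real (exp (- z\<^sup>2 / 2))" for z
    by (simp only: std_normal_density_def of_real_mult mult.assoc)
  have std: "(\<integral>s. of_real (exp (- s\<^sup>2 / 2)) * cis (z * s) \<partial>lborel)
      = complex_of_real (sqrt (2 * pi) * exp (- z\<^sup>2 / 2))" for z
    using std0[of z] by (simp add: field_simps)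
  have "(\<integral>s. of_real (exp (- s\<^sup>2 / 2)) * cis (y / sqrt A * s) \<partial>lborel)
     = \<bar>sqrt A\<bar> *\<^sub>R (\<integral>s. of_real (exp (- (0 + sqrt A * s)\<^sup>2 / 2)) * cis (y / sqrt A * (0 + sqrt A * s)) \<partial>lborel)"
    using A by (intro lborel_integral_real_affine) auto
  also have "\<dots> = sqrt A *\<^sub>R (\<integral>s. of_real (exp (- (A / 2 * s\<^sup>2))) * cis (s * y) \<partial>lborel)"
    using A by (simp add: power_mult_distrib mult_ac)
  finally have "sqrt A *\<^sub>R (\<integral>s. of_real (exp (- (A / 2 * s\<^sup>2))) * cis (s * y) \<partial>lborel)
     = complex_of_real (sqrt (2 * pi) * exp (- (y / sqrt A)\<^sup>2 / 2))"
    using std[of "y / sqrt A"] by simp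
  then have "(\<integral>s. of_real (exp (- (A / 2 * s\<^sup>2))) * cis (s * y) \<partial>lborel)
     = complex_of_real (sqrt (2 * pi / A) * exp (- (y\<^sup>2 / (2 * A))))"
    using A by (simp add: scaleR_conv_of_real real_sqrt_divide power_divide eq_divide_eq mult_ac)
  with int[OF A] show ?thesis by (simp add: has_bochner_integral_iff)
qed

lemma norm_power2_Basis: "(norm (x::'a::euclidean_space))\<^sup>2 = (\<Sum>b\<in>Basis. (x \<bullet> b)\<^sup>2)"
  unfolding power2_norm_eq_inner by (subst euclidean_inner) (simp add: power2_eq_square)

text \<open>The linear term \<open>b\<close> accommodates the cross term of the Mehler kernel when
  one of its variables is integrated out.\<close>

lemma has_bochner_integral_gaussian:
  fixes b :: "'a::euclidean_space"
  assumes A: "A > 0"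
  shows "has_bochner_integral lborel (\<lambda>v. exp (b \<bullet> v - A / 2 * (norm v)\<^sup>2))
           (sqrt (2 * pi / A) ^ DIM('a) * exp ((norm b)\<^sup>2 / (2 * A)))"
proof -
  have "has_bochner_integral lborel (\<lambda>v::'a. \<Prod>c\<in>Basis. exp ((b \<bullet> c) * (v \<bullet> c) - A / 2 * (v \<bullet> c)\<^sup>2))
          (\<Prod>c\<in>(Basis::'a set). sqrt (2 * pi / A) * exp ((b \<bullet> c)\<^sup>2 / (2 * A)))"
    by (intro has_bochner_integral_prod_Basis has_bochner_integral_gaussian_real A)
  moreover have "(\<Prod>c\<in>Basis. exp ((b \<bullet> c) * (v \<bullet> c) - A / 2 * (v \<bullet> c)\<^sup>2)) = exp (b \<bullet> v - A / 2 * (norm v)\<^sup>2)" for v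
    unfolding euclidean_inner[of b v] norm_power2_Basis
    by (simp add: exp_sum[symmetric] sum_subtractf sum_distrib_left)
  ultimately show ?thesis
    by (simp add: exp_sum[symmetric] prod.distrib norm_power2_Basis[of b] sum_divide_distrib)
qed

lemma cis_sum: "finite S \<Longrightarrow> cis (sum f S) = (\<Prod>x\<in>S. cis (f x))"
  by (induction S rule: finite_induct) (auto simp flip: cis_mult)

lemma has_bochner_integral_gaussian_cis:
  fixes y :: "'a::euclidean_space"
  assumes A: "A > 0"
  shows "has_bochner_integral lborel (\<lambda>v. of_real (exp (- (A / 2 * (norm v)\<^sup>2))) * cis (v \<bullet> y))
           (complex_of_real (sqrt (2 * pi / A) ^ DIM('a) * exp (- ((norm y)\<^sup>2 / (2 * A)))))"
proof -
  have "has_bochner_integral lborel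
          (\<lambda>v::'a. \<Prod>c\<in>Basis. of_real (exp (- (A / 2 * (v \<bullet> c)\<^sup>2))) * cis ((v \<bullet> c) * (y \<bullet> c)))
          (\<Prod>c\<in>(Basis::'a set). complex_of_real (sqrt (2 * pi / A) * exp (- ((y \<bullet> c)\<^sup>2 / (2 * A)))))"
    by (intro has_bochner_integral_prod_Basis has_bochner_integral_gaussian_cis_real A)
  moreover have "(\<Prod>c\<in>Basis. of_real (exp (- (A / 2 * (v \<bullet> c)\<^sup>2))) * cis ((v \<bullet> c) * (y \<bullet> c)))
      = of_real (exp (- (A / 2 * (norm v)\<^sup>2))) * cis (v \<bullet> y)" for v
    unfolding euclidean_inner[of v y] norm_power2_Basis
    by (simp add: prod.distrib cis_sum of_real_prod[symmetric] exp_sum[symmetric] sum_distrib_left sum_negf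
             del: of_real_prod)
  moreover have "(\<Prod>c\<in>(Basis::'a set). complex_of_real (sqrt (2 * pi / A) * exp (- ((y \<bullet> c)\<^sup>2 / (2 * A)))))
      = complex_of_real (sqrt (2 * pi / A) ^ DIM('a) * exp (- ((norm y)\<^sup>2 / (2 * A))))"
    unfolding of_real_prod[symmetric]
    by (simp add: prod.distrib exp_sum[symmetric] norm_power2_Basis sum_divide_distrib sum_negf)
  ultimately show ?thesis by simp
qed

section \<open>Exponential weights\<close>

lemma exp_neg_abs_integrable_real:
  assumes c: "c > 0"
  shows "integrable lborel (\<lambda>s::real. exp (- (c * \<bar>s\<bar>)))"
    and "(\<integral>s. exp (- (c * \<bar>s\<bar>)) \<partial>lborel) = 2 / c"
proof -
  have *: "(\<integral>\<^sup>+s. ennreal (exp (- (c * s))) * indicator {0..} s \<partial>lborel) = ennreal (1 / c)"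
  proof -
    have "((\<lambda>s. - (exp (- (c * s)) / c)) \<longlongrightarrow> - (0 / c)) at_top"
      using c by (intro tendsto_intros filterlim_compose[OF exp_at_bot]
           filterlim_compose[OF filterlim_uminus_at_bot_at_top]
           filterlim_tendsto_pos_mult_at_top[OF tendsto_const] filterlim_ident) auto
    then have "(\<integral>\<^sup>+s. ennreal (exp (- (c * s))) * indicator {0..} s \<partial>lborel) = ennreal (0 - (- (exp (- (c * 0)) / c)))"
      using c by (intro nn_integral_FTC_atLeast) (auto intro!: derivative_eq_intros)
    then show ?thesis by simp
  qed
  \<comment> \<open>The negative half-line is the mirror image of the positive one; both indicators
    contain 0, hence equality only off a null set.\<close>
  have "(\<integral>\<^sup>+s. ennreal (exp (- (c * \<bar>s\<bar>))) \<partial>lborel)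
      = (\<integral>\<^sup>+s. (ennreal (exp (- (c * s))) * indicator {0..} s + ennreal (exp (- (c * (0 + (-1) * s)))) * indicator {0..} (0 + (-1) * s)) \<partial>lborel)"
    by (intro nn_integral_cong_AE AE_I[where N="{0}"]) (auto simp: indicator_def abs_if)
  also have "\<dots> = ennreal (1 / c) + ennreal (1 / c)"
    using * nn_integral_real_affine[where c="-1" and t=0 and f="\<lambda>s. ennreal (exp (- (c * s))) * indicator {0..} s"]
    by (subst nn_integral_add) simp_all
  also have "\<dots> = ennreal (2 / c)"
    using c by (simp flip: ennreal_plus)
  finally have **: "(\<integral>\<^sup>+s. ennreal (exp (- (c * \<bar>s\<bar>))) \<partial>lborel) = ennreal (2 / c)" .
  show "integrable lborel (\<lambda>s::real. exp (- (c * \<bar>s\<bar>)))"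
    by (intro integrableI_nonneg) (auto simp: **)
  show "(\<integral>s. exp (- (c * \<bar>s\<bar>)) \<partial>lborel) = 2 / c"
    using c by (subst integral_eq_nn_integral) (auto simp: **)
qed

text \<open>Every coordinate is bounded by the norm, so spreading \<open>c\<close> evenly over the
  coordinates bounds the weight by a product of one-dimensional exponentials, each with integral
  \<open>2 * DIM('a) / c\<close>. The power of \<open>c\<close> contributes to the power of
  \<open>t\<close> in the kernel bound.\<close>

lemma exp_neg_norm_integrable:
  fixes c :: real
  assumes c: "c > 0"
  shows "integrable lborel (\<lambda>x::'a::euclidean_space. exp (- (c * norm x)))"
    and "(\<integral>x. exp (- (c * norm (x::'a))) \<partial>lborel) \<le> (2 * real DIM('a) / c) ^ DIM('a)"
proof -
  let ?d = "c / real DIM('a)"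
  have d: "?d > 0" using c by simp
  have "has_bochner_integral lborel (\<lambda>x::'a. \<Prod>b\<in>Basis. exp (- (?d * \<bar>x \<bullet> b\<bar>))) (\<Prod>b\<in>(Basis::'a set). 2 / ?d)"
    using exp_neg_abs_integrable_real[OF d]
    by (intro has_bochner_integral_prod_Basis) (auto simp: has_bochner_integral_iff)
  then have 1: "integrable lborel (\<lambda>x::'a. \<Prod>b\<in>Basis. exp (- (?d * \<bar>x \<bullet> b\<bar>)))"
    and 2: "(\<integral>x. (\<Prod>b\<in>Basis. exp (- (c / real DIM('a) * \<bar>(x::'a) \<bullet> b\<bar>))) \<partial>lborel) = (2 * real DIM('a) / c) ^ DIM('a)"
    by (auto simp: has_bochner_integral_iff)
  have le: "exp (- (c * norm x)) \<le> (\<Prod>b\<in>Basis. exp (- (?d * \<bar>x \<bullet> b\<bar>)))" for x :: 'a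
  proof -
    have "(\<Sum>b\<in>Basis. ?d * \<bar>x \<bullet> b\<bar>) \<le> (\<Sum>b\<in>(Basis::'a set). ?d * norm x)"
      using d by (intro sum_mono mult_left_mono Basis_le_norm) auto
    also have "\<dots> = c * norm x" by simp
    finally show ?thesis by (simp add: exp_sum[symmetric] sum_negf)
  qed
  show 3: "integrable lborel (\<lambda>x::'a. exp (- (c * norm x)))"
    by (rule Bochner_Integration.integrable_bound[OF 1])
       (use le in \<open>auto intro!: order_trans[OF le] simp: abs_of_nonneg\<close>)
  show "(\<integral>x. exp (- (c * norm (x::'a))) \<partial>lborel) \<le> (2 * real DIM('a) / c) ^ DIM('a)"
    unfolding 2[symmetric] by (intro integral_mono 1 3 le)
qed

section \<open>Fourier inversion for nonnegative transforms\<close>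

lemma lborel_affine_integral:
  fixes f :: "'a::euclidean_space \<Rightarrow> 'b::{banach,second_countable_topology}"
  assumes [measurable]: "f \<in> borel_measurable borel" and c: "c \<noteq> 0"
  shows "(\<integral>x. f x \<partial>lborel) = \<bar>c\<bar> ^ DIM('a) *\<^sub>R (\<integral>x. f (t + c *\<^sub>R x) \<partial>lborel)"
  by (subst lborel_affine[OF c, of t]) (simp add: integral_density integral_distr)

lemma lborel_affine_nn_integral:
  fixes f :: "'a::euclidean_space \<Rightarrow> ennreal"
  assumes [measurable]: "f \<in> borel_measurable borel" and c: "c \<noteq> 0"
  shows "(\<integral>\<^sup>+x. f x \<partial>lborel) = ennreal (\<bar>c\<bar> ^ DIM('a)) * (\<integral>\<^sup>+x. f (t + c *\<^sub>R x) \<partial>lborel)"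
  by (subst lborel_affine[OF c, of t]) (simp add: nn_integral_density nn_integral_distr nn_integral_cmult)

text \<open>The Gaussian in \<open>y\<close> turns the formal inversion integral into a convolution
  of \<open>f\<close> with a Gaussian of variance \<open>d\<close>. It serves with \<open>d\<close>
  tending to 0 for inversion and with \<open>d = 1\<close> for concentration.\<close>

lemma fourier_gaussian_regularized:
  fixes f :: "'a::euclidean_space \<Rightarrow> real"
  assumes f: "integrable lborel f" and d: "d > 0"
  shows "(\<integral>y. (\<integral>x. of_real (f x) * cis (x \<bullet> y) \<partial>lborel) * (cis (- (z \<bullet> y)) * of_real (exp (- (d / 2 * (norm y)\<^sup>2)))) \<partial>lborel)
       = complex_of_real (\<integral>x. f x * (sqrt (2 * pi / d) ^ DIM('a) * exp (- ((norm (x - z))\<^sup>2 / (2 * d)))) \<partial>lborel)"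
proof -
  let ?h = "\<lambda>x y. complex_of_real (f x) * cis (x \<bullet> y) * (cis (- (z \<bullet> y)) * of_real (exp (- (d / 2 * (norm y)\<^sup>2))))"
  have [measurable]: "f \<in> borel_measurable borel" using f by simp
  have [measurable]: "cis \<in> borel_measurable borel"
    by (intro borel_measurable_continuous_onI continuous_intros)
  have g: "integrable lborel (\<lambda>y::'a. exp (- (d / 2 * (norm y)\<^sup>2)))"
    using has_bochner_integral_gaussian[OF d, of "0::'a"] by (simp add: has_bochner_integral_iff)
  have nrm: "norm (?h x y) = \<bar>f x\<bar> * exp (- (d / 2 * (norm y)\<^sup>2))" for x y
    by (simp add: norm_mult)
  have int_h: "integrable (lborel \<Otimes>\<^sub>M lborel) (\<lambda>(x, y). ?h x y)"
  proof (rule lborel_pair.Fubini_integrable)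
    show "(\<lambda>(x, y). ?h x y) \<in> borel_measurable (lborel \<Otimes>\<^sub>M lborel)"
      by measurable
    show "integrable lborel (\<lambda>x. \<integral>y. norm (case (x, y) of (x, y) \<Rightarrow> ?h x y) \<partial>lborel)"
      unfolding prod.case nrm using f by simp
    show "AE x in lborel. integrable lborel (\<lambda>y. case (x, y) of (x, y) \<Rightarrow> ?h x y)"
    proof (intro always_eventually allI)
      fix x
      show "integrable lborel (\<lambda>y. case (x, y) of (x, y) \<Rightarrow> ?h x y)"
        unfolding prod.case
        by (rule Bochner_Integration.integrable_bound[OF integrable_mult_right[OF g, of "f x"]])
           (simp_all add: norm_mult)
    qed
  qed
  have inner: "(\<integral>y. ?h x y \<partial>lborel) = complex_of_real (f x * (sqrt (2 * pi / d) ^ DIM('a) * exp (- ((norm (x - z))\<^sup>2 / (2 * d)))))" for x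
  proof -
    have h: "?h x y = of_real (f x) * (of_real (exp (- (d / 2 * (norm y)\<^sup>2))) * cis (y \<bullet> (x - z)))" for y
    proof -
      have "cis (y \<bullet> (x - z)) = cis (x \<bullet> y) * cis (- (z \<bullet> y))"
        by (simp add: cis_mult inner_commute inner_diff_right)
      then show ?thesis by (simp add: mult_ac)
    qed
    show ?thesis unfolding h
      using has_bochner_integral_gaussian_cis[OF d, of "x - z"]
      by (simp add: has_bochner_integral_iff)
  qed
  from lborel_pair.Fubini_integral[OF int_h]
  have "(\<integral>y. \<integral>x. ?h x y \<partial>lborel \<partial>lborel) = (\<integral>x. \<integral>y. ?h x y \<partial>lborel \<partial>lborel)" .
  then show ?thesis
    by (simp only: inner integral_complex_of_real integral_mult_left_zero)
qed

text \<open>Positivity of \<open>g\<close> replaces the usual integrability assumption of the inversion theorem: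
  it turns the Gaussian regularization of \<open>\<integral>g\<close> into a monotone limit.\<close>

lemma fourier_inversion_nonneg:
  fixes f g :: "'a::euclidean_space \<Rightarrow> real"
  assumes int: "integrable lborel f" and cont: "continuous_on UNIV f" and bound: "\<And>x. \<bar>f x\<bar> \<le> B"
    and nonneg: "\<And>y. 0 \<le> g y"
    and fourier: "\<And>y. (\<integral>x. of_real (f x) * cis (x \<bullet> y) \<partial>lborel) = complex_of_real (g y)"
  shows "integrable lborel g"
    and "(\<integral>y. of_real (g y) * cis (- (z \<bullet> y)) \<partial>lborel) = complex_of_real ((2 * pi) ^ DIM('a) * f z)"
proof -
  have [measurable]: "f \<in> borel_measurable borel" using int by simp
  have [measurable]: "cis \<in> borel_measurable borel"
    by (intro borel_measurable_continuous_onI continuous_intros)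
  have "g = (\<lambda>y. Re (\<integral>x. of_real (f x) * cis (x \<bullet> y) \<partial>lborel))"
    by (simp add: fourier)
  also have "\<dots> \<in> borel_measurable borel" by measurable
  finally have [measurable]: "g \<in> borel_measurable borel" .
  \<comment> \<open>This bound makes \<open>g\<close> times a Gaussian integrable before
    \<open>g\<close> itself is known to be integrable.\<close>
  have g_le: "g y \<le> (\<integral>x. \<bar>f x\<bar> \<partial>lborel)" for y
  proof -
    have "g y = norm (\<integral>x. of_real (f x) * cis (x \<bullet> y) \<partial>lborel)"
      using nonneg[of y] by (simp add: fourier)
    also have "\<dots> \<le> (\<integral>x. norm (of_real (f x) * cis (x \<bullet> y)) \<partial>lborel)"
      by (rule integral_norm_bound)
    finally show ?thesis by (simp add: norm_mult)
  qed
  define d where "d n = 1 / real (Suc n)" for n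
  have d: "d n > 0" for n by (simp add: d_def)
  have d0: "d \<longlonglongrightarrow> 0" unfolding d_def by (rule LIMSEQ_Suc) (rule lim_1_over_n)
  define w where "w n y = exp (- (d n / 2 * (norm (y::'a))\<^sup>2))" for n y
  have w_lim: "(\<lambda>n. w n y) \<longlonglongrightarrow> 1" for y
  proof -
    have "(\<lambda>n. w n y) \<longlonglongrightarrow> exp (- (0 / 2 * (norm y)\<^sup>2))"
      unfolding w_def by (intro tendsto_intros d0) auto
    then show ?thesis by simp
  qed
  have w01: "0 \<le> w n y" "w n y \<le> 1" for n y
    using d[of n] by (auto simp: w_def intro!: mult_nonneg_nonneg)
  have [measurable]: "w n \<in> borel_measurable borel" for n
    unfolding w_def by measurable
  have w_int: "integrable lborel (w n)" for n
    using has_bochner_integral_gaussian[OF d[of n], of "0::'a"] by (simp add: has_bochner_integral_iff w_def[abs_def])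
  have gw_int: "integrable lborel (\<lambda>y. g y * w n y)" for n
    by (rule Bochner_Integration.integrable_bound[OF integrable_mult_right[OF w_int[of n], of "\<integral>x. \<bar>f x\<bar> \<partial>lborel"]])
       (use g_le nonneg w01 in \<open>auto simp: abs_mult intro!: mult_right_mono order_trans[OF g_le abs_ge_self]\<close>)
  have eq: "(\<integral>y. of_real (g y * w n y) * cis (- (z \<bullet> y)) \<partial>lborel)
      = complex_of_real (sqrt (2 * pi) ^ DIM('a) * (\<integral>x. f (z + sqrt (d n) *\<^sub>R x) * exp (- ((norm x)\<^sup>2 / 2)) \<partial>lborel))" for n z
  proof -
    have sq: "sqrt (2 * pi / d n) * sqrt (d n) = sqrt (2 * pi)"
      using d[of n] by (simp add: real_sqrt_divide)
    have "(\<integral>y. of_real (g y * w n y) * cis (- (z \<bullet> y)) \<partial>lborel)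
      = complex_of_real (\<integral>x. f x * (sqrt (2 * pi / d n) ^ DIM('a) * exp (- ((norm (x - z))\<^sup>2 / (2 * d n)))) \<partial>lborel)"
      unfolding fourier_gaussian_regularized[OF int d, symmetric] fourier
      by (simp add: w_def mult_ac)
    \<comment> \<open>Substituting \<open>z + sqrt (d n) *\<^sub>R x\<close> moves
      \<open>d n\<close> from the Gaussian into the argument of \<open>f\<close>, where continuity
      and boundedness give the limit.\<close>
    also have "(\<integral>x. f x * (sqrt (2 * pi / d n) ^ DIM('a) * exp (- ((norm (x - z))\<^sup>2 / (2 * d n)))) \<partial>lborel)
      = \<bar>sqrt (d n)\<bar> ^ DIM('a) *\<^sub>R (\<integral>x. f (z + sqrt (d n) *\<^sub>R x) *
           (sqrt (2 * pi / d n) ^ DIM('a) * exp (- ((norm (z + sqrt (d n) *\<^sub>R x - z))\<^sup>2 / (2 * d n)))) \<partial>lborel)"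
      using d[of n] by (intro lborel_affine_integral) auto
    also have "\<dots> = sqrt (2 * pi) ^ DIM('a) * (\<integral>x. f (z + sqrt (d n) *\<^sub>R x) * exp (- ((norm x)\<^sup>2 / 2)) \<partial>lborel)"
      unfolding sq[symmetric] power_mult_distrib
      using d[of n] by (simp add: power_mult_distrib mult.left_commute[of "f _"] mult.commute[of "sqrt (d n) ^ DIM('a)"])
    finally show ?thesis .
  qed
  have lim: "(\<lambda>n. \<integral>y. of_real (g y * w n y) * cis (- (z \<bullet> y)) \<partial>lborel) \<longlonglongrightarrow> complex_of_real ((2 * pi) ^ DIM('a) * f z)" for z
  proof -
    have G: "has_bochner_integral lborel (\<lambda>x::'a. exp (- ((norm x)\<^sup>2 / 2))) (sqrt (2 * pi) ^ DIM('a))"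
      using has_bochner_integral_gaussian[of 1 "0::'a"] by simp
    have "(\<lambda>n. \<integral>x. f (z + sqrt (d n) *\<^sub>R x) * exp (- ((norm x)\<^sup>2 / 2)) \<partial>lborel)
        \<longlonglongrightarrow> (\<integral>x. f z * exp (- ((norm (x::'a))\<^sup>2 / 2)) \<partial>lborel)"
    proof (rule integral_dominated_convergence[where w="\<lambda>x. B * exp (- ((norm x)\<^sup>2 / 2))"])
      show "integrable lborel (\<lambda>x::'a. B * exp (- ((norm x)\<^sup>2 / 2)))"
        using G by (intro integrable_mult_right) (simp add: has_bochner_integral_iff)
      show "AE x in lborel. (\<lambda>n. f (z + sqrt (d n) *\<^sub>R x) * exp (- ((norm x)\<^sup>2 / 2))) \<longlonglongrightarrow> f z * exp (- ((norm x)\<^sup>2 / 2))"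
      proof (intro always_eventually allI tendsto_mult tendsto_const)
        fix x
        have "(\<lambda>n. z + sqrt (d n) *\<^sub>R x) \<longlonglongrightarrow> z + sqrt 0 *\<^sub>R x"
          by (intro tendsto_intros d0)
        then show "(\<lambda>n. f (z + sqrt (d n) *\<^sub>R x)) \<longlonglongrightarrow> f z"
          using continuous_on_tendsto_compose[OF cont, of _ z] by simp
      qed
    qed (use bound in \<open>auto simp: abs_mult intro!: mult_right_mono\<close>)
    also have "(\<integral>x. f z * exp (- ((norm (x::'a))\<^sup>2 / 2)) \<partial>lborel) = f z * sqrt (2 * pi) ^ DIM('a)"
      using G by (simp add: has_bochner_integral_iff)
    finally have "(\<lambda>n. complex_of_real (sqrt (2 * pi) ^ DIM('a) * (\<integral>x. f (z + sqrt (d n) *\<^sub>R x) * exp (- ((norm x)\<^sup>2 / 2)) \<partial>lborel)))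
       \<longlonglongrightarrow> complex_of_real (sqrt (2 * pi) ^ DIM('a) * (f z * sqrt (2 * pi) ^ DIM('a)))"
      by (intro tendsto_intros)
    moreover have "sqrt (2 * pi) ^ DIM('a) * (f z * sqrt (2 * pi) ^ DIM('a)) = (2 * pi) ^ DIM('a) * f z"
    proof -
      have "sqrt (2 * pi) ^ DIM('a) * sqrt (2 * pi) ^ DIM('a) = (2 * pi) ^ DIM('a)"
        unfolding power_mult_distrib[symmetric] by simp
      then show ?thesis by (metis mult.commute mult.left_commute)
    qed
    ultimately show ?thesis unfolding eq by simp
  qed
  show g_int: "integrable lborel g"
  proof (rule integrable_monotone_convergence[where f="\<lambda>n y. g y * w n y"])
    show "AE y in lborel. mono (\<lambda>n. g y * w n y)"
    proof (intro always_eventually allI monoI mult_left_mono nonneg)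
      fix y and m n :: nat assume "m \<le> n"
      then have "d n \<le> d m" by (simp add: d_def frac_le)
      then show "w m y \<le> w n y" by (simp add: w_def mult_right_mono)
    qed
    show "AE y in lborel. (\<lambda>n. g y * w n y) \<longlonglongrightarrow> g y"
      using tendsto_mult[OF tendsto_const w_lim] by auto
    \<comment> \<open>At \<open>z = 0\<close> the oscillating factor is 1, so the integrals of the
      increasing functions \<open>g y * w n y\<close> have a finite limit.\<close>
    show "(\<lambda>n. \<integral>y. g y * w n y \<partial>lborel) \<longlonglongrightarrow> (2 * pi) ^ DIM('a) * f 0"
      using lim[of 0] by (simp flip: of_real_mult add: integral_complex_of_real tendsto_of_real_iff)
  qed (use gw_int in auto)
  have "(\<lambda>n. \<integral>y. of_real (g y * w n y) * cis (- (z \<bullet> y)) \<partial>lborel) \<longlonglongrightarrow> (\<integral>y. of_real (g y) * cis (- (z \<bullet> y)) \<partial>lborel)"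
  proof (rule integral_dominated_convergence[where w=g])
    show "AE y in lborel. (\<lambda>n. complex_of_real (g y * w n y) * cis (- (z \<bullet> y))) \<longlonglongrightarrow> of_real (g y) * cis (- (z \<bullet> y))"
    proof (intro always_eventually allI tendsto_mult tendsto_const tendsto_of_real)
      fix y
      show "(\<lambda>n. g y * w n y) \<longlonglongrightarrow> g y"
        using tendsto_mult[OF tendsto_const w_lim, of "g y" y] by simp
    qed
  qed (use g_int nonneg w01 in \<open>auto simp: norm_mult intro!: mult_left_le\<close>)
  then show "(\<integral>y. of_real (g y) * cis (- (z \<bullet> y)) \<partial>lborel) = complex_of_real ((2 * pi) ^ DIM('a) * f z)"
    using lim LIMSEQ_unique by blast
qed

section \<open>Functions of the frequency with nonnegative transform\<close>

text \<open>The Gaussian factor makes the integral converge for every bounded \<open>f\<close>. Since \<open>c\<close> is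
  arbitrary, the class is stable, by Fubini, under multiplication by mixtures of Gaussians.\<close>

definition gauss_positive :: "('a::euclidean_space \<Rightarrow> real) \<Rightarrow> bool" where
  "gauss_positive f \<longleftrightarrow> f \<in> borel_measurable borel \<and> (\<exists>B. \<forall>x. \<bar>f x\<bar> \<le> B) \<and>
     (\<forall>c>0. \<forall>y. 0 \<le> (\<integral>x. f x * (exp (- (c * (norm x)\<^sup>2)) * cos (x \<bullet> y)) \<partial>lborel))"

text \<open>Acting on the class instead of belonging to it makes products of multipliers immediate;
  a product of two members of \<open>gauss_positive\<close> would require a convolution theorem. The
  bound by 1 keeps infinite products dominated.\<close>

definition gauss_multiplier :: "('a::euclidean_space \<Rightarrow> real) \<Rightarrow> bool" where
  "gauss_multiplier h \<longleftrightarrow> h \<in> borel_measurable borel \<and> (\<forall>x. 0 \<le> h x \<and> h x \<le> 1) \<and>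
     (\<forall>f. gauss_positive f \<longrightarrow> gauss_positive (\<lambda>x. h x * f x))"

lemma gauss_integrable:
  assumes "c > 0"
  shows "integrable lborel (\<lambda>x::'a::euclidean_space. exp (- (c * (norm x)\<^sup>2)))"
  using has_bochner_integral_gaussian[of "2 * c" "0::'a"] assms by (simp add: has_bochner_integral_iff)

lemma gauss_cos_integrable:
  fixes f :: "'a::euclidean_space \<Rightarrow> real"
  assumes "c > 0" and [measurable]: "f \<in> borel_measurable borel" and B: "\<And>x. \<bar>f x\<bar> \<le> B"
  shows "integrable lborel (\<lambda>x. f x * (exp (- (c * (norm x)\<^sup>2)) * cos (x \<bullet> y)))"
proof (rule Bochner_Integration.integrable_bound[OF integrable_mult_right[OF gauss_integrable[OF assms(1)], of B]])
  show "AE x in lborel. norm (f x * (exp (- (c * (norm x)\<^sup>2)) * cos (x \<bullet> y))) \<le> norm (B * exp (- (c * (norm x)\<^sup>2)))"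
  proof (intro always_eventually allI)
    fix x
    have "\<bar>f x\<bar> * (exp (- (c * (norm x)\<^sup>2)) * \<bar>cos (x \<bullet> y)\<bar>) \<le> B * (exp (- (c * (norm x)\<^sup>2)) * 1)"
      using B[of x] by (intro mult_mono) auto
    also have "\<dots> \<le> \<bar>B\<bar> * exp (- (c * (norm x)\<^sup>2))" by (simp add: mult_right_mono)
    finally show "norm (f x * (exp (- (c * (norm x)\<^sup>2)) * cos (x \<bullet> y))) \<le> norm (B * exp (- (c * (norm x)\<^sup>2)))"
      by (simp add: abs_mult)
  qed
qed measurable

text \<open>The seed of the class: applied to it, every multiplier is seen to be
  \<open>gauss_positive\<close> itself.\<close>

lemma gauss_positive_one: "gauss_positive (\<lambda>_::'a::euclidean_space. 1)"
  unfolding gauss_positive_def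
proof (intro conjI allI impI)
  fix c :: real and y :: 'a assume c: "c > 0"
  from has_bochner_integral_gaussian_cis[of "2 * c" y, THEN has_bochner_integral_Re] c
  have "(\<integral>x. exp (- (c * (norm x)\<^sup>2)) * cos (x \<bullet> y) \<partial>lborel)
      = sqrt (2 * pi / (2 * c)) ^ DIM('a) * exp (- ((norm y)\<^sup>2 / (2 * (2 * c))))"
    by (simp add: has_bochner_integral_iff flip: of_real_power)
  also have "\<dots> \<ge> 0" using c by simp
  finally show "0 \<le> (\<integral>x. 1 * (exp (- (c * (norm x)\<^sup>2)) * cos (x \<bullet> y)) \<partial>lborel)"
    by simp
qed (auto intro: exI[of _ 1])

text \<open>The Gaussian in the definition supplies an integrable majorant, so a uniform bound on
  \<open>F n\<close> suffices.\<close>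

lemma gauss_positive_LIMSEQ:
  assumes F: "\<And>n. gauss_positive (F n)" and B: "\<And>n x. \<bar>F n x\<bar> \<le> B" and lim: "\<And>x. (\<lambda>n. F n x) \<longlonglongrightarrow> f x"
  shows "gauss_positive f"
  unfolding gauss_positive_def
proof (intro conjI allI impI)
  have Fm[measurable]: "F n \<in> borel_measurable borel" for n
    using F by (simp add: gauss_positive_def)
  show fm[measurable]: "f \<in> borel_measurable borel"
    by (rule borel_measurable_LIMSEQ_real[OF _ Fm]) (rule lim)
  have fB: "\<bar>f x\<bar> \<le> B" for x
    using tendsto_rabs[OF lim[of x]] by (rule LIMSEQ_le_const2) (auto simp: B)
  then show "\<exists>B. \<forall>x. \<bar>f x\<bar> \<le> B" by blast
  fix c :: real and y assume c: "c > 0"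
  have "(\<lambda>n. \<integral>x. F n x * (exp (- (c * (norm x)\<^sup>2)) * cos (x \<bullet> y)) \<partial>lborel)
      \<longlonglongrightarrow> (\<integral>x. f x * (exp (- (c * (norm x)\<^sup>2)) * cos (x \<bullet> y)) \<partial>lborel)"
  proof (rule integral_dominated_convergence[where w="\<lambda>x. B * exp (- (c * (norm x)\<^sup>2))"])
    show "AE x in lborel. norm (F n x * (exp (- (c * (norm x)\<^sup>2)) * cos (x \<bullet> y))) \<le> B * exp (- (c * (norm x)\<^sup>2))" for n
    proof (intro always_eventually allI)
      fix x
      have "\<bar>F n x\<bar> * (exp (- (c * (norm x)\<^sup>2)) * \<bar>cos (x \<bullet> y)\<bar>) \<le> B * (exp (- (c * (norm x)\<^sup>2)) * 1)"
        using B[of n x] by (intro mult_mono) auto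
      then show "norm (F n x * (exp (- (c * (norm x)\<^sup>2)) * cos (x \<bullet> y))) \<le> B * exp (- (c * (norm x)\<^sup>2))"
        by (simp add: abs_mult)
    qed
  qed (auto intro!: integrable_mult_right gauss_integrable c tendsto_mult lim tendsto_const)
  then show "0 \<le> (\<integral>x. f x * (exp (- (c * (norm x)\<^sup>2)) * cos (x \<bullet> y)) \<partial>lborel)"
    by (rule LIMSEQ_le_const) (use F c in \<open>auto simp: gauss_positive_def\<close>)
qed

lemma gauss_multiplierD:
  assumes "gauss_multiplier h"
  shows "h \<in> borel_measurable borel" "0 \<le> h x" "h x \<le> 1"
    "gauss_positive f \<Longrightarrow> gauss_positive (\<lambda>x. h x * f x)"
  using assms by (auto simp: gauss_multiplier_def)

lemma gauss_multiplierI: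
  assumes [measurable]: "h \<in> borel_measurable borel" and h: "\<And>x. 0 \<le> h x" "\<And>x. h x \<le> 1"
    and pos: "\<And>f c y. gauss_positive f \<Longrightarrow> c > 0 \<Longrightarrow>
       0 \<le> (\<integral>x. h x * f x * (exp (- (c * (norm x)\<^sup>2)) * cos (x \<bullet> y)) \<partial>lborel)"
  shows "gauss_multiplier h"
  unfolding gauss_multiplier_def
proof (intro conjI allI impI h assms(1))
  fix f :: "'a \<Rightarrow> real" assume f: "gauss_positive f"
  then obtain B where B: "\<And>x. \<bar>f x\<bar> \<le> B" and [measurable]: "f \<in> borel_measurable borel"
    by (auto simp: gauss_positive_def)
  show "gauss_positive (\<lambda>x. h x * f x)"
    unfolding gauss_positive_def
  proof (intro conjI allI impI)
    have "\<bar>h x * f x\<bar> \<le> B" for x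
    proof -
      have "\<bar>h x\<bar> * \<bar>f x\<bar> \<le> 1 * B" using h[of x] B[of x] by (intro mult_mono) auto
      then show ?thesis by (simp add: abs_mult)
    qed
    then show "\<exists>B. \<forall>x. \<bar>h x * f x\<bar> \<le> B" by blast
  qed (use pos[OF f] in auto)
qed

lemma gauss_multiplier_const:
  assumes "0 \<le> c" "c \<le> 1"
  shows "gauss_multiplier (\<lambda>_. c)"
  by (rule gauss_multiplierI) (use assms in \<open>auto simp: gauss_positive_def mult.assoc\<close>)

lemma gauss_multiplier_mult:
  assumes "gauss_multiplier g" "gauss_multiplier h"
  shows "gauss_multiplier (\<lambda>x. g x * h x)"
  unfolding gauss_multiplier_def
proof (intro conjI allI impI)
  show "(\<lambda>x. g x * h x) \<in> borel_measurable borel"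
    using assms[THEN gauss_multiplierD(1)] by measurable
  show "g x * h x \<le> 1" for x
    using assms[THEN gauss_multiplierD(2), of x] assms[THEN gauss_multiplierD(3), of x] by (simp add: mult_le_one)
  show "0 \<le> g x * h x" for x
    using assms[THEN gauss_multiplierD(2), of x] by simp
  show "gauss_positive (\<lambda>x. g x * h x * f x)" if "gauss_positive f" for f
    using gauss_multiplierD(4)[OF assms(1) gauss_multiplierD(4)[OF assms(2) that]] by (simp add: mult.assoc)
qed

lemma gauss_multiplier_prod:
  "finite A \<Longrightarrow> (\<And>i. i \<in> A \<Longrightarrow> gauss_multiplier (h i)) \<Longrightarrow> gauss_multiplier (\<lambda>x. \<Prod>i\<in>A. h i x)"
  by (induction A rule: finite_induct) (auto intro: gauss_multiplier_const gauss_multiplier_mult)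

lemma gauss_multiplier_power: "gauss_multiplier h \<Longrightarrow> gauss_multiplier (\<lambda>x. h x ^ n)"
  by (induction n) (auto intro: gauss_multiplier_const gauss_multiplier_mult)

text \<open>The integrals are linear in the multiplier. This serves to recognize a quotient of two
  affine functions of |x|^2 as a mixture.\<close>

lemma gauss_multiplier_convex:
  fixes h :: "'a::euclidean_space \<Rightarrow> real"
  assumes h: "gauss_multiplier h" and a: "0 \<le> a" "a \<le> 1"
  shows "gauss_multiplier (\<lambda>x. a + (1 - a) * h x)"
proof (rule gauss_multiplierI)
  note [measurable] = gauss_multiplierD(1)[OF h]
  show "(\<lambda>x. a + (1 - a) * h x) \<in> borel_measurable borel" by measurable
  show "0 \<le> a + (1 - a) * h x" for x using gauss_multiplierD(2)[OF h, of x] a by simp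
  show "a + (1 - a) * h x \<le> 1" for x
    using mult_left_mono[OF gauss_multiplierD(3)[OF h, of x], of "1 - a"] a by simp
  fix f :: "'a \<Rightarrow> real" and c :: real and y assume f: "gauss_positive f" and c: "c > 0"
  let ?e = "\<lambda>x::'a. exp (- (c * (norm x)\<^sup>2)) * cos (x \<bullet> y)"
  have hf: "gauss_positive (\<lambda>x. h x * f x)" by (rule gauss_multiplierD(4)[OF h f])
  have int: "integrable lborel (\<lambda>x. g x * ?e x)" if "gauss_positive g" for g
    using that c by (auto simp: gauss_positive_def intro: gauss_cos_integrable)
  have "(\<integral>x. (a + (1 - a) * h x) * f x * ?e x \<partial>lborel)
      = (\<integral>x. a * (f x * ?e x) + (1 - a) * (h x * f x * ?e x) \<partial>lborel)"
    by (intro Bochner_Integration.integral_cong) (auto simp: algebra_simps)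
  also have "\<dots> = a * (\<integral>x. f x * ?e x \<partial>lborel) + (1 - a) * (\<integral>x. h x * f x * ?e x \<partial>lborel)"
    using int[OF f] int[OF hf] by simp
  also have "\<dots> \<ge> 0"
    using f hf a c by (auto simp: gauss_positive_def)
  finally show "0 \<le> (\<integral>x. (a + (1 - a) * h x) * f x * ?e x \<partial>lborel)" .
qed

lemma gauss_multiplier_LIMSEQ:
  assumes H: "\<And>n. gauss_multiplier (H n)" and lim: "\<And>x. (\<lambda>n. H n x) \<longlonglongrightarrow> h x"
  shows "gauss_multiplier h"
  unfolding gauss_multiplier_def
proof (intro conjI allI impI)
  show "h \<in> borel_measurable borel"
    by (rule borel_measurable_LIMSEQ_real[OF _ gauss_multiplierD(1)[OF H]]) (rule lim)
  show "0 \<le> h x" for x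
    by (rule LIMSEQ_le_const[OF lim]) (auto simp: gauss_multiplierD(2)[OF H])
  show "h x \<le> 1" for x
    by (rule LIMSEQ_le_const2[OF lim]) (auto simp: gauss_multiplierD(3)[OF H])
  fix f :: "'a \<Rightarrow> real" assume f: "gauss_positive f"
  then obtain B where B: "\<And>x. \<bar>f x\<bar> \<le> B" by (auto simp: gauss_positive_def)
  show "gauss_positive (\<lambda>x. h x * f x)"
  proof (rule gauss_positive_LIMSEQ[where F="\<lambda>n x. H n x * f x" and B=B])
    show "gauss_positive (\<lambda>x. H n x * f x)" for n by (rule gauss_multiplierD(4)[OF H f])
    show "\<bar>H n x * f x\<bar> \<le> B" for n x
    proof -
      have "\<bar>H n x\<bar> * \<bar>f x\<bar> \<le> 1 * B"
        using gauss_multiplierD(2,3)[OF H, of n x] B[of x] by (intro mult_mono) auto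
      then show ?thesis by (simp add: abs_mult)
    qed
  qed (intro tendsto_mult lim tendsto_const)
qed

text \<open>Up to the factor \<open>sqrt (2 * pi)\<close> the function is the integral over z of
  exp(-(1 + c |x|^2) z^2 / 2), a mixture of Gaussians in x.\<close>

lemma gauss_multiplier_inv_sqrt:
  assumes c: "c \<ge> 0"
  shows "gauss_multiplier (\<lambda>x::'a::euclidean_space. 1 / sqrt (1 + c * (norm x)\<^sup>2))"
proof (rule gauss_multiplierI)
  have le1: "1 / sqrt (1 + c * (norm x)\<^sup>2) \<le> 1" for x :: 'a
  proof -
    have "1 \<le> sqrt (1 + c * (norm x)\<^sup>2)" using c by simp
    then show ?thesis by (simp add: divide_le_eq_1)
  qed
  then show "1 / sqrt (1 + c * (norm x)\<^sup>2) \<le> 1" for x :: 'a .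
  fix f :: "'a \<Rightarrow> real" and e y assume f: "gauss_positive f" and e: "(e::real) > 0"
  then obtain B where B: "\<And>x. \<bar>f x\<bar> \<le> B" and [measurable]: "f \<in> borel_measurable borel"
    by (auto simp: gauss_positive_def)
  let ?e = "\<lambda>x::'a. exp (- (e * (norm x)\<^sup>2)) * cos (x \<bullet> y)"
  let ?k = "\<lambda>(x::'a) (z::real). f x * ?e x * exp (- ((1 + c * (norm x)\<^sup>2) / 2 * z\<^sup>2))"
  have G: "has_bochner_integral lborel (\<lambda>z. exp (- ((1 + c * (norm x)\<^sup>2) / 2 * z\<^sup>2)))
         (sqrt (2 * pi) * (1 / sqrt (1 + c * (norm x)\<^sup>2)))" for x :: 'a
  proof -
    have "1 + c * (norm x)\<^sup>2 > 0" using c by (simp add: add_pos_nonneg)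
    from has_bochner_integral_gaussian_real[OF this, of 0] show ?thesis
      by (simp add: real_sqrt_divide)
  qed
  have fe: "integrable lborel (\<lambda>x. f x * ?e x)"
    by (rule gauss_cos_integrable) (use e B in auto)
  have g1: "integrable lborel (\<lambda>z::real. exp (- (z\<^sup>2 / 2)))"
    using has_bochner_integral_gaussian_real[of 1 0] by (simp add: has_bochner_integral_iff)
  have int: "integrable (lborel \<Otimes>\<^sub>M lborel) (\<lambda>(x, z). ?k x z)"
  proof (rule lborel_pair.Fubini_integrable)
    show "(\<lambda>(x, z). ?k x z) \<in> borel_measurable (lborel \<Otimes>\<^sub>M lborel)" by measurable
    have eq: "(\<integral>z. norm (case (x, z) of (x, z) \<Rightarrow> ?k x z) \<partial>lborel)
       = \<bar>f x * ?e x\<bar> * (sqrt (2 * pi) * (1 / sqrt (1 + c * (norm x)\<^sup>2)))" for x :: 'a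
      using G[of x] by (simp add: has_bochner_integral_iff abs_mult)
    show "integrable lborel (\<lambda>x. \<integral>z. norm (case (x, z) of (x, z) \<Rightarrow> ?k x z) \<partial>lborel)"
      unfolding eq
    proof (rule Bochner_Integration.integrable_bound[OF integrable_mult_left[OF integrable_abs[OF fe], of "sqrt (2 * pi)"]])
      show "AE x in lborel. norm (\<bar>f x * ?e x\<bar> * (sqrt (2 * pi) * (1 / sqrt (1 + c * (norm x)\<^sup>2))))
              \<le> norm (\<bar>f x * ?e x\<bar> * sqrt (2 * pi))"
      proof (intro always_eventually allI)
        fix x :: 'a
        have "0 \<le> 1 / sqrt (1 + c * (norm x)\<^sup>2)" "1 / sqrt (1 + c * (norm x)\<^sup>2) \<le> 1" using c le1[of x] by simp_all
        then show "norm (\<bar>f x * ?e x\<bar> * (sqrt (2 * pi) * (1 / sqrt (1 + c * (norm x)\<^sup>2))))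
              \<le> norm (\<bar>f x * ?e x\<bar> * sqrt (2 * pi))"
          unfolding real_norm_def abs_mult[of "\<bar>f x * ?e x\<bar>"] abs_idempotent
          by (intro mult_left_mono) (use mult_left_le[of "1 / sqrt (1 + c * (norm x)\<^sup>2)" "sqrt (2 * pi)"] c in \<open>auto simp: abs_mult\<close>)
      qed
    qed measurable
    show "AE x in lborel. integrable lborel (\<lambda>z. case (x, z) of (x, z) \<Rightarrow> ?k x z)"
      unfolding prod.case using G by (intro always_eventually allI integrable_mult_right) (auto simp: has_bochner_integral_iff)
  qed
  have "0 \<le> (\<integral>z. \<integral>x. ?k x z \<partial>lborel \<partial>lborel)"
  proof (rule Bochner_Integration.integral_nonneg)
    fix z :: real
    \<comment> \<open>For fixed \<open>z\<close> the mixture merely raises the Gaussian parameter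
      from \<open>e\<close> to e + c z^2 / 2, which the arbitrary parameter in
      \<open>gauss_positive\<close> permits.\<close>
    have k: "?k x z = exp (- (z\<^sup>2 / 2)) * (f x * (exp (- ((e + c / 2 * z\<^sup>2) * (norm x)\<^sup>2)) * cos (x \<bullet> y)))" for x :: 'a
      by (simp add: exp_add[symmetric] algebra_simps add_divide_distrib exp_diff exp_minus)
    moreover have "0 \<le> (\<integral>x. f x * (exp (- ((e + c / 2 * z\<^sup>2) * (norm x)\<^sup>2)) * cos (x \<bullet> y)) \<partial>lborel)"
    proof -
      have "e + c / 2 * z\<^sup>2 > 0" using e c by (simp add: add_pos_nonneg)
      with f show ?thesis unfolding gauss_positive_def by blast
    qed
    ultimately show "0 \<le> (\<integral>x. ?k x z \<partial>lborel)"
      unfolding k by simp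
  qed
  also have "\<dots> = (\<integral>x. \<integral>z. ?k x z \<partial>lborel \<partial>lborel)"
    by (rule lborel_pair.Fubini_integral[OF int])
  also have "\<dots> = (\<integral>x. sqrt (2 * pi) * (1 / sqrt (1 + c * (norm x)\<^sup>2) * f x * ?e x) \<partial>lborel)"
    using G by (intro Bochner_Integration.integral_cong) (auto simp: has_bochner_integral_iff)
  finally have "0 \<le> sqrt (2 * pi) * (\<integral>x. 1 / sqrt (1 + c * (norm x)\<^sup>2) * f x * ?e x \<partial>lborel)"
    by (simp only: integral_mult_right_zero)
  then show "0 \<le> (\<integral>x. 1 / sqrt (1 + c * (norm x)\<^sup>2) * f x * ?e x \<partial>lborel)"
    using pi_gt_zero unfolding zero_le_mult_iff by auto
qed (use c in auto)

text \<open>With r = |x|^2, (1 + a r) / (1 + b r) = a/b + (1 - a/b) / (1 + b r). This is a convex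
  combination because a is at most b, and 1 / (1 + b r) is the square of the preceding
  multiplier.\<close>

lemma gauss_multiplier_ratio:
  assumes "0 \<le> a" "a \<le> b"
  shows "gauss_multiplier (\<lambda>x. (1 + a * (norm x)\<^sup>2) / (1 + b * (norm x)\<^sup>2))"
proof (cases "b = 0")
  case True
  with assms show ?thesis by (simp add: gauss_multiplier_const)
next
  case False
  with assms have b: "b > 0" by simp
  have "gauss_multiplier (\<lambda>x::'a. a / b + (1 - a / b) * (1 / sqrt (1 + b * (norm x)\<^sup>2)) ^ 2)"
    using assms b by (intro gauss_multiplier_convex gauss_multiplier_power gauss_multiplier_inv_sqrt) auto
  moreover have "a / b + (1 - a / b) * (1 / sqrt (1 + b * (norm x)\<^sup>2)) ^ 2 = (1 + a * (norm x)\<^sup>2) / (1 + b * (norm x)\<^sup>2)" for x :: 'a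
  proof -
    have p: "1 + b * (norm x)\<^sup>2 > 0" using b by (simp add: add_pos_nonneg)
    then have "(1 / sqrt (1 + b * (norm x)\<^sup>2)) ^ 2 = 1 / (1 + b * (norm x)\<^sup>2)"
      by (simp add: power_divide)
    then show ?thesis using p b by (simp add: divide_simps) (simp add: algebra_simps)
  qed
  ultimately show ?thesis by simp
qed

text \<open>The exponential of a logarithmic derivative is the limit of the multipliers
  \<open>(T t / T (t + a / m)) ^ m\<close>.\<close>

lemma gauss_multiplier_log_derivative:
  fixes T :: "real \<Rightarrow> 'a::euclidean_space \<Rightarrow> real"
  assumes prod: "\<And>s x. s > 0 \<Longrightarrow> (\<lambda>n. \<Prod>k=1..n. 1 + c k * s\<^sup>2 * (norm x)\<^sup>2) \<longlonglongrightarrow> T s x"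
    and c: "\<And>k. c k \<ge> 0" and T: "\<And>s x. s > 0 \<Longrightarrow> T s x > 0"
    and D: "\<And>x. ((\<lambda>s. ln (T s x)) has_real_derivative D x) (at t)" and t: "t > 0" and a: "a \<ge> 0"
  shows "gauss_multiplier (\<lambda>x. exp (- (a * D x)))"
proof (cases "a = 0")
  case True
  then show ?thesis by (simp add: gauss_multiplier_const)
next
  case False
  with a have a: "a > 0" by simp
  \<comment> \<open>Passing from \<open>t\<close> to the larger \<open>s\<close> increases every
    coefficient, so the quotient is a multiplier factor by factor.\<close>
  have ratio: "gauss_multiplier (\<lambda>x. T t x / T s x)" if s: "t \<le> s" for s
  proof (rule gauss_multiplier_LIMSEQ)
    show "gauss_multiplier (\<lambda>x::'a. \<Prod>k=1..n. (1 + c k * t\<^sup>2 * (norm x)\<^sup>2) / (1 + c k * s\<^sup>2 * (norm x)\<^sup>2))" for n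
      using t s c by (intro gauss_multiplier_prod gauss_multiplier_ratio mult_left_mono power_mono mult_nonneg_nonneg) auto
    show "(\<lambda>n. \<Prod>k=1..n. (1 + c k * t\<^sup>2 * (norm x)\<^sup>2) / (1 + c k * s\<^sup>2 * (norm x)\<^sup>2)) \<longlonglongrightarrow> T t x / T s x" for x
      unfolding prod_dividef using t s T[of s x] by (intro tendsto_divide prod) auto
  qed
  \<comment> \<open>Chosen so that \<open>real (Suc m) = a / h m\<close>: the power of the quotient
    is then the exponential of \<open>- a\<close> times a difference quotient.\<close>
  define h where "h m = a / real (Suc m)" for m
  have h: "h m > 0" for m using a by (simp add: h_def)
  have h0: "filterlim h (at 0) sequentially"
    unfolding filterlim_at
  proof
    have "(\<lambda>m. a * (1 / real (Suc m))) \<longlonglongrightarrow> a * 0"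
      by (intro tendsto_intros LIMSEQ_Suc lim_1_over_n)
    then show "h \<longlonglongrightarrow> 0" by (simp add: h_def[abs_def])
    show "\<forall>\<^sub>F m in sequentially. h m \<in> UNIV \<and> h m \<noteq> 0"
      using h by (simp add: less_imp_neq[symmetric])
  qed
  show ?thesis
  proof (rule gauss_multiplier_LIMSEQ)
    show "gauss_multiplier (\<lambda>x. (T t x / T (t + h m) x) ^ Suc m)" for m
      using h[of m] by (intro gauss_multiplier_power ratio) auto
    fix x
    have "((\<lambda>h. (ln (T (t + h) x) - ln (T t x)) / h) \<longlongrightarrow> D x) (at 0)"
      using D[of x] by (simp add: DERIV_def)
    from filterlim_compose[OF this h0]
    have "(\<lambda>m. exp (- (a * ((ln (T (t + h m) x) - ln (T t x)) / h m)))) \<longlonglongrightarrow> exp (- (a * D x))"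
      by (intro tendsto_intros)
    moreover have "exp (- (a * ((ln (T (t + h m) x) - ln (T t x)) / h m))) = (T t x / T (t + h m) x) ^ Suc m" for m
    proof -
      have p: "T t x > 0" "T (t + h m) x > 0" using T t h[of m] by auto
      have "(T t x / T (t + h m) x) ^ Suc m = exp (ln (T t x) - ln (T (t + h m) x)) ^ Suc m"
        using p by (simp add: exp_diff)
      also have "\<dots> = exp (real (Suc m) * (ln (T t x) - ln (T (t + h m) x)))"
        by (rule exp_of_nat_mult[symmetric])
      also have "real (Suc m) * (ln (T t x) - ln (T (t + h m) x)) = - (a * ((ln (T (t + h m) x) - ln (T t x)) / h m))"
        using a by (simp add: h_def field_simps)
      finally show ?thesis ..
    qed
    ultimately show "(\<lambda>m. (T t x / T (t + h m) x) ^ Suc m) \<longlonglongrightarrow> exp (- (a * D x))"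
      by simp
  qed
qed

text \<open>Integrability of \<open>h\<close> now provides the majorant, so the Gaussian can be
  removed by letting its parameter tend to 0.\<close>

lemma gauss_multiplier_cos_integral_nonneg:
  assumes h: "gauss_multiplier h" and int: "integrable lborel h"
  shows "0 \<le> (\<integral>x. h x * cos (x \<bullet> y) \<partial>lborel)"
proof -
  note [measurable] = gauss_multiplierD(1)[OF h]
  have h1: "gauss_positive h" using gauss_multiplierD(4)[OF h gauss_positive_one] by simp
  define d where "d n = 1 / real (Suc n)" for n
  have d: "d n > 0" for n by (simp add: d_def)
  have d0: "d \<longlonglongrightarrow> 0" unfolding d_def by (rule LIMSEQ_Suc) (rule lim_1_over_n)
  have "(\<lambda>n. \<integral>x. h x * (exp (- (d n * (norm x)\<^sup>2)) * cos (x \<bullet> y)) \<partial>lborel)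
      \<longlonglongrightarrow> (\<integral>x. h x * cos (x \<bullet> y) \<partial>lborel)"
  proof (rule integral_dominated_convergence[where w=h])
    show "AE x in lborel. (\<lambda>n. h x * (exp (- (d n * (norm x)\<^sup>2)) * cos (x \<bullet> y))) \<longlonglongrightarrow> h x * cos (x \<bullet> y)"
    proof (intro always_eventually allI)
      fix x
      have "(\<lambda>n. h x * (exp (- (d n * (norm x)\<^sup>2)) * cos (x \<bullet> y))) \<longlonglongrightarrow> h x * (exp (- (0 * (norm x)\<^sup>2)) * cos (x \<bullet> y))"
        by (intro tendsto_intros d0)
      then show "(\<lambda>n. h x * (exp (- (d n * (norm x)\<^sup>2)) * cos (x \<bullet> y))) \<longlonglongrightarrow> h x * cos (x \<bullet> y)" by simp
    qed
    show "AE x in lborel. norm (h x * (exp (- (d n * (norm x)\<^sup>2)) * cos (x \<bullet> y))) \<le> h x" for n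
    proof (intro always_eventually allI)
      fix x
      have "h x * (exp (- (d n * (norm x)\<^sup>2)) * \<bar>cos (x \<bullet> y)\<bar>) \<le> h x * (1 * 1)"
        using gauss_multiplierD(2)[OF h, of x] by (intro mult_mono) (auto simp: d_def)
      then show "norm (h x * (exp (- (d n * (norm x)\<^sup>2)) * cos (x \<bullet> y))) \<le> h x"
        using gauss_multiplierD(2)[OF h, of x] by (simp add: abs_mult)
    qed
  qed (use int in auto)
  then show ?thesis
    by (rule LIMSEQ_le_const) (use h1 d in \<open>auto simp: gauss_positive_def\<close>)
qed

section \<open>The Mehler kernel\<close>

definition shc :: "real \<Rightarrow> real" where
  "shc x = (if x = 0 then 1 else sinh x / x)"

text \<open>Euler's product for the sine at i x / pi, divided by i x.\<close>

lemma shc_product: "(\<lambda>n. \<Prod>k=1..n. 1 + 1 / (pi\<^sup>2 * (real k)\<^sup>2) * x\<^sup>2) \<longlonglongrightarrow> shc x"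
proof (cases "x = 0")
  case True
  then show ?thesis by (simp add: shc_def)
next
  case False
  let ?z = "\<i> * complex_of_real (x / pi)"
  have "(\<lambda>n. of_real pi * ?z * (\<Prod>k=1..n. 1 - ?z\<^sup>2 / of_nat k^2)) \<longlonglongrightarrow> sin (of_real pi * ?z)"
    by (rule sin_product_formula_complex)
  also have "of_real pi * ?z = \<i> * of_real x" by simp
  also have "sin (\<i> * complex_of_real x) = \<i> * of_real (sinh x)"
    using sinh_conv_sin[of "complex_of_real x"] by (simp add: sinh_field_def exp_of_real flip: of_real_minus)
  also have "(\<lambda>n. \<i> * of_real x * (\<Prod>k=1..n. 1 - ?z\<^sup>2 / of_nat k^2)) = (\<lambda>n. \<i> * of_real x * complex_of_real (\<Prod>k=1..n. 1 + 1 / (pi\<^sup>2 * (real k)\<^sup>2) * x\<^sup>2))"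
    unfolding of_real_prod by (intro ext arg_cong2[where f=times] prod.cong refl) (simp add: power_mult_distrib power_divide)
  finally have "(\<lambda>n. \<i> * of_real x * complex_of_real (\<Prod>k=1..n. 1 + 1 / (pi\<^sup>2 * (real k)\<^sup>2) * x\<^sup>2))
      \<longlonglongrightarrow> \<i> * of_real (sinh x)" .
  from tendsto_mult[OF tendsto_const[of "- \<i> / of_real x"] this]
  have "(\<lambda>n. complex_of_real (\<Prod>k=1..n. 1 + 1 / (pi\<^sup>2 * (real k)\<^sup>2) * x\<^sup>2)) \<longlonglongrightarrow> of_real (sinh x / x)"
    using False by simp
  then show ?thesis using False by (simp only: tendsto_of_real_iff shc_def if_False)
qed

lemma shc_ge_1: "1 \<le> shc x"
  by (rule LIMSEQ_le_const[OF shc_product]) (auto intro!: exI[of _ 0] prod_ge_1)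

lemma shc_pos [simp]: "0 < shc x"
  using shc_ge_1[of x] by linarith

lemma shc_nonzero [simp]: "shc x \<noteq> 0"
  using shc_pos[of x] by linarith

lemma shc_0 [simp]: "shc 0 = 1"
  by (simp add: shc_def)

lemma shc_minus [simp]: "shc (- x) = shc x"
  by (simp add: shc_def)

lemma shc_double: "shc (2 * x) = shc x * cosh x"
  by (simp add: shc_def sinh_double)

text \<open>Halving the argument trades the denominator of \<open>shc\<close> for a smaller
  exponential rate, via \<open>shc_double\<close> and \<open>shc_ge_1\<close>.\<close>

lemma shc_ge_exp:
  "shc x \<ge> exp (x / 2) / 2"
proof -
  have "exp (x / 2) / 2 \<le> cosh (x / 2)" by (simp add: cosh_def)
  also have "\<dots> \<le> shc (x / 2) * cosh (x / 2)"
    using mult_right_mono[OF shc_ge_1[of "x / 2"], of "cosh (x / 2)"] by simp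
  finally show ?thesis using shc_double[of "x / 2"] by simp
qed

lemma continuous_on_shc: "continuous_on UNIV shc"
proof (rule continuous_at_imp_continuous_on, rule ballI)
  fix x :: real
  show "isCont shc x"
  proof (cases "x = 0")
    case True
    have "(sinh has_real_derivative cosh 0) (at (0::real))"
      by (auto intro!: derivative_eq_intros)
    then have "((\<lambda>h::real. sinh h / h) \<longlongrightarrow> 1) (at 0)"
      by (simp add: DERIV_def)
    then have "(shc \<longlongrightarrow> 1) (at 0)"
      by (rule Lim_transform_eventually) (auto simp: eventually_at_filter shc_def)
    with True show ?thesis by (simp add: isCont_def)
  next
    case False
    have "isCont (\<lambda>x. sinh x / x) x" using False by (intro continuous_intros) auto
    moreover have "\<forall>\<^sub>F y in nhds x. shc y = sinh y / y"
      using eventually_nhds_in_open[of "- {0}" x] False by (auto elim!: eventually_mono simp: shc_def)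
    ultimately show ?thesis by (simp add: isCont_cong)
  qed
qed

lemmas continuous_on_shc' [continuous_intros] = continuous_on_compose2[OF continuous_on_shc _ subset_UNIV]

lemma tendsto_shc [tendsto_intros]:
  "(f \<longlongrightarrow> l) F \<Longrightarrow> ((\<lambda>x. shc (f x)) \<longlongrightarrow> shc l) F"
  using continuous_on_shc by (simp add: continuous_on_eq_continuous_at isCont_tendsto_compose)

lemma borel_measurable_shc [measurable]: "shc \<in> borel_measurable borel"
  by (rule borel_measurable_continuous_onI[OF continuous_on_shc])

lemma borel_measurable_cosh_real [measurable]: "(cosh :: real \<Rightarrow> real) \<in> borel_measurable borel"
  by (intro borel_measurable_continuous_onI continuous_intros)

text \<open>cosh x is the quotient of \<open>shc (2 * x)\<close> and \<open>shc x\<close>. In the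
  product for 2 x the factors of even index form the product for x and cancel; those of odd index
  remain.\<close>

lemma cosh_product:
  "(\<lambda>n. \<Prod>k=1..n. 1 + 4 / (pi\<^sup>2 * (2 * real k - 1)\<^sup>2) * x\<^sup>2) \<longlonglongrightarrow> cosh x"
proof -
  let ?p = "\<lambda>x n. \<Prod>k=1..n. 1 + 1 / (pi\<^sup>2 * (real k)\<^sup>2) * x\<^sup>2"
  have split: "?p (2 * x) (2 * n) = ?p x n * (\<Prod>k=1..n. 1 + 4 / (pi\<^sup>2 * (2 * real k - 1)\<^sup>2) * x\<^sup>2)" for n
  proof (induction n)
    case (Suc n)
    have "?p (2 * x) (2 * Suc n) = ?p (2 * x) (2 * n) *
        ((1 + 1 / (pi\<^sup>2 * (real (2 * n + 1))\<^sup>2) * (2 * x)\<^sup>2) * (1 + 1 / (pi\<^sup>2 * (real (2 * n + 2))\<^sup>2) * (2 * x)\<^sup>2))"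
      by (simp add: mult.assoc)
    also have "1 + 1 / (pi\<^sup>2 * (real (2 * n + 2))\<^sup>2) * (2 * x)\<^sup>2 = 1 + 1 / (pi\<^sup>2 * (real (Suc n))\<^sup>2) * x\<^sup>2"
    proof -
      have "real (2 * n + 2) = 2 * real (Suc n)" by simp
      then show ?thesis by (simp only: power_mult_distrib) (simp add: field_simps)
    qed
    also have "1 + 1 / (pi\<^sup>2 * (real (2 * n + 1))\<^sup>2) * (2 * x)\<^sup>2 = 1 + 4 / (pi\<^sup>2 * (2 * real (Suc n) - 1)\<^sup>2) * x\<^sup>2"
    proof -
      have "real (2 * n + 1) = 2 * real (Suc n) - 1" by simp
      then show ?thesis by (simp only: power_mult_distrib) simp
    qed
    finally show ?case unfolding Suc.IH by (simp add: mult_ac)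
  qed simp
  have pos: "?p x n > 0" for n by (intro prod_pos) (simp add: add_pos_nonneg)
  have "filterlim (\<lambda>n::nat. 2 * n) at_top sequentially"
    by (rule filterlim_subseq) (simp add: strict_mono_def)
  from filterlim_compose[OF shc_product[of "2 * x"] this]
  have "(\<lambda>n. ?p (2 * x) (2 * n) / ?p x n) \<longlonglongrightarrow> shc (2 * x) / shc x"
    by (rule tendsto_divide[OF _ shc_product]) (auto simp: less_imp_neq[symmetric])
  moreover have "?p (2 * x) (2 * n) / ?p x n = (\<Prod>k=1..n. 1 + 4 / (pi\<^sup>2 * (2 * real k - 1)\<^sup>2) * x\<^sup>2)" for n
    unfolding split using pos[of n] by (simp only: nonzero_mult_div_cancel_left less_imp_neq[symmetric] simp_thms)
  moreover have "shc (2 * x) / shc x = cosh x"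
    by (simp add: shc_double less_imp_neq[symmetric])
  ultimately show ?thesis by simp
qed

section \<open>Hyperbolic coefficients of the Mehler kernel\<close>

definition mehler_H :: "real \<Rightarrow> real \<Rightarrow> real" where
  "mehler_H t a = t * shc (t * a)"

lemma mehler_H_pos [simp]: "t > 0 \<Longrightarrow> mehler_H t a > 0"
  by (simp add: mehler_H_def)

lemma mehler_H_nonzero: "t > 0 \<Longrightarrow> mehler_H t a \<noteq> 0"
  using mehler_H_pos[of t a] by linarith

lemma mehler_H_0 [simp]: "mehler_H t 0 = t"
  by (simp add: mehler_H_def)

lemma mehler_H_minus: "mehler_H (- t) a = - mehler_H t a"
  by (simp add: mehler_H_def)

lemma mehler_H_eq: "a \<noteq> 0 \<Longrightarrow> mehler_H t a = sinh (t * a) / a"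
  by (cases "t = 0") (auto simp: mehler_H_def shc_def)

lemma mehler_H_add: "mehler_H (t + s) a = mehler_H t a * cosh (s * a) + mehler_H s a * cosh (t * a)"
  by (cases "a = 0") (auto simp: mehler_H_eq sinh_add distrib_right add_divide_distrib)

lemma cosh_square_H: "(cosh (t * a))\<^sup>2 = 1 + a\<^sup>2 * (mehler_H t a)\<^sup>2"
  by (cases "a = 0") (auto simp: mehler_H_eq cosh_square_eq power_divide)

text \<open>\<open>mehler_Q\<close> is a csch(t a) and \<open>mehler_P\<close> is a coth(t a), both
  extended to a = 0 by 1/t. The total mass is read off at a = 0, so the value there has to be the
  limit.\<close>

definition mehler_Q :: "real \<Rightarrow> real \<Rightarrow> real" where
  "mehler_Q t a = 1 / mehler_H t a"

definition mehler_P :: "real \<Rightarrow> real \<Rightarrow> real" where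
  "mehler_P t a = cosh (t * a) / mehler_H t a"

lemma mehler_Q_pos: "t > 0 \<Longrightarrow> mehler_Q t a > 0"
  by (simp add: mehler_Q_def)

lemma mehler_P_pos: "t > 0 \<Longrightarrow> mehler_P t a > 0"
  by (simp add: mehler_P_def cosh_real_pos)

lemma mehler_Q_le: "t > 0 \<Longrightarrow> mehler_Q t a \<le> 1 / t"
  using shc_ge_1[of "t * a"] by (simp add: mehler_Q_def mehler_H_def divide_simps)

lemma mehler_Q_le_exp:
  assumes t: "t > 0"
  shows "mehler_Q t a \<le> 2 / t * exp (- (t * a / 2))"
proof -
  have "t * (exp (t * a / 2) / 2) \<le> mehler_H t a"
    unfolding mehler_H_def using t by (intro mult_left_mono shc_ge_exp) auto
  then have "1 / mehler_H t a \<le> 1 / (t * (exp (t * a / 2) / 2))"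
    using t by (intro divide_left_mono) auto
  then show ?thesis by (simp add: mehler_Q_def exp_minus divide_simps)
qed

lemma mehler_PQ_diff_squares:
  assumes t: "t > 0" shows "(mehler_P t a)\<^sup>2 - (mehler_Q t a)\<^sup>2 = a\<^sup>2"
  using mehler_H_pos[OF t, of a]
  by (simp add: mehler_P_def mehler_Q_def power_divide cosh_square_H divide_simps) 

text \<open>Half-angle formulas: coth + csch is coth of half the argument and, below, coth - csch is
  tanh of half the argument. They turn both coefficients in \<open>mehler_alt\<close> into
  logarithmic derivatives.\<close>

lemma mehler_PQ_sum:
  assumes t: "t > 0" shows "mehler_P t a + mehler_Q t a = mehler_P (t / 2) a"
proof -
  have H: "mehler_H t a = 2 * mehler_H (t / 2) a * cosh (t / 2 * a)"
    using mehler_H_add[of "t / 2" "t / 2" a] by simp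
  have c: "cosh (t * a) = 2 * (cosh (t / 2 * a))\<^sup>2 - 1"
    using cosh_double_cosh[of "t / 2 * a"] by simp
  show ?thesis
    using mehler_H_pos[of "t / 2" a] t cosh_real_pos[of "t / 2 * a"]
    unfolding mehler_P_def mehler_Q_def H c by (simp add: divide_simps power2_eq_square)
qed

lemma mehler_PQ_diff:
  assumes t: "t > 0" shows "mehler_P t a - mehler_Q t a = a * tanh (t / 2 * a)"
proof (cases "a = 0")
  case True
  then show ?thesis using t by (simp add: mehler_P_def mehler_Q_def)
next
  case False
  have c: "cosh (t * a) = 2 * (sinh (t / 2 * a))\<^sup>2 + 1"
    using cosh_double_cosh[of "t / 2 * a"] cosh_square_eq[of "t / 2 * a"] by simp
  have s: "sinh (t * a) = 2 * sinh (t / 2 * a) * cosh (t / 2 * a)"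
    using sinh_double[of "t / 2 * a"] by simp
  have "sinh (t / 2 * a) \<noteq> 0" using False t by simp
  then show ?thesis
    using False cosh_real_pos[of "t / 2 * a"]
    unfolding mehler_P_def mehler_Q_def mehler_H_eq[OF False] c s
    by (simp add: tanh_def divide_simps power2_eq_square) (simp add: algebra_simps)
qed

lemma tanh_nonneg_mult: "t > 0 \<Longrightarrow> 0 \<le> a * tanh (t / 2 * (a::real))"
  by (cases "a \<ge> 0") (auto simp: mult_nonpos_nonpos zero_le_mult_iff mult_le_0_iff)

lemma mehler_Q_le_P: "t > 0 \<Longrightarrow> mehler_Q t a \<le> mehler_P t a"
  using mehler_PQ_diff[of t a] tanh_nonneg_mult[of t a] by simp

text \<open>The heat kernel of (1/2) (Laplacian - a^2 |x|^2) without its constant factor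
  \<open>1 / sqrt (2 * pi) ^ DIM('a)\<close>.\<close>

definition mehler :: "real \<Rightarrow> 'a::euclidean_space \<Rightarrow> 'a \<Rightarrow> real \<Rightarrow> real" where
  "mehler t x w a = sqrt (mehler_Q t a) ^ DIM('a) *
     exp (- ((mehler_P t a * ((norm x)\<^sup>2 + (norm w)\<^sup>2) - 2 * mehler_Q t a * (x \<bullet> w)) / 2))"

lemma mehler_commute: "mehler t x w a = mehler t w x a"
  by (simp add: mehler_def inner_commute add.commute)

text \<open>Sum and difference of the two points diagonalize the quadratic form. Both coefficients
  are nonnegative for positive times, which gives bounds and lets each exponential be treated as a
  separate multiplier.\<close>

lemma mehler_alt:
  "mehler t (x::'a::euclidean_space) w a = sqrt (mehler_Q t a) ^ DIM('a) *
     exp (- (((mehler_P t a - mehler_Q t a) * (norm (x + w))\<^sup>2 + (mehler_P t a + mehler_Q t a) * (norm (x - w))\<^sup>2) / 4))"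
proof -
  have "(norm (x + w))\<^sup>2 = (norm x)\<^sup>2 + (norm w)\<^sup>2 + 2 * (x \<bullet> w)"
    and "(norm (x - w))\<^sup>2 = (norm x)\<^sup>2 + (norm w)\<^sup>2 - 2 * (x \<bullet> w)"
    by (simp_all add: power2_norm_eq_inner inner_add_left inner_add_right inner_diff_left inner_diff_right inner_commute)
  then show ?thesis
    unfolding mehler_def by (simp only:) (simp add: algebra_simps add_divide_distrib diff_divide_distrib)
qed

lemma mehler_pos: "t > 0 \<Longrightarrow> 0 < mehler t x w a"
  by (simp add: mehler_def mehler_Q_pos)

lemma mehler_le_sqrt_Q:
  assumes t: "t > 0"
  shows "mehler t (x::'a::euclidean_space) w a \<le> sqrt (mehler_Q t a) ^ DIM('a)"
proof -
  have "0 \<le> (mehler_P t a - mehler_Q t a) * (norm (x + w))\<^sup>2 + (mehler_P t a + mehler_Q t a) * (norm (x - w))\<^sup>2"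
    using mehler_Q_le_P[OF t] mehler_P_pos[OF t] mehler_Q_pos[OF t] by (simp add: add_nonneg_nonneg less_imp_le)
  then show ?thesis
    unfolding mehler_alt using mehler_Q_pos[OF t, of a] by (intro mult_left_le) auto
qed

lemma sqrt_mehler_Q_power_le:
  assumes t: "t > 0" and a: "a \<ge> 0"
  shows "sqrt (mehler_Q t a) ^ DIM('a::euclidean_space) \<le> sqrt (2 / t) ^ DIM('a) * exp (- (t / 4 * a))"
proof -
  have "sqrt (mehler_Q t a) \<le> sqrt (2 / t * exp (- (t * a / 2)))"
    by (rule real_sqrt_le_mono) (rule mehler_Q_le_exp[OF t])
  also have "\<dots> = sqrt (2 / t) * exp (- (t / 4 * a))"
  proof -
    have "exp (- (t * a / 2)) = exp (- (t / 4 * a)) ^ 2" by (simp flip: exp_double)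
    then show ?thesis by (simp only: real_sqrt_mult real_sqrt_power) simp
  qed
  finally have "sqrt (mehler_Q t a) ^ DIM('a) \<le> (sqrt (2 / t) * exp (- (t / 4 * a))) ^ DIM('a)"
    using mehler_Q_pos[OF t, of a] by (intro power_mono) auto
  \<comment> \<open>The exponential is at most 1 and the dimension at least 1, so keeping a single
    factor of it is enough.\<close>
  also have "\<dots> \<le> sqrt (2 / t) ^ DIM('a) * exp (- (t / 4 * a))"
    unfolding power_mult_distrib using t a power_decreasing[of 1 "DIM('a)" "exp (- (t / 4 * a))"]
    by (intro mult_left_mono) (auto simp: DIM_positive Suc_leI)
  finally show ?thesis .
qed

lemma sqrt_mehler_Q_power_le_const:
  assumes t: "t > 0"
  shows "sqrt (mehler_Q t a) ^ DIM('a::euclidean_space) \<le> sqrt (1 / t) ^ DIM('a)"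
  using mehler_Q_le[OF t, of a] mehler_Q_pos[OF t, of a]
  by (intro power_mono real_sqrt_le_mono) auto

text \<open>A Gaussian integral in \<open>v\<close> with precision S = P_t + P_s. The addition
  theorem for sinh gives S = Q_t Q_s / Q_(t+s), and completing the square produces P_t - Q_t^2 / S,
  which is P_(t+s).\<close>

lemma mehler_chapman_kolmogorov:
  fixes x w :: "'a::euclidean_space"
  assumes t: "t > 0" and s: "s > 0"
  shows "has_bochner_integral lborel (\<lambda>v. mehler t x v a * mehler s v w a)
           (sqrt (2 * pi) ^ DIM('a) * mehler (t + s) x w a)"
proof -
  define S where "S = mehler_P t a + mehler_P s a"
  have S: "S > 0" unfolding S_def using t s by (simp add: mehler_P_pos add_pos_pos)
  have pos: "mehler_H t a > 0" "mehler_H s a > 0" "mehler_H (t + s) a > 0" using t s by auto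
  have S_eq: "S = mehler_Q t a * mehler_Q s a / mehler_Q (t + s) a"
    unfolding S_def mehler_P_def mehler_Q_def mehler_H_add[of t s] using pos by (simp add: divide_simps)
  have Pt: "mehler_P t a - (mehler_Q t a)\<^sup>2 / S = mehler_P (t + s) a"
  proof -
    \<comment> \<open>The addition theorem at \<open>(t + s) + (- t)\<close>: a use of
      \<open>mehler_H\<close> at a negative time.\<close>
    have "mehler_H s a = mehler_H (t + s) a * cosh (t * a) - mehler_H t a * cosh ((t + s) * a)"
      using mehler_H_add[of "t + s" "- t" a] by (simp add: mehler_H_minus)
    then show ?thesis
      unfolding S_eq mehler_P_def mehler_Q_def using pos by (simp add: divide_simps power2_eq_square) 
  qed
  have Ps: "mehler_P s a - (mehler_Q s a)\<^sup>2 / S = mehler_P (t + s) a"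
  proof -
    have "mehler_H t a = mehler_H (t + s) a * cosh (s * a) - mehler_H s a * cosh ((t + s) * a)"
      using mehler_H_add[of "t + s" "- s" a] by (simp add: mehler_H_minus)
    then show ?thesis
      unfolding S_eq mehler_P_def mehler_Q_def using pos by (simp add: divide_simps power2_eq_square)
  qed
  define b where "b = mehler_Q t a *\<^sub>R x + mehler_Q s a *\<^sub>R w"
  let ?c = "sqrt (mehler_Q t a) ^ DIM('a) * sqrt (mehler_Q s a) ^ DIM('a) *
      exp (- ((mehler_P t a * (norm x)\<^sup>2 + mehler_P s a * (norm w)\<^sup>2) / 2))"
  have 1: "mehler t x v a * mehler s v w a = ?c * exp (b \<bullet> v - S / 2 * (norm v)\<^sup>2)" for v
  proof -
    have "exp (- ((mehler_P t a * ((norm x)\<^sup>2 + (norm v)\<^sup>2) - 2 * mehler_Q t a * (x \<bullet> v)) / 2)) *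
        exp (- ((mehler_P s a * ((norm v)\<^sup>2 + (norm w)\<^sup>2) - 2 * mehler_Q s a * (v \<bullet> w)) / 2))
      = exp (- ((mehler_P t a * (norm x)\<^sup>2 + mehler_P s a * (norm w)\<^sup>2) / 2)) * exp (b \<bullet> v - S / 2 * (norm v)\<^sup>2)"
      unfolding exp_add[symmetric] b_def S_def
      by (rule arg_cong[where f=exp]) (simp add: inner_add_left inner_commute[of v w] field_simps)
    then show ?thesis unfolding mehler_def by (simp only: mult_ac)
  qed
  have 2: "?c * (sqrt (2 * pi / S) ^ DIM('a) * exp ((norm b)\<^sup>2 / (2 * S))) = sqrt (2 * pi) ^ DIM('a) * mehler (t + s) x w a"
  proof -
    have q: "sqrt (mehler_Q t a) * sqrt (mehler_Q s a) * sqrt (2 * pi / S) = sqrt (2 * pi) * sqrt (mehler_Q (t + s) a)"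
      unfolding S_eq real_sqrt_mult[symmetric] using pos by (simp add: mehler_Q_def)
    have nb: "(norm b)\<^sup>2 = (mehler_Q t a)\<^sup>2 * (norm x)\<^sup>2 + (mehler_Q s a)\<^sup>2 * (norm w)\<^sup>2 + 2 * mehler_Q t a * mehler_Q s a * (x \<bullet> w)"
      unfolding b_def power2_norm_eq_inner
      by (simp add: inner_add_left inner_add_right inner_commute[of w x] algebra_simps power2_eq_square)
    have QQ: "mehler_Q t a * mehler_Q s a / S = mehler_Q (t + s) a"
      unfolding S_eq using pos by (simp add: mehler_Q_def)
    have "exp (- ((mehler_P t a * (norm x)\<^sup>2 + mehler_P s a * (norm w)\<^sup>2) / 2)) * exp ((norm b)\<^sup>2 / (2 * S))
      = exp (- (((mehler_P t a - (mehler_Q t a)\<^sup>2 / S) * (norm x)\<^sup>2 + (mehler_P s a - (mehler_Q s a)\<^sup>2 / S) * (norm w)\<^sup>2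
             - 2 * (mehler_Q t a * mehler_Q s a / S) * (x \<bullet> w)) / 2))"
      unfolding exp_add[symmetric] nb using S by (intro arg_cong[where f=exp]) (simp add: field_simps)
    also have "\<dots> = exp (- ((mehler_P (t + s) a * ((norm x)\<^sup>2 + (norm w)\<^sup>2) - 2 * mehler_Q (t + s) a * (x \<bullet> w)) / 2))"
      unfolding Pt Ps QQ by (simp add: algebra_simps)
    finally have e: "exp (- ((mehler_P t a * (norm x)\<^sup>2 + mehler_P s a * (norm w)\<^sup>2) / 2)) * exp ((norm b)\<^sup>2 / (2 * S))
       = exp (- ((mehler_P (t + s) a * ((norm x)\<^sup>2 + (norm w)\<^sup>2) - 2 * mehler_Q (t + s) a * (x \<bullet> w)) / 2))" .
    have "?c * (sqrt (2 * pi / S) ^ DIM('a) * exp ((norm b)\<^sup>2 / (2 * S)))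
      = (sqrt (mehler_Q t a) * sqrt (mehler_Q s a) * sqrt (2 * pi / S)) ^ DIM('a) *
        (exp (- ((mehler_P t a * (norm x)\<^sup>2 + mehler_P s a * (norm w)\<^sup>2) / 2)) * exp ((norm b)\<^sup>2 / (2 * S)))"
      unfolding power_mult_distrib by (simp only: mult_ac)
    then show ?thesis unfolding q e mehler_def power_mult_distrib by (simp only: mult_ac)
  qed
  show ?thesis
    unfolding 1 2[symmetric]
    by (intro has_bochner_integral_mult_right has_bochner_integral_gaussian S)
qed

text \<open>At \<open>a = 0\<close> this is the mass of the Euclidean heat kernel. For other
  \<open>a\<close> it is, after normalization, the characteristic function of the second component
  of the transition law, which the concentration estimate uses.\<close>

lemma mehler_marginal:
  fixes x :: "'a::euclidean_space"
  assumes t: "t > 0"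
  shows "has_bochner_integral lborel (\<lambda>w. mehler t x w a)
           (sqrt (2 * pi / cosh (t * a)) ^ DIM('a) * exp (- (a\<^sup>2 / (2 * mehler_P t a) * (norm x)\<^sup>2)))"
proof -
  have P: "mehler_P t a > 0" by (rule mehler_P_pos[OF t])
  have Q: "mehler_Q t a > 0" by (rule mehler_Q_pos[OF t])
  let ?c = "sqrt (mehler_Q t a) ^ DIM('a) * exp (- (mehler_P t a * (norm x)\<^sup>2 / 2))"
  have 1: "mehler t x w a = ?c * exp ((mehler_Q t a *\<^sub>R x) \<bullet> w - mehler_P t a / 2 * (norm w)\<^sup>2)" for w
    unfolding mehler_def mult.assoc exp_add[symmetric] by (simp add: field_simps)
  have 2: "?c * (sqrt (2 * pi / mehler_P t a) ^ DIM('a) * exp ((norm (mehler_Q t a *\<^sub>R x))\<^sup>2 / (2 * mehler_P t a)))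
     = sqrt (2 * pi / cosh (t * a)) ^ DIM('a) * exp (- (a\<^sup>2 / (2 * mehler_P t a) * (norm x)\<^sup>2))"
  proof -
    have q: "sqrt (mehler_Q t a) * sqrt (2 * pi / mehler_P t a) = sqrt (2 * pi / cosh (t * a))"
      unfolding real_sqrt_mult[symmetric] using mehler_H_pos[OF t, of a] by (simp add: mehler_Q_def mehler_P_def)
    have e: "exp (- (mehler_P t a * (norm x)\<^sup>2 / 2)) * exp ((norm (mehler_Q t a *\<^sub>R x))\<^sup>2 / (2 * mehler_P t a))
      = exp (- (a\<^sup>2 / (2 * mehler_P t a) * (norm x)\<^sup>2))"
      unfolding exp_add[symmetric] mehler_PQ_diff_squares[OF t, of a, symmetric]
      using P by (simp add: power_mult_distrib field_simps power2_eq_square)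
    show ?thesis
      unfolding q[symmetric] e[symmetric] power_mult_distrib by (simp only: mult_ac)
  qed
  show ?thesis
    unfolding 1 2[symmetric]
    by (intro has_bochner_integral_mult_right has_bochner_integral_gaussian P)
qed

section \<open>The heat kernel as a density\<close>

lemma gauss_multiplier_inv_sqrt_shc:
  assumes t: "t > 0"
  shows "gauss_multiplier (\<lambda>x::'a::euclidean_space. 1 / sqrt (shc (t * norm x)))"
proof (rule gauss_multiplier_LIMSEQ)
  let ?c = "\<lambda>k. 1 / (pi\<^sup>2 * (real k)\<^sup>2) * t\<^sup>2"
  show "gauss_multiplier (\<lambda>x::'a. \<Prod>k=1..n. 1 / sqrt (1 + ?c k * (norm x)\<^sup>2))" for n
    by (intro gauss_multiplier_prod gauss_multiplier_inv_sqrt) auto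
  have eq: "(\<Prod>k=1..n. 1 / sqrt (1 + ?c k * (norm x)\<^sup>2))
      = 1 / sqrt (\<Prod>k=1..n. 1 + 1 / (pi\<^sup>2 * (real k)\<^sup>2) * (t * norm x)\<^sup>2)" for n and x :: 'a
    by (induction n) (simp_all add: real_sqrt_mult power_mult_distrib mult_ac)
  show "(\<lambda>n. \<Prod>k=1..n. 1 / sqrt (1 + ?c k * (norm x)\<^sup>2)) \<longlonglongrightarrow> 1 / sqrt (shc (t * norm x))" for x :: 'a
    unfolding eq using shc_pos[of "t * norm x"] by (intro tendsto_intros shc_product) (auto simp del: shc_pos)
qed

text \<open>\<open>mehler_P t (norm x) - 1 / t\<close> is the derivative of
  \<open>ln (shc (s * norm x))\<close> at \<open>s = t\<close>; the pole \<open>1 / t\<close> comes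
  from the denominator of \<open>shc\<close>.\<close>

lemma gauss_multiplier_coth:
  assumes t: "t > 0" and a: "a \<ge> 0"
  shows "gauss_multiplier (\<lambda>x::'a::euclidean_space. exp (- (a * (mehler_P t (norm x) - 1 / t))))"
proof (rule gauss_multiplier_log_derivative[where T="\<lambda>s x. shc (s * norm x)" and c="\<lambda>k. 1 / (pi\<^sup>2 * (real k)\<^sup>2)", OF _ _ _ _ t a])
  show "(\<lambda>n. \<Prod>k=1..n. 1 + 1 / (pi\<^sup>2 * (real k)\<^sup>2) * s\<^sup>2 * (norm x)\<^sup>2) \<longlonglongrightarrow> shc (s * norm x)" for s and x :: 'a
    using shc_product[of "s * norm x"] by (simp add: power_mult_distrib mult.assoc)
  show "((\<lambda>s. ln (shc (s * norm x))) has_real_derivative mehler_P t (norm x) - 1 / t) (at t)" for x :: 'a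
  proof (cases "x = 0")
    case True
    then show ?thesis by (simp add: mehler_P_def)
  next
    case False
    then have n: "norm x > 0" by simp
    have "((\<lambda>s. ln (sinh (s * norm x) / (s * norm x))) has_real_derivative mehler_P t (norm x) - 1 / t) (at t)"
      using n t by (auto intro!: derivative_eq_intros simp: mehler_P_def mehler_H_eq divide_simps) (simp add: algebra_simps)
    moreover have "\<forall>\<^sub>F s in nhds t. ln (sinh (s * norm x) / (s * norm x)) = ln (shc (s * norm x))"
      using eventually_nhds_in_open[of "{0<..}" t] t n by (auto elim!: eventually_mono simp: shc_def)
    ultimately show ?thesis
      by (subst DERIV_cong_ev[OF refl _ refl, symmetric]) auto
  qed
qed auto

lemma gauss_multiplier_tanh:
  assumes t: "t > 0" and a: "a \<ge> 0"
  shows "gauss_multiplier (\<lambda>x::'a::euclidean_space. exp (- (a * (norm x * tanh (t * norm x)))))"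
proof (rule gauss_multiplier_log_derivative[where T="\<lambda>s x. cosh (s * norm x)" and c="\<lambda>k. 4 / (pi\<^sup>2 * (2 * real k - 1)\<^sup>2)", OF _ _ _ _ t a])
  show "(\<lambda>n. \<Prod>k=1..n. 1 + 4 / (pi\<^sup>2 * (2 * real k - 1)\<^sup>2) * s\<^sup>2 * (norm x)\<^sup>2) \<longlonglongrightarrow> cosh (s * norm x)" for s and x :: 'a
    using cosh_product[of "s * norm x"] by (simp add: power_mult_distrib mult.assoc)
  show "((\<lambda>s. ln (cosh (s * norm x))) has_real_derivative norm x * tanh (t * norm x)) (at t)" for x :: 'a
    by (auto intro!: derivative_eq_intros simp: tanh_def cosh_real_pos)
qed (auto simp: cosh_real_pos)

lemma borel_measurable_mehler [measurable]:
  assumes [measurable]: "f \<in> borel_measurable M" "g \<in> borel_measurable M" "h \<in> borel_measurable M"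
  shows "(\<lambda>z. mehler t (f z) (g z :: 'a::euclidean_space) (h z)) \<in> borel_measurable M"
proof -
  have [measurable]: "(\<lambda>a. mehler_H t a) \<in> borel_measurable borel"
    unfolding mehler_H_def by measurable
  show ?thesis
    unfolding mehler_def mehler_P_def mehler_Q_def by measurable
qed

lemma mehler_integrable:
  fixes x w :: "'a::euclidean_space"
  assumes t: "t > 0"
  shows "integrable lborel (\<lambda>y::'b::euclidean_space. mehler t x w (norm y))"
    and "(\<integral>y. mehler t x w (norm (y::'b)) \<partial>lborel) \<le> sqrt (2 / t) ^ DIM('a) * (8 * real DIM('b) / t) ^ DIM('b)"
proof -
  have le: "mehler t x w (norm y) \<le> sqrt (2 / t) ^ DIM('a) * exp (- (t / 4 * norm y))" for y :: 'b
    using order_trans[OF mehler_le_sqrt_Q[OF t] sqrt_mehler_Q_power_le[OF t], of "norm y" x w] by simp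
  have i: "integrable lborel (\<lambda>y::'b. sqrt (2 / t) ^ DIM('a) * exp (- (t / 4 * norm y)))"
    using t by (intro integrable_mult_right exp_neg_norm_integrable) auto
  show j: "integrable lborel (\<lambda>y::'b. mehler t x w (norm y))"
    by (rule Bochner_Integration.integrable_bound[OF i])
       (use le t in \<open>auto simp: abs_of_pos[OF mehler_pos[OF t]] abs_mult power_abs\<close>)
  have "(\<integral>y. mehler t x w (norm (y::'b)) \<partial>lborel) \<le> (\<integral>y. sqrt (2 / t) ^ DIM('a) * exp (- (t / 4 * norm (y::'b))) \<partial>lborel)"
    by (intro integral_mono i j le)
  \<comment> \<open>The rate \<open>t / 4\<close>, inserted in the bound of
    \<open>exp_neg_norm_integrable\<close>, produces the constant 8.\<close>
  also have "\<dots> \<le> sqrt (2 / t) ^ DIM('a) * (2 * real DIM('b) / (t / 4)) ^ DIM('b)"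
    unfolding integral_mult_right_zero using t
    by (intro mult_left_mono exp_neg_norm_integrable) auto
  finally show "(\<integral>y. mehler t x w (norm (y::'b)) \<partial>lborel) \<le> sqrt (2 / t) ^ DIM('a) * (8 * real DIM('b) / t) ^ DIM('b)"
    by simp
qed

text \<open>Positivity of the heat kernel, up to normalization: the Mehler kernel is a constant
  times a product of three multipliers, one for the prefactor and one each for x + w and x -
  w.\<close>

lemma mehler_cos_integral_nonneg:
  fixes x w :: "'a::euclidean_space" and y :: "'b::euclidean_space"
  assumes t: "t > 0"
  shows "0 \<le> (\<integral>z. mehler t x w (norm z) * cos (z \<bullet> y) \<partial>lborel)"
proof -
  define h where "h z = (1 / sqrt (shc (t * norm z))) ^ DIM('a) *
     (exp (- ((norm (x + w))\<^sup>2 / 4 * (norm z * tanh (t / 2 * norm z)))) *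
      exp (- ((norm (x - w))\<^sup>2 / 4 * (mehler_P (t / 2) (norm z) - 1 / (t / 2)))))" for z :: 'b
  \<comment> \<open>The pole of the coth at time \<open>t / 2\<close> contributes
    \<open>2 / t\<close> times |x - w|^2 / 4, which is the Gaussian here; the remainder of the coth
    stays in \<open>h\<close>.\<close>
  define c where "c = sqrt (1 / t) ^ DIM('a) * exp (- ((norm (x - w))\<^sup>2 / (2 * t)))"
  have c: "c > 0" using t by (simp add: c_def)
  have eq: "mehler t x w (norm z) = c * h z" for z :: 'b
  proof -
    have q: "sqrt (mehler_Q t (norm z)) = sqrt (1 / t) * (1 / sqrt (shc (t * norm z)))"
      unfolding mehler_Q_def mehler_H_def by (simp add: real_sqrt_mult real_sqrt_divide)
    have e: "exp (- (((mehler_P t (norm z) - mehler_Q t (norm z)) * (norm (x + w))\<^sup>2 + (mehler_P t (norm z) + mehler_Q t (norm z)) * (norm (x - w))\<^sup>2) / 4))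
      = exp (- ((norm (x - w))\<^sup>2 / (2 * t))) * (exp (- ((norm (x + w))\<^sup>2 / 4 * (norm z * tanh (t / 2 * norm z)))) *
      exp (- ((norm (x - w))\<^sup>2 / 4 * (mehler_P (t / 2) (norm z) - 1 / (t / 2)))))"
      unfolding mehler_PQ_diff[OF t] mehler_PQ_sum[OF t] exp_add[symmetric]
      using t by (intro arg_cong[where f=exp]) (simp add: field_simps)
    show ?thesis
      unfolding mehler_alt q e h_def c_def power_mult_distrib by (simp only: mult_ac)
  qed
  have mh: "gauss_multiplier h"
    unfolding h_def using t
    by (intro gauss_multiplier_mult gauss_multiplier_power gauss_multiplier_inv_sqrt_shc gauss_multiplier_coth gauss_multiplier_tanh) auto
  have "integrable lborel (\<lambda>z::'b. (1 / c) * mehler t x w (norm z))"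
    by (intro integrable_mult_right mehler_integrable t)
  then have "integrable lborel h" using c by (simp add: eq)
  from gauss_multiplier_cos_integral_nonneg[OF mh this, of y] c
  show ?thesis by (simp add: eq mult.assoc)
qed

section \<open>The density and its Fourier transform\<close>

lemma fourier_even_eq_cos:
  fixes f :: "'a::euclidean_space \<Rightarrow> real"
  assumes f: "integrable lborel f" and even: "\<And>x. f (- x) = f x"
  shows "(\<integral>x. of_real (f x) * cis (x \<bullet> y) \<partial>lborel) = complex_of_real (\<integral>x. f x * cos (x \<bullet> y) \<partial>lborel)"
proof -
  have [measurable]: "f \<in> borel_measurable borel" using f by simp
  have c: "integrable lborel (\<lambda>x. f x * cos (x \<bullet> y))"
    by (rule Bochner_Integration.integrable_bound[OF f]) (auto simp: abs_mult mult_left_le)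
  have s: "integrable lborel (\<lambda>x. f x * sin (x \<bullet> y))"
    by (rule Bochner_Integration.integrable_bound[OF f]) (auto simp: abs_mult mult_left_le)
  have "(\<integral>x. f x * sin (x \<bullet> y) \<partial>lborel) = \<bar>- 1\<bar> ^ DIM('a) *\<^sub>R (\<integral>x. f (0 + (- 1) *\<^sub>R x) * sin ((0 + (- 1) *\<^sub>R x) \<bullet> y) \<partial>lborel)"
    by (rule lborel_affine_integral) auto
  then have s0: "(\<integral>x. f x * sin (x \<bullet> y) \<partial>lborel) = 0"
    by (simp add: even)
  have "(\<integral>x. of_real (f x) * cis (x \<bullet> y) \<partial>lborel)
     = (\<integral>x. of_real (f x * cos (x \<bullet> y)) + \<i> * of_real (f x * sin (x \<bullet> y)) \<partial>lborel)"
    by (intro Bochner_Integration.integral_cong) (auto simp: complex_eq_iff)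
  also have "\<dots> = of_real (\<integral>x. f x * cos (x \<bullet> y) \<partial>lborel) + \<i> * of_real (\<integral>x. f x * sin (x \<bullet> y) \<partial>lborel)"
    using c s by (subst Bochner_Integration.integral_add)
       (auto intro!: integrable_mult_right integrable_of_real simp del: of_real_mult simp: integral_complex_of_real)
  finally show ?thesis using s0 by simp
qed

text \<open>The cosine makes it real by construction. One power in the denominator normalizes the
  Mehler kernel, the other the inverse Fourier transform.\<close>

definition grushin_density :: "real \<Rightarrow> 'a::euclidean_space \<Rightarrow> 'a \<Rightarrow> 'b::euclidean_space \<Rightarrow> real" where
  "grushin_density t x w y =
     (\<integral>z. mehler t x w (norm z) * cos (z \<bullet> y) \<partial>lborel) / (sqrt (2 * pi) ^ DIM('a) * (2 * pi) ^ DIM('b))"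

lemma grushin_density_nonneg: "t > 0 \<Longrightarrow> 0 \<le> grushin_density t x w y"
  unfolding grushin_density_def by (intro divide_nonneg_pos mehler_cos_integral_nonneg) auto

lemma grushin_density_commute: "grushin_density t x w y = grushin_density t w x y"
  unfolding grushin_density_def by (simp add: mehler_commute)

lemma grushin_density_minus: "grushin_density t x w (- y) = grushin_density t x w y"
  unfolding grushin_density_def by simp

text \<open>The cosine is at most 1 and the normalizing constants are at least 1, which leaves the
  integral of the Mehler kernel over all frequencies. Its powers of \<open>t\<close> add up to -(N +
  2k)/2.\<close>

lemma grushin_density_le:
  assumes t: "t > 0"
  shows "grushin_density t (x::'a::euclidean_space) w (y::'b::euclidean_space)
     \<le> sqrt (2 / t) ^ DIM('a) * (8 * real DIM('b) / t) ^ DIM('b)"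
proof -
  have "(\<integral>z. mehler t x w (norm z) * cos (z \<bullet> y) \<partial>lborel) \<le> (\<integral>z. mehler t x w (norm (z::'b)) \<partial>lborel)"
  proof (rule integral_mono)
    show "integrable lborel (\<lambda>z::'b. mehler t x w (norm z) * cos (z \<bullet> y))"
      by (rule Bochner_Integration.integrable_bound[OF mehler_integrable(1)[OF t, of x w]])
         (auto simp: abs_mult mult_left_le)
    show "mehler t x w (norm z) * cos (z \<bullet> y) \<le> mehler t x w (norm z)" for z :: 'b
      using mehler_pos[OF t, of x w "norm z"] by (intro mult_left_le) auto
  qed (rule mehler_integrable[OF t])
  also note mehler_integrable(2)[OF t, of x w]
  finally have le: "(\<integral>z. mehler t x w (norm z) * cos (z \<bullet> y) \<partial>lborel) \<le> sqrt (2 / t) ^ DIM('a) * (8 * real DIM('b) / t) ^ DIM('b)" .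
  have "1 \<le> sqrt (2 * pi) ^ DIM('a) * (2 * pi) ^ DIM('b)"
  proof -
    have "1 \<le> 2 * pi" using pi_ge_two by simp
    then have "1 * 1 \<le> sqrt (2 * pi) ^ DIM('a) * (2 * pi) ^ DIM('b)"
      by (intro mult_mono one_le_power) auto
    then show ?thesis by simp
  qed
  then have "grushin_density t x w y \<le> (\<integral>z. mehler t x w (norm z) * cos (z \<bullet> y) \<partial>lborel) / 1"
    unfolding grushin_density_def by (intro divide_left_mono mehler_cos_integral_nonneg t) auto
  with le show ?thesis by simp
qed

lemma borel_measurable_grushin_density [measurable]:
  assumes [measurable]: "f \<in> borel_measurable M" "g \<in> borel_measurable M" "h \<in> borel_measurable M"
  shows "(\<lambda>z. grushin_density t (f z) (g z :: 'a::euclidean_space) (h z :: 'b::euclidean_space)) \<in> borel_measurable M"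
proof -
  have "(\<lambda>p. grushin_density t (fst p) (fst (snd p)) (snd (snd p)))
      \<in> borel_measurable (borel \<Otimes>\<^sub>M borel \<Otimes>\<^sub>M borel :: ('a \<times> 'a \<times> 'b) measure)"
    unfolding grushin_density_def by measurable
  from measurable_compose[OF _ this, of "\<lambda>z. (f z, g z, h z)" M]
  show ?thesis by simp
qed

lemma continuous_on_mehler:
  assumes t: "t > 0"
  shows "continuous_on UNIV (\<lambda>z::'b::euclidean_space. mehler t x w (norm z))"
proof -
  have "mehler_H t a \<noteq> 0" for a using mehler_H_pos[OF t, of a] by linarith
  moreover have "continuous_on UNIV (\<lambda>z::'b. mehler_H t (norm z))"
    unfolding mehler_H_def by (intro continuous_intros)
  ultimately show ?thesis
    unfolding mehler_def mehler_P_def mehler_Q_def by (intro continuous_intros) auto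
qed

text \<open>Nonnegativity opens the way to the inversion theorem; integrability in \<open>y\<close>
  is one of its conclusions.\<close>

lemma grushin_density_fourier:
  fixes x w :: "'a::euclidean_space"
  assumes t: "t > 0"
  shows "integrable lborel (\<lambda>y::'b::euclidean_space. grushin_density t x w y)"
    and "(\<integral>y. of_real (grushin_density t x w y) * cis (- (z \<bullet> y)) \<partial>lborel)
       = complex_of_real (mehler t x w (norm (z::'b)) / sqrt (2 * pi) ^ DIM('a))"
proof -
  let ?c = "sqrt (2 * pi) ^ DIM('a) * (2 * pi) ^ DIM('b)"
  have c: "?c > 0" by simp
  have i: "integrable lborel (\<lambda>z::'b. mehler t x w (norm z) / ?c)"
    by (intro integrable_divide mehler_integrable t)
  have cont: "continuous_on UNIV (\<lambda>z::'b. mehler t x w (norm z) / ?c)"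
    using c by (intro continuous_intros continuous_on_mehler t) auto
  have b: "\<bar>mehler t x w (norm z) / ?c\<bar> \<le> sqrt (1 / t) ^ DIM('a) / ?c" for z :: 'b
    using order_trans[OF mehler_le_sqrt_Q[OF t] sqrt_mehler_Q_power_le_const[OF t], of x w "norm z"]
      mehler_pos[OF t, of x w "norm z"] c
    by (simp add: abs_of_pos divide_right_mono del: mult_pos_pos)
  have f: "(\<integral>z. of_real (mehler t x w (norm z) / ?c) * cis (z \<bullet> y) \<partial>lborel) = complex_of_real (grushin_density t x w y)" for y :: 'b
    by (subst fourier_even_eq_cos[OF i]) (simp_all add: grushin_density_def)
  note inv = fourier_inversion_nonneg[OF i cont b grushin_density_nonneg[OF t] f]
  show "integrable lborel (\<lambda>y::'b. grushin_density t x w y)"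
    using inv(1) by (simp add: eta_contract_eq)
  show "(\<integral>y. of_real (grushin_density t x w y) * cis (- (z \<bullet> y)) \<partial>lborel)
       = complex_of_real (mehler t x w (norm (z::'b)) / sqrt (2 * pi) ^ DIM('a))"
    using inv(2)[of z] by simp
qed

lemma integrable_pair_mult_unimodular:
  fixes f :: "'a::euclidean_space \<Rightarrow> real" and g :: "'b::euclidean_space \<Rightarrow> real" and u :: "'a \<times> 'b \<Rightarrow> complex"
  assumes f: "integrable lborel f" and g: "integrable lborel g"
    and [measurable]: "u \<in> borel_measurable (borel \<Otimes>\<^sub>M borel)" and u: "\<And>p. norm (u p) \<le> 1"
  shows "integrable (lborel \<Otimes>\<^sub>M lborel) (\<lambda>(x, y). of_real (f x * g y) * u (x, y))"
proof -
  have [measurable]: "f \<in> borel_measurable borel" "g \<in> borel_measurable borel" using f g by simp_all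
  have i: "integrable (lborel \<Otimes>\<^sub>M lborel) (\<lambda>(x, y). f x * g y)"
  proof (rule lborel_pair.Fubini_integrable)
    show "integrable lborel (\<lambda>x. \<integral>y. norm (case (x, y) of (x, y) \<Rightarrow> f x * g y) \<partial>lborel)"
      unfolding prod.case norm_mult using f by simp
  qed (use g in auto)
  show ?thesis
    by (rule Bochner_Integration.integrable_bound[OF i])
       (use u in \<open>auto simp: norm_mult abs_mult mult_left_le split: prod.split\<close>)
qed

lemma of_real_grushin_density:
  assumes t: "t > 0"
  shows "complex_of_real (grushin_density t (x::'a::euclidean_space) w (y::'b::euclidean_space))
     = (\<integral>z. of_real (mehler t x w (norm z)) * cis (z \<bullet> y) \<partial>lborel) / of_real (sqrt (2 * pi) ^ DIM('a) * (2 * pi) ^ DIM('b))"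
  by (subst fourier_even_eq_cos[OF mehler_integrable(1)[OF t]]) (simp_all add: grushin_density_def)

text \<open>The transform at frequency 0, where the Mehler kernel is a multiple of the Euclidean
  heat kernel.\<close>

lemma grushin_density_marginal:
  fixes x w :: "'a::euclidean_space"
  assumes t: "t > 0"
  shows "(\<integral>y. grushin_density t x w (y::'b::euclidean_space) \<partial>lborel) = mehler t x w 0 / sqrt (2 * pi) ^ DIM('a)"
proof -
  have "complex_of_real (\<integral>y. grushin_density t x w (y::'b) \<partial>lborel) = complex_of_real (mehler t x w 0 / sqrt (2 * pi) ^ DIM('a))"
    using grushin_density_fourier(2)[OF t, of x w "0::'b"] by (simp add: integral_complex_of_real)
  then show ?thesis by (simp only: of_real_eq_iff)
qed

lemma mehler_0_total:
  fixes x :: "'a::euclidean_space"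
  assumes t: "t > 0"
  shows "has_bochner_integral lborel (\<lambda>w. mehler t x w 0 / sqrt (2 * pi) ^ DIM('a)) 1"
  using has_bochner_integral_divide_zero[OF mehler_marginal[OF t, of x 0], of "sqrt (2 * pi) ^ DIM('a)"] by simp

text \<open>Convolution in the second variable is multiplication of Fourier transforms, so this is
  the semigroup law of the Mehler kernel under the integral sign.\<close>

lemma grushin_density_chapman_kolmogorov:
  fixes x w :: "'a::euclidean_space" and y :: "'b::euclidean_space"
  assumes t: "t > 0" and s: "s > 0"
  shows "(\<integral>\<^sup>+v. \<integral>\<^sup>+z. ennreal (grushin_density t x v z) * ennreal (grushin_density s v w (y - z)) \<partial>lborel \<partial>lborel)
     = ennreal (grushin_density (t + s) x w y)"
proof -
  define C where "C = sqrt (2 * pi) ^ DIM('a) * (2 * pi) ^ DIM('b)"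
  have C: "C > 0" by (simp add: C_def)
  have [measurable]: "cis \<in> borel_measurable borel"
    by (intro borel_measurable_continuous_onI continuous_intros)
  let ?dd = "\<lambda>v z. grushin_density t x v z * grushin_density s v w (y - z)"
  \<comment> \<open>The first factor is integrable in \<open>z\<close> and the second is
    bounded.\<close>
  have dd_int: "integrable lborel (?dd v)" for v
  proof (rule Bochner_Integration.integrable_bound[OF integrable_mult_left[OF grushin_density_fourier(1)[OF t, of x v], of "sqrt (2 / s) ^ DIM('a) * (8 * real DIM('b) / s) ^ DIM('b)"]])
    show "AE z in lborel. norm (?dd v z) \<le> norm (grushin_density t x v z * (sqrt (2 / s) ^ DIM('a) * (8 * real DIM('b) / s) ^ DIM('b)))"
    proof (intro AE_I2)
      fix z :: 'b
      have "norm (grushin_density s v w (y - z)) \<le> norm (sqrt (2 / s) ^ DIM('a) * (8 * real DIM('b) / s) ^ DIM('b))"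
        using grushin_density_nonneg[OF s, of v w "y - z"] grushin_density_le[OF s, of v w "y - z"] s by simp
      then show "norm (?dd v z) \<le> norm (grushin_density t x v z * (sqrt (2 / s) ^ DIM('a) * (8 * real DIM('b) / s) ^ DIM('b)))"
        unfolding norm_mult[of "grushin_density t x v z"] by (rule mult_left_mono) simp
    qed
  qed measurable
  define G where "G v = (\<integral>z. ?dd v z \<partial>lborel)" for v
  let ?m = "\<lambda>z v. mehler t x v (norm (z::'b)) * mehler s v w (norm z)"
  \<comment> \<open>Insert the Fourier integral of the second density, exchange the integrals and
    recognize the transform of the first density.\<close>
  have conv: "complex_of_real (G v) = (\<integral>z. of_real (?m z v) * cis (z \<bullet> y) \<partial>lborel) / of_real (C * sqrt (2 * pi) ^ DIM('a))" for v
  proof -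
    have int: "integrable (lborel \<Otimes>\<^sub>M lborel) (\<lambda>(z', z). of_real (grushin_density t x v z' * mehler s v w (norm z)) * cis (z \<bullet> (y - z')))"
      using integrable_pair_mult_unimodular[OF grushin_density_fourier(1)[OF t] mehler_integrable(1)[OF s], of "\<lambda>(z', z). cis (z \<bullet> (y - z'))" x v v w]
      by (simp split: prod.split)
    have dC: "complex_of_real (grushin_density s v w z) * of_real C = (\<integral>x. of_real (mehler s v w (norm x)) * cis (x \<bullet> z) \<partial>lborel)" for z :: 'b
      using C unfolding of_real_grushin_density[OF s] C_def[symmetric] by simp
    have "complex_of_real (G v) * of_real C = (\<integral>z'. of_real (grushin_density t x v z') * (of_real (grushin_density s v w (y - z')) * of_real C) \<partial>lborel)"
      unfolding G_def integral_complex_of_real[symmetric] integral_mult_left_zero[symmetric]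
      by (simp only: of_real_mult mult.assoc)
    also have "\<dots> = (\<integral>z'. \<integral>z. of_real (grushin_density t x v z' * mehler s v w (norm z)) * cis (z \<bullet> (y - z')) \<partial>lborel \<partial>lborel)"
      by (simp only: dC of_real_mult mult.assoc integral_mult_right_zero)
    also have "\<dots> = (\<integral>z. \<integral>z'. of_real (grushin_density t x v z' * mehler s v w (norm z)) * cis (z \<bullet> (y - z')) \<partial>lborel \<partial>lborel)"
      by (rule lborel_pair.Fubini_integral[OF int, symmetric])
    also have "(\<lambda>z. \<integral>z'. of_real (grushin_density t x v z' * mehler s v w (norm z)) * cis (z \<bullet> (y - z')) \<partial>lborel)
       = (\<lambda>z. of_real (?m z v) * cis (z \<bullet> y) / of_real (sqrt (2 * pi) ^ DIM('a)))"
    proof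
      fix z :: 'b
      have c: "of_real (grushin_density t x v z' * mehler s v w (norm z)) * cis (z \<bullet> (y - z'))
         = of_real (mehler s v w (norm z)) * cis (z \<bullet> y) * (of_real (grushin_density t x v z') * cis (- (z \<bullet> z')))" for z'
      proof -
        have "cis (z \<bullet> (y - z')) = cis (z \<bullet> y) * cis (- (z \<bullet> z'))"
          by (simp add: cis_mult inner_diff_right)
        then show ?thesis by simp
      qed
      show "(\<integral>z'. of_real (grushin_density t x v z' * mehler s v w (norm z)) * cis (z \<bullet> (y - z')) \<partial>lborel)
        = of_real (?m z v) * cis (z \<bullet> y) / of_real (sqrt (2 * pi) ^ DIM('a))"
        unfolding c integral_mult_right_zero grushin_density_fourier(2)[OF t] by simp
    qed
    finally have "complex_of_real (G v) * of_real C = (\<integral>z. of_real (?m z v) * cis (z \<bullet> y) \<partial>lborel) / of_real (sqrt (2 * pi) ^ DIM('a))"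
      by simp
    then have "complex_of_real (G v) = (\<integral>z. of_real (?m z v) * cis (z \<bullet> y) \<partial>lborel) / of_real (sqrt (2 * pi) ^ DIM('a)) / of_real C"
      using C by (subst nonzero_eq_divide_eq) auto
    then show ?thesis by (simp only: of_real_mult divide_divide_eq_left mult.commute)
  qed
  have ck: "has_bochner_integral lborel (\<lambda>v. ?m z v) (sqrt (2 * pi) ^ DIM('a) * mehler (t + s) x w (norm z))" for z :: 'b
    by (rule mehler_chapman_kolmogorov[OF t s])
  have int: "integrable (lborel \<Otimes>\<^sub>M lborel) (\<lambda>(z, v). complex_of_real (?m z v) * cis (z \<bullet> y))"
  proof (rule lborel_pair.Fubini_integrable)
    \<comment> \<open>Both Mehler kernels are positive, so their semigroup law also evaluates the
      integral of the absolute value.\<close>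
    have "(\<integral>v. norm (case (z, v) of (z, v) \<Rightarrow> complex_of_real (?m z v) * cis (z \<bullet> y)) \<partial>lborel)
        = sqrt (2 * pi) ^ DIM('a) * mehler (t + s) x w (norm z)" for z :: 'b
      using ck[of z] by (simp add: norm_mult has_bochner_integral_iff abs_of_pos mehler_pos[OF t] mehler_pos[OF s])
    then show "integrable lborel (\<lambda>z. \<integral>v. norm (case (z, v) of (z, v) \<Rightarrow> complex_of_real (?m z v) * cis (z \<bullet> y)) \<partial>lborel)"
      using t s by (simp add: mehler_integrable)
    show "AE z in lborel. integrable lborel (\<lambda>v. case (z, v) of (z, v) \<Rightarrow> complex_of_real (?m z v) * cis (z \<bullet> y))"
      unfolding prod.case using ck by (intro always_eventually allI integrable_mult_left integrable_of_real) (auto simp: has_bochner_integral_iff)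
  qed measurable
  have G_int: "integrable lborel G"
  proof -
    have "integrable lborel (\<lambda>v. (\<integral>z. of_real (?m z v) * cis (z \<bullet> y) \<partial>lborel) / complex_of_real (C * sqrt (2 * pi) ^ DIM('a)))"
      using lborel_pair.integrable_snd[OF int] by (intro integrable_divide) simp
    then have "integrable lborel (\<lambda>v. complex_of_real (G v))"
      by (simp only: conv)
    from integrable_bounded_linear[OF bounded_linear_Re this] show ?thesis by simp
  qed
  have "complex_of_real (\<integral>v. G v \<partial>lborel)
      = (\<integral>v. \<integral>z. of_real (?m z v) * cis (z \<bullet> y) \<partial>lborel \<partial>lborel) / of_real (C * sqrt (2 * pi) ^ DIM('a))"
    unfolding integral_complex_of_real[symmetric] conv by simp
  also have "(\<integral>v. \<integral>z. of_real (?m z v) * cis (z \<bullet> y) \<partial>lborel \<partial>lborel) = (\<integral>z. \<integral>v. of_real (?m z v) * cis (z \<bullet> y) \<partial>lborel \<partial>lborel)"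
    by (rule lborel_pair.Fubini_integral[OF int])
  also have "\<dots> = (\<integral>z. complex_of_real (sqrt (2 * pi) ^ DIM('a)) * (of_real (mehler (t + s) x w (norm z)) * cis (z \<bullet> y)) \<partial>lborel)"
  proof (rule Bochner_Integration.integral_cong[OF refl])
    fix z :: 'b
    have "(\<integral>v. complex_of_real (?m z v) * cis (z \<bullet> y) \<partial>lborel) = complex_of_real (\<integral>v. ?m z v \<partial>lborel) * cis (z \<bullet> y)"
      by (simp only: integral_mult_left_zero integral_complex_of_real)
    also have "(\<integral>v. ?m z v \<partial>lborel) = sqrt (2 * pi) ^ DIM('a) * mehler (t + s) x w (norm z)"
      using ck[of z] by (simp add: has_bochner_integral_iff)
    finally show "(\<integral>v. complex_of_real (?m z v) * cis (z \<bullet> y) \<partial>lborel) = complex_of_real (sqrt (2 * pi) ^ DIM('a)) * (of_real (mehler (t + s) x w (norm z)) * cis (z \<bullet> y))"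
      by simp
  qed
  also have "\<dots> / of_real (C * sqrt (2 * pi) ^ DIM('a)) = complex_of_real (grushin_density (t + s) x w y)"
    unfolding of_real_grushin_density[OF add_pos_pos[OF t s]] C_def[symmetric] by simp
  finally have G_total: "(\<integral>v. G v \<partial>lborel) = grushin_density (t + s) x w y"
    by (simp only: of_real_eq_iff)
  have "(\<integral>\<^sup>+z. ennreal (grushin_density t x v z) * ennreal (grushin_density s v w (y - z)) \<partial>lborel) = ennreal (G v)" for v
    unfolding G_def
    by (subst nn_integral_eq_integral[OF dd_int, symmetric])
       (auto simp: ennreal_mult' grushin_density_nonneg t s)
  moreover have "G v \<ge> 0" for v
    unfolding G_def by (intro Bochner_Integration.integral_nonneg mult_nonneg_nonneg grushin_density_nonneg t s)
  ultimately show ?thesis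
    by (simp add: nn_integral_eq_integral[OF G_int] G_total)
qed

section \<open>The transition kernel on the product space\<close>

definition grushin_transition :: "real \<Rightarrow> 'a::euclidean_space \<times> 'b::euclidean_space \<Rightarrow> 'a \<times> 'b \<Rightarrow> real" where
  "grushin_transition t u v = grushin_density t (fst u) (fst v) (snd u - snd v)"

lemma grushin_transition_nonneg: "t > 0 \<Longrightarrow> 0 \<le> grushin_transition t u v"
  by (simp add: grushin_transition_def grushin_density_nonneg)

lemma grushin_transition_commute: "grushin_transition t u v = grushin_transition t v u"
  unfolding grushin_transition_def
  by (subst grushin_density_commute, subst grushin_density_minus[symmetric]) simp

lemma borel_measurable_grushin_transition [measurable]:
  fixes f g :: "'z \<Rightarrow> 'a::euclidean_space \<times> 'b::euclidean_space"
  assumes [measurable]: "f \<in> borel_measurable M" "g \<in> borel_measurable M"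
  shows "(\<lambda>z. grushin_transition t (f z) (g z)) \<in> borel_measurable M"
proof -
  have [measurable]: "f \<in> M \<rightarrow>\<^sub>M borel \<Otimes>\<^sub>M borel" "g \<in> M \<rightarrow>\<^sub>M borel \<Otimes>\<^sub>M borel"
    using assms by (simp_all add: borel_prod)
  show ?thesis unfolding grushin_transition_def by measurable
qed

text \<open>Makes \<open>snd u - snd v\<close>, the last argument of the density, the variable of
  integration.\<close>

lemma nn_integral_lborel_prod_shift:
  fixes y :: "'b::euclidean_space" and f :: "'a::euclidean_space \<times> 'b \<Rightarrow> ennreal"
  assumes [measurable]: "f \<in> borel_measurable borel"
  shows "(\<integral>\<^sup>+v. f v \<partial>lborel) = (\<integral>\<^sup>+w. \<integral>\<^sup>+z. f (w, y - z) \<partial>lborel \<partial>lborel)"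
proof -
  have "(\<integral>\<^sup>+v. f v \<partial>lborel) = (\<integral>\<^sup>+w. \<integral>\<^sup>+z. f (w, z) \<partial>lborel \<partial>lborel)"
    unfolding lborel_prod[symmetric] by (rule lborel.nn_integral_fst[symmetric]) (simp add: lborel_prod)
  also have "\<dots> = (\<integral>\<^sup>+w. \<integral>\<^sup>+z. f (w, y - z) \<partial>lborel \<partial>lborel)"
  proof (rule nn_integral_cong)
    fix w
    show "(\<integral>\<^sup>+z. f (w, z) \<partial>lborel) = (\<integral>\<^sup>+z. f (w, y - z) \<partial>lborel)"
      using lborel_affine_nn_integral[of "\<lambda>z. f (w, z)" "-1" y] by simp
  qed
  finally show ?thesis .
qed

lemma nn_integral_grushin_transition:
  fixes u :: "'a::euclidean_space \<times> 'b::euclidean_space"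
  assumes t: "t > 0"
  shows "(\<integral>\<^sup>+v. ennreal (grushin_transition t u v) \<partial>lborel) = 1"
proof -
  have "(\<integral>\<^sup>+v. ennreal (grushin_transition t u v) \<partial>lborel)
      = (\<integral>\<^sup>+w. \<integral>\<^sup>+z. ennreal (grushin_density t (fst u) w (z::'b)) \<partial>lborel \<partial>lborel)"
    by (subst nn_integral_lborel_prod_shift[where y="snd u"], measurable) (simp add: grushin_transition_def)
  also have "\<dots> = (\<integral>\<^sup>+w. ennreal (mehler t (fst u) w 0 / sqrt (2 * pi) ^ DIM('a)) \<partial>lborel)"
    by (subst nn_integral_eq_integral) (auto simp: grushin_density_fourier grushin_density_nonneg t grushin_density_marginal)
  also have "\<dots> = 1"
    using mehler_0_total[OF t, of "fst u"]
    by (subst nn_integral_eq_integral) (auto simp: has_bochner_integral_iff mehler_pos[OF t, THEN less_imp_le])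
  finally show ?thesis .
qed

lemma grushin_transition_chapman_kolmogorov:
  fixes u w :: "'a::euclidean_space \<times> 'b::euclidean_space"
  assumes t: "t > 0" and s: "s > 0"
  shows "(\<integral>\<^sup>+v. ennreal (grushin_transition t u v) * ennreal (grushin_transition s v w) \<partial>lborel)
    = ennreal (grushin_transition (t + s) u w)"
  \<comment> \<open>After the shift \<open>snd v\<close> has become \<open>snd u - z\<close>, and
    \<open>snd u - z - snd w\<close> is regrouped as \<open>(snd u - snd w) - z\<close>.\<close>
  by (subst nn_integral_lborel_prod_shift[where y="snd u"], measurable)
     (simp add: grushin_transition_def grushin_density_chapman_kolmogorov[OF t s, symmetric]
        cancel_ab_semigroup_add_class.diff_right_commute[of "snd u" _ "snd w"])

text \<open>At \<open>x = 0\<close> positivity of \<open>n\<close> matters: \<open>0 powr 0\<close>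
  is 0, whereas \<open>0 ^ 0\<close> is 1.\<close>

lemma sqrt_power_eq_powr:
  fixes x :: real
  assumes "x \<ge> 0" "n > 0"
  shows "sqrt x ^ n = x powr (real n / 2)"
proof (cases "x = 0")
  case True
  then show ?thesis using assms by simp
next
  case False
  then have "x powr (real n / 2) = (x powr (1 / 2)) powr real n"
    by (simp add: powr_powr)
  also have "\<dots> = sqrt x ^ n"
    using False assms by (simp add: powr_half_sqrt powr_realpow)
  finally show ?thesis ..
qed

lemma exp_ii_diff: "exp (\<i> * of_real a - of_real b) = complex_of_real (exp (- b)) * cis a"
  by (simp add: exp_diff exp_minus cis_conv_exp divide_inverse exp_of_real)

lemma grushin_kernel_eq_density:
  fixes x w :: "real^'n" and y :: "real^'k"
  assumes t: "t > 0"
  shows "grushin_kernel x w y t = complex_of_real (grushin_density t x w y)"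
proof -
  let ?g = "\<lambda>z::real^'k. complex_of_real (mehler t x w (norm z)) * cis (z \<bullet> y)"
  let ?f = "\<lambda>\<xi>::real^'k. of_real ((norm \<xi> / sinh (norm \<xi> * t)) powr (real CARD('n) / 2)) *
          exp (\<i> * of_real (\<xi> \<bullet> y) -
               of_real (norm \<xi> / 2 *
                 (((norm x)\<^sup>2 + (norm w)\<^sup>2) * (cosh (norm \<xi> * t) / sinh (norm \<xi> * t))
                  - 2 * (x \<bullet> w) * (1 / sinh (norm \<xi> * t)))))"
  have [measurable]: "cis \<in> borel_measurable borel"
    by (intro borel_measurable_continuous_onI continuous_intros)
  \<comment> \<open>At frequency 0 the prefactor is \<open>0 / 0 = 0\<close> raised to a power, so
    the integrand vanishes there instead of taking its limit; the indicator records this exceptional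
    null set.\<close>
  have fz: "?f z = indicator (- {0}) z *\<^sub>R ?g z" for z :: "real^'k"
  proof (cases "z = 0")
    case False
    then have n: "norm z \<noteq> 0" by simp
    have Q: "mehler_Q t (norm z) = norm z / sinh (norm z * t)"
      and P: "mehler_P t (norm z) = norm z * (cosh (norm z * t) / sinh (norm z * t))"
      by (simp_all add: mehler_Q_def mehler_P_def mehler_H_eq[OF n] mult.commute)
    have "(norm z / sinh (norm z * t)) powr (real CARD('n) / 2) = sqrt (mehler_Q t (norm z)) ^ CARD('n)"
      using mehler_Q_pos[OF t, of "norm z"] by (subst sqrt_power_eq_powr) (auto simp: Q)
    moreover have "norm z / 2 * (((norm x)\<^sup>2 + (norm w)\<^sup>2) * (cosh (norm z * t) / sinh (norm z * t)) - 2 * (x \<bullet> w) * (1 / sinh (norm z * t)))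
      = (mehler_P t (norm z) * ((norm x)\<^sup>2 + (norm w)\<^sup>2) - 2 * mehler_Q t (norm z) * (x \<bullet> w)) / 2"
      unfolding P Q by (simp add: algebra_simps diff_divide_distrib add_divide_distrib)
    ultimately show ?thesis
      using False unfolding mehler_def by (simp only: exp_ii_diff) simp
  qed simp
  have f: "?f = (\<lambda>z. indicator (- {0}) z *\<^sub>R ?g z)"
    by (rule ext) (rule fz)
  have "(\<integral>z. ?f z \<partial>lebesgue) = (\<integral>z. ?f z \<partial>lborel)"
    unfolding f by (rule integral_completion) measurable
  also have "\<dots> = (\<integral>z. ?g z \<partial>lborel)"
  proof (rule integral_cong_AE)
    have "AE z in lborel. z \<noteq> (0::real^'k)"
      by (rule AE_lborel_singleton)
    then show "AE z in lborel. ?f z = ?g z"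
      unfolding fz by eventually_elim simp
    show "?f \<in> borel_measurable lborel" unfolding f by measurable
  qed measurable
  finally have int: "(\<integral>z. ?f z \<partial>lebesgue) = (\<integral>z. ?g z \<partial>lborel)" .
  have "(2 * pi) powr ((real CARD('n) + 2 * real CARD('k)) / 2) = (2 * pi) powr (real CARD('n) / 2) * (2 * pi) powr real CARD('k)"
    by (subst powr_add[symmetric]) (simp add: add_divide_distrib)
  also have "\<dots> = sqrt (2 * pi) ^ CARD('n) * (2 * pi) ^ CARD('k)"
    by (subst sqrt_power_eq_powr) (simp_all add: powr_realpow)
  finally show ?thesis
    unfolding grushin_kernel_def int of_real_grushin_density[OF t] by simp
qed

section \<open>Concentration near the diagonal\<close>

lemma mehler_0:
  fixes x w :: "'a::euclidean_space"
  shows "mehler h x w 0 = sqrt (1 / h) ^ DIM('a) * exp (- (1 / h / 2 * (norm (w - x))\<^sup>2))"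
  unfolding mehler_alt by (simp add: mehler_Q_def mehler_P_def norm_minus_commute)

text \<open>The first component of the transition law is Gaussian with variance \<open>h\<close>, so
  the expectation of a Gaussian weight is explicit. It tends to 1 with \<open>h\<close> tending to
  0.\<close>

lemma nn_integral_transition_exp_fst:
  fixes u :: "'a::euclidean_space \<times> 'b::euclidean_space"
  assumes h: "h > 0"
  shows "(\<integral>\<^sup>+v. ennreal (grushin_transition h u v * exp (- ((norm (fst v - fst u))\<^sup>2 / 2))) \<partial>lborel)
    = ennreal (sqrt (1 / (1 + h)) ^ DIM('a))"
proof -
  let ?x = "fst u"
  let ?F = "\<lambda>w. mehler h ?x w 0 / sqrt (2 * pi) ^ DIM('a) * exp (- ((norm (w - ?x))\<^sup>2 / 2))"
  have "continuous_on UNIV (\<lambda>v::'a \<times> 'b. exp (- ((norm (fst v - fst u))\<^sup>2 / 2)))"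
    by (intro continuous_intros) simp
  then have [measurable]: "(\<lambda>v::'a \<times> 'b. exp (- ((norm (fst v - fst u))\<^sup>2 / 2))) \<in> borel_measurable borel"
    by (rule borel_measurable_continuous_onI)
  have "(\<integral>\<^sup>+v. ennreal (grushin_transition h u v * exp (- ((norm (fst v - fst u))\<^sup>2 / 2))) \<partial>lborel)
     = (\<integral>\<^sup>+w. \<integral>\<^sup>+z. ennreal (grushin_density h ?x w (z::'b)) * ennreal (exp (- ((norm (w - ?x))\<^sup>2 / 2))) \<partial>lborel \<partial>lborel)"
    by (subst nn_integral_lborel_prod_shift[where y="snd u"], measurable)
       (simp add: grushin_transition_def ennreal_mult grushin_density_nonneg h)
  also have "\<dots> = (\<integral>\<^sup>+w. ennreal (mehler h ?x w 0 / sqrt (2 * pi) ^ DIM('a)) * ennreal (exp (- ((norm (w - ?x))\<^sup>2 / 2))) \<partial>lborel)"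
    by (simp add: nn_integral_multc nn_integral_eq_integral grushin_density_fourier grushin_density_nonneg h
        grushin_density_marginal)
  also have "\<dots> = (\<integral>\<^sup>+w. ennreal (?F w) \<partial>lborel)"
    by (intro nn_integral_cong ennreal_mult[symmetric]) (auto simp: mehler_pos[OF h, THEN less_imp_le])
  also have "\<dots> = (\<integral>\<^sup>+v. ennreal (?F (?x + 1 *\<^sub>R v)) \<partial>lborel)"
    by (subst lborel_affine_nn_integral[where c=1 and t="?x"]) simp_all
  \<comment> \<open>The precisions \<open>1 / h\<close> of the heat kernel and 1 of the weight add
    up.\<close>
  also have "\<dots> = (\<integral>\<^sup>+v. ennreal ((sqrt (1 / h) ^ DIM('a) / sqrt (2 * pi) ^ DIM('a)) * exp ((0::'a) \<bullet> v - (1 / h + 1) / 2 * (norm v)\<^sup>2)) \<partial>lborel)"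
    by (intro nn_integral_cong arg_cong[where f=ennreal])
       (simp add: mehler_0 exp_add[symmetric] field_simps)
  also have "\<dots> = ennreal ((sqrt (1 / h) ^ DIM('a) / sqrt (2 * pi) ^ DIM('a)) * (sqrt (2 * pi / (1 / h + 1)) ^ DIM('a) * exp ((norm (0::'a))\<^sup>2 / (2 * (1 / h + 1)))))"
  proof -
    have A: "1 / h + 1 > 0" using h by (simp add: add_pos_pos)
    have H: "has_bochner_integral lborel (\<lambda>v::'a. (sqrt (1 / h) ^ DIM('a) / sqrt (2 * pi) ^ DIM('a)) * exp ((0::'a) \<bullet> v - (1 / h + 1) / 2 * (norm v)\<^sup>2))
       ((sqrt (1 / h) ^ DIM('a) / sqrt (2 * pi) ^ DIM('a)) * (sqrt (2 * pi / (1 / h + 1)) ^ DIM('a) * exp ((norm (0::'a))\<^sup>2 / (2 * (1 / h + 1)))))"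
      by (intro has_bochner_integral_mult_right has_bochner_integral_gaussian A)
    show ?thesis
      using H h by (subst nn_integral_eq_integral) (auto simp: has_bochner_integral_iff)
  qed
  also have "(sqrt (1 / h) ^ DIM('a) / sqrt (2 * pi) ^ DIM('a)) * (sqrt (2 * pi / (1 / h + 1)) ^ DIM('a) * exp ((norm (0::'a))\<^sup>2 / (2 * (1 / h + 1))))
     = sqrt (1 / (1 + h)) ^ DIM('a)"
  proof -
    have "sqrt (1 / h) / sqrt (2 * pi) * sqrt (2 * pi / (1 / h + 1)) = sqrt (1 / h / (2 * pi) * (2 * pi / (1 / h + 1)))"
      by (simp only: real_sqrt_mult real_sqrt_divide)
    also have "1 / h / (2 * pi) * (2 * pi / (1 / h + 1)) = 1 / (1 + h)"
      using h by (simp add: field_simps)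
    finally have "sqrt (1 / (1 + h)) ^ DIM('a) = (sqrt (1 / h) / sqrt (2 * pi) * sqrt (2 * pi / (1 / h + 1))) ^ DIM('a)"
      by simp
    then show ?thesis by (simp only: power_mult_distrib power_divide) simp
  qed
  finally show ?thesis .
qed

text \<open>No formula for the law of the second component is needed: the expectation of a Gaussian
  weight is the Gaussian average of the characteristic function, which
  \<open>mehler_marginal\<close> provides.\<close>

lemma nn_integral_transition_exp_snd:
  fixes u :: "'a::euclidean_space \<times> 'b::euclidean_space"
  assumes h: "h > 0"
  shows "(\<integral>\<^sup>+v. ennreal (grushin_transition h u v * exp (- ((norm (snd u - snd v))\<^sup>2 / 2))) \<partial>lborel)
    = ennreal (1 / sqrt (2 * pi) ^ DIM('b) * (\<integral>z. exp (- ((norm (z::'b))\<^sup>2 / 2)) *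
        (sqrt (1 / cosh (h * norm z)) ^ DIM('a) * exp (- ((norm z)\<^sup>2 / (2 * mehler_P h (norm z)) * (norm (fst u))\<^sup>2))) \<partial>lborel))"
proof -
  let ?x = "fst u"
  let ?e = "\<lambda>z::'b. exp (- ((norm z)\<^sup>2 / 2))"
  define C where "C = sqrt (2 * pi) ^ DIM('a) * (2 * pi) ^ DIM('b)"
  have C: "C > 0" by (simp add: C_def)
  have e_int: "integrable lborel ?e"
    using gauss_integrable[of "1/2", where 'a='b] by simp
  have e1: "?e z \<le> 1" for z by simp
  have inner: "(\<integral>\<^sup>+z. ennreal (grushin_density h ?x w z * ?e z) \<partial>lborel)
     = (\<integral>\<^sup>+z. ennreal (sqrt (2 * pi) ^ DIM('b) / C * (mehler h ?x w (norm z) * ?e z)) \<partial>lborel)" for w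
  proof -
    have i1: "integrable lborel (\<lambda>z. grushin_density h ?x w z * ?e z)"
      by (rule Bochner_Integration.integrable_bound[OF grushin_density_fourier(1)[OF h, of ?x w]])
         (auto simp: abs_mult mult_left_le)
    have i2: "integrable lborel (\<lambda>z. mehler h ?x w (norm z) * ?e z)"
      by (rule Bochner_Integration.integrable_bound[OF mehler_integrable(1)[OF h, of ?x w]])
         (auto simp: abs_mult mult_left_le)
    have "integrable lborel (\<lambda>z::'b. mehler h ?x w (norm z) / C)"
      by (intro integrable_divide mehler_integrable h)
    \<comment> \<open>Width 1 and \<open>z = 0\<close>: up to a constant the weight
      \<open>?e\<close> is its own Fourier transform.\<close>
    from fourier_gaussian_regularized[OF this, of 1 0]
    have "complex_of_real (\<integral>z. grushin_density h ?x w z * ?e z \<partial>lborel)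
       = complex_of_real (\<integral>z. mehler h ?x w (norm z) / C * (sqrt (2 * pi) ^ DIM('b) * ?e z) \<partial>lborel)"
      by (simp add: of_real_grushin_density[OF h] C_def flip: integral_complex_of_real)
    then have "(\<integral>z. grushin_density h ?x w z * ?e z \<partial>lborel) = (\<integral>z. sqrt (2 * pi) ^ DIM('b) / C * (mehler h ?x w (norm z) * ?e z) \<partial>lborel)"
      by (simp only: of_real_eq_iff) (simp add: mult_ac)
    then show ?thesis
      using i1 i2 C h
      by (simp add: nn_integral_eq_integral grushin_density_nonneg mehler_pos[THEN less_imp_le])
  qed
  have "continuous_on UNIV (\<lambda>v::'a \<times> 'b. exp (- ((norm (snd u - snd v))\<^sup>2 / 2)))"
    by (intro continuous_intros) simp
  then have [measurable]: "(\<lambda>v::'a \<times> 'b. exp (- ((norm (snd u - snd v))\<^sup>2 / 2))) \<in> borel_measurable borel"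
    by (rule borel_measurable_continuous_onI)
  have "(\<integral>\<^sup>+v. ennreal (grushin_transition h u v * exp (- ((norm (snd u - snd v))\<^sup>2 / 2))) \<partial>lborel)
     = (\<integral>\<^sup>+w. \<integral>\<^sup>+z. ennreal (grushin_density h ?x w z * ?e z) \<partial>lborel \<partial>lborel)"
    by (subst nn_integral_lborel_prod_shift[where y="snd u"], measurable) (simp add: grushin_transition_def)
  also have "\<dots> = (\<integral>\<^sup>+w. \<integral>\<^sup>+z. ennreal (sqrt (2 * pi) ^ DIM('b) / C * (mehler h ?x w (norm z) * ?e z)) \<partial>lborel \<partial>lborel)"
    by (simp only: inner)
  also have "\<dots> = (\<integral>\<^sup>+z. \<integral>\<^sup>+w. ennreal (sqrt (2 * pi) ^ DIM('b) / C * (mehler h ?x w (norm z) * ?e z)) \<partial>lborel \<partial>lborel)"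
    by (rule lborel_pair.Fubini'[symmetric]) measurable
  also have "\<dots> = (\<integral>\<^sup>+z. ennreal (1 / sqrt (2 * pi) ^ DIM('b) * (?e z *
        (sqrt (1 / cosh (h * norm z)) ^ DIM('a) * exp (- ((norm z)\<^sup>2 / (2 * mehler_P h (norm z)) * (norm ?x)\<^sup>2))))) \<partial>lborel)"
  proof (rule nn_integral_cong)
    fix z :: 'b
    have H: "has_bochner_integral lborel (\<lambda>w. sqrt (2 * pi) ^ DIM('b) / C * (mehler h ?x w (norm z) * ?e z))
      (sqrt (2 * pi) ^ DIM('b) / C * (sqrt (2 * pi / cosh (h * norm z)) ^ DIM('a) * exp (- ((norm z)\<^sup>2 / (2 * mehler_P h (norm z)) * (norm ?x)\<^sup>2)) * ?e z))"
      by (intro has_bochner_integral_mult_right has_bochner_integral_mult_left mehler_marginal h)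
    have s2: "sqrt (2 * pi / cosh (h * norm z)) ^ DIM('a) = sqrt (2 * pi) ^ DIM('a) * sqrt (1 / cosh (h * norm z)) ^ DIM('a)"
      unfolding power_mult_distrib[symmetric] real_sqrt_mult[symmetric] by simp
    have s1: "(2 * pi) ^ DIM('b) = sqrt (2 * pi) ^ DIM('b) * sqrt (2 * pi) ^ DIM('b)"
      unfolding power_mult_distrib[symmetric] by simp
    have "sqrt (2 * pi) ^ DIM('b) / C * (sqrt (2 * pi / cosh (h * norm z)) ^ DIM('a) * exp (- ((norm z)\<^sup>2 / (2 * mehler_P h (norm z)) * (norm ?x)\<^sup>2)) * ?e z)
      = 1 / sqrt (2 * pi) ^ DIM('b) * (?e z * (sqrt (1 / cosh (h * norm z)) ^ DIM('a) * exp (- ((norm z)\<^sup>2 / (2 * mehler_P h (norm z)) * (norm ?x)\<^sup>2))))"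
      unfolding C_def s1 s2 by simp
    with H have "has_bochner_integral lborel (\<lambda>w. sqrt (2 * pi) ^ DIM('b) / C * (mehler h ?x w (norm z) * ?e z))
      (1 / sqrt (2 * pi) ^ DIM('b) * (?e z * (sqrt (1 / cosh (h * norm z)) ^ DIM('a) * exp (- ((norm z)\<^sup>2 / (2 * mehler_P h (norm z)) * (norm ?x)\<^sup>2)))))"
      by simp
    then show "(\<integral>\<^sup>+w. ennreal (sqrt (2 * pi) ^ DIM('b) / C * (mehler h ?x w (norm z) * ?e z)) \<partial>lborel)
       = ennreal (1 / sqrt (2 * pi) ^ DIM('b) * (?e z *
        (sqrt (1 / cosh (h * norm z)) ^ DIM('a) * exp (- ((norm z)\<^sup>2 / (2 * mehler_P h (norm z)) * (norm ?x)\<^sup>2)))))"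
      using C by (subst nn_integral_eq_integral) (auto simp: has_bochner_integral_iff mehler_pos[OF h, THEN less_imp_le])
  qed
  also have "\<dots> = ennreal (\<integral>z. 1 / sqrt (2 * pi) ^ DIM('b) * (?e z *
        (sqrt (1 / cosh (h * norm z)) ^ DIM('a) * exp (- ((norm z)\<^sup>2 / (2 * mehler_P h (norm z)) * (norm ?x)\<^sup>2)))) \<partial>lborel)"
  proof (rule nn_integral_eq_integral)
    have le: "sqrt (1 / cosh (h * norm z)) ^ DIM('a) * exp (- ((norm z)\<^sup>2 / (2 * mehler_P h (norm z)) * (norm ?x)\<^sup>2)) \<le> 1" for z :: 'b
      using cosh_real_ge_1[of "h * norm z"] mehler_P_pos[OF h, of "norm z"]
      by (intro mult_le_one power_le_one) auto
    have [measurable]: "(\<lambda>a. mehler_H h a) \<in> borel_measurable borel"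
      unfolding mehler_H_def by measurable
    show "integrable lborel (\<lambda>z. 1 / sqrt (2 * pi) ^ DIM('b) * (?e z *
        (sqrt (1 / cosh (h * norm z)) ^ DIM('a) * exp (- ((norm z)\<^sup>2 / (2 * mehler_P h (norm z)) * (norm ?x)\<^sup>2)))))"
    proof (rule integrable_mult_right, rule Bochner_Integration.integrable_bound[OF e_int])
      show "(\<lambda>z. ?e z * (sqrt (1 / cosh (h * norm z)) ^ DIM('a) * exp (- ((norm z)\<^sup>2 / (2 * mehler_P h (norm z)) * (norm ?x)\<^sup>2))))
         \<in> borel_measurable lborel"
        unfolding mehler_P_def by measurable
    qed (use le in \<open>auto simp: abs_mult power_abs mult_left_le\<close>)
  qed auto
  finally show ?thesis by simp
qed

lemma nn_integral_complement:
  assumes [measurable]: "k \<in> borel_measurable M" "e \<in> borel_measurable M"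
    and k: "\<And>v. 0 \<le> k v" and e: "\<And>v. 0 \<le> e v" "\<And>v. e v \<le> 1"
    and tot: "(\<integral>\<^sup>+v. ennreal (k v) \<partial>M) = 1" and a: "(\<integral>\<^sup>+v. ennreal (k v * e v) \<partial>M) = ennreal a" and "a \<ge> 0"
  shows "(\<integral>\<^sup>+v. ennreal (k v * (1 - e v)) \<partial>M) = ennreal (1 - a)"
proof -
  have "(\<integral>\<^sup>+v. ennreal (k v * (1 - e v)) \<partial>M) + ennreal a = (\<integral>\<^sup>+v. ennreal (k v * (1 - e v)) + ennreal (k v * e v) \<partial>M)"
    unfolding a[symmetric] by (rule nn_integral_add[symmetric]) measurable
  also have "\<dots> = (\<integral>\<^sup>+v. ennreal (k v) \<partial>M)"
  proof (rule nn_integral_cong)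
    fix v
    have "ennreal (k v * (1 - e v)) + ennreal (k v * e v) = ennreal (k v * (1 - e v) + k v * e v)"
      using k e by (intro ennreal_plus[symmetric] mult_nonneg_nonneg) auto
    then show "ennreal (k v * (1 - e v)) + ennreal (k v * e v) = ennreal (k v)"
      by (simp add: algebra_simps)
  qed
  finally have 1: "(\<integral>\<^sup>+v. ennreal (k v * (1 - e v)) \<partial>M) + ennreal a = 1"
    using tot by simp
  have "(\<integral>\<^sup>+v. ennreal (k v * (1 - e v)) \<partial>M) = ((\<integral>\<^sup>+v. ennreal (k v * (1 - e v)) \<partial>M) + ennreal a) - ennreal a"
    by simp
  also have "\<dots> = 1 - ennreal a" unfolding 1 ..
  also have "\<dots> = ennreal (1 - a)" using \<open>a \<ge> 0\<close> by (simp add: ennreal_minus flip: ennreal_1)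
  finally show ?thesis .
qed

text \<open>Chebyshev's inequality with the Gaussian defects \<open>1 - e1\<close> and
  \<open>1 - e2\<close> in place of a second moment; their expectations follow from the two
  preceding computations.\<close>

lemma grushin_transition_tail:
  fixes u :: "'a::euclidean_space \<times> 'b::euclidean_space"
  assumes h: "\<And>n. h n > 0" and h0: "h \<longlonglongrightarrow> 0" and d: "d > 0"
  shows "(\<lambda>n. \<integral>\<^sup>+v. ennreal (grushin_transition (h n) u v) * indicator {v. d \<le> dist u v} v \<partial>lborel) \<longlonglongrightarrow> 0"
proof -
  define e1 where "e1 v = exp (- ((norm (fst v - fst u))\<^sup>2 / 2))" for v :: "'a \<times> 'b"
  define e2 where "e2 v = exp (- ((norm (snd u - snd v))\<^sup>2 / 2))" for v :: "'a \<times> 'b"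
  have "continuous_on UNIV e1" "continuous_on UNIV e2"
    unfolding e1_def e2_def by (intro continuous_intros; simp)+
  then have [measurable]: "e1 \<in> borel_measurable borel" "e2 \<in> borel_measurable borel"
    by (auto intro: borel_measurable_continuous_onI)
  have e01: "0 \<le> e1 v" "e1 v \<le> 1" "0 \<le> e2 v" "e2 v \<le> 1" for v
    by (auto simp: e1_def e2_def)
  define a where "a n = sqrt (1 / (1 + h n)) ^ DIM('a)" for n
  define s where "s n z = sqrt (1 / cosh (h n * norm z)) ^ DIM('a) * exp (- ((norm z)\<^sup>2 / (2 * mehler_P (h n) (norm z)) * (norm (fst u))\<^sup>2))" for n and z :: 'b
  define b where "b n = 1 / sqrt (2 * pi) ^ DIM('b) * (\<integral>z. exp (- ((norm (z::'b))\<^sup>2 / 2)) * s n z \<partial>lborel)" for n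
  have s01: "0 \<le> s n z" "s n z \<le> 1" for n z
    using cosh_real_ge_1[of "h n * norm z"] mehler_P_pos[OF h, of n "norm z"]
    unfolding s_def by (auto intro!: mult_le_one power_le_one)
  have [measurable]: "(\<lambda>a. mehler_H (h n) a) \<in> borel_measurable borel" for n
    unfolding mehler_H_def by measurable
  have [measurable]: "s n \<in> borel_measurable borel" for n
    unfolding s_def mehler_P_def by measurable
  have a_lim: "a \<longlonglongrightarrow> 1"
  proof -
    have "a \<longlonglongrightarrow> sqrt (1 / (1 + 0)) ^ DIM('a)"
      unfolding a_def by (intro tendsto_intros h0) simp
    then show ?thesis by simp
  qed
  have b_lim: "b \<longlonglongrightarrow> 1"
  proof -
    have G: "has_bochner_integral lborel (\<lambda>x::'b. exp (- ((norm x)\<^sup>2 / 2))) (sqrt (2 * pi) ^ DIM('b))"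
      using has_bochner_integral_gaussian[of 1 "0::'b"] by simp
    have "(\<lambda>n. \<integral>z. exp (- ((norm (z::'b))\<^sup>2 / 2)) * s n z \<partial>lborel) \<longlonglongrightarrow> (\<integral>z. exp (- ((norm (z::'b))\<^sup>2 / 2)) \<partial>lborel)"
    proof (rule integral_dominated_convergence[where w="\<lambda>z. exp (- ((norm z)\<^sup>2 / 2))"])
      show "AE z in lborel. (\<lambda>n. exp (- ((norm z)\<^sup>2 / 2)) * s n z) \<longlonglongrightarrow> exp (- ((norm (z::'b))\<^sup>2 / 2))"
      proof (intro AE_I2)
        fix z :: 'b
        \<comment> \<open>\<open>mehler_P\<close> blows up as \<open>h n\<close> tends to 0. With
          its reciprocal written out, the expression is continuous there.\<close>
        have s_eq: "s n z = sqrt (1 / cosh (h n * norm z)) ^ DIM('a) *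
            exp (- ((norm z)\<^sup>2 * (h n * shc (h n * norm z)) / (2 * cosh (h n * norm z)) * (norm (fst u))\<^sup>2))" for n
          by (simp add: s_def mehler_P_def mehler_H_def)
        have c: "(\<lambda>n. cosh (h n * norm z)) \<longlonglongrightarrow> cosh (0 * norm z)"
          by (intro tendsto_intros h0)
        have "(\<lambda>n. exp (- ((norm z)\<^sup>2 / 2)) * s n z) \<longlonglongrightarrow> exp (- ((norm z)\<^sup>2 / 2)) * (sqrt (1 / cosh (0 * norm z)) ^ DIM('a) *
            exp (- ((norm z)\<^sup>2 * (0 * shc (0 * norm z)) / (2 * cosh (0 * norm z)) * (norm (fst u))\<^sup>2)))"
          unfolding s_eq by (intro tendsto_intros h0 c) auto
        then show "(\<lambda>n. exp (- ((norm z)\<^sup>2 / 2)) * s n z) \<longlonglongrightarrow> exp (- ((norm z)\<^sup>2 / 2))"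
          by simp
      qed
    qed (use G s01 in \<open>auto simp: has_bochner_integral_iff abs_mult mult_left_le\<close>)
    then have "b \<longlonglongrightarrow> 1 / sqrt (2 * pi) ^ DIM('b) * (\<integral>z. exp (- ((norm (z::'b))\<^sup>2 / 2)) \<partial>lborel)"
      unfolding b_def by (intro tendsto_intros)
    then show ?thesis using G by (simp add: has_bochner_integral_iff)
  qed
  have X1: "(\<integral>\<^sup>+v. ennreal (grushin_transition (h n) u v * (1 - e1 v)) \<partial>lborel) = ennreal (1 - a n)" for n
  proof (rule nn_integral_complement)
    show "0 \<le> a n" using h[of n] by (simp add: a_def)
    show "(\<integral>\<^sup>+v. ennreal (grushin_transition (h n) u v * e1 v) \<partial>lborel) = ennreal (a n)"
      unfolding e1_def a_def by (rule nn_integral_transition_exp_fst[OF h])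
  qed (auto simp: e01 grushin_transition_nonneg h nn_integral_grushin_transition)
  have X2: "(\<integral>\<^sup>+v. ennreal (grushin_transition (h n) u v * (1 - e2 v)) \<partial>lborel) = ennreal (1 - b n)" for n
    using nn_integral_transition_exp_snd[OF h, of n u]
    by (intro nn_integral_complement)
       (auto simp: e01 grushin_transition_nonneg h nn_integral_grushin_transition b_def s_def e2_def[symmetric]
          intro!: Bochner_Integration.integral_nonneg divide_nonneg_nonneg)
  \<comment> \<open>At distance \<open>d\<close> or more, one of the two component distances has
    square at least d^2 / 2, so one of the defects is at least 1 - exp(- d^2 / 4); \<open>c\<close>
    is the reciprocal of this number.\<close>
  define c where "c = 1 / (1 - exp (- (d\<^sup>2 / 4)))"
  have c: "1 - exp (- (d\<^sup>2 / 4)) > 0" "c > 0" using d by (auto simp: c_def)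
  have ind: "indicator {v. d \<le> dist u v} v \<le> c * ((1 - e1 v) + (1 - e2 v))" for v
  proof (cases "d \<le> dist u v")
    case True
    then have "d\<^sup>2 \<le> (dist u v)\<^sup>2" using d by (intro power_mono) auto
    also have "\<dots> = (norm (fst v - fst u))\<^sup>2 + (norm (snd u - snd v))\<^sup>2"
      by (simp add: dist_prod_def dist_norm norm_minus_commute)
    finally have "d\<^sup>2 / 4 \<le> (norm (fst v - fst u))\<^sup>2 / 2 \<or> d\<^sup>2 / 4 \<le> (norm (snd u - snd v))\<^sup>2 / 2"
      by argo
    then have "1 - exp (- (d\<^sup>2 / 4)) \<le> 1 - e1 v \<or> 1 - exp (- (d\<^sup>2 / 4)) \<le> 1 - e2 v"
      unfolding e1_def e2_def by auto
    then have "1 - exp (- (d\<^sup>2 / 4)) \<le> (1 - e1 v) + (1 - e2 v)"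
      using e01[of v] by auto
    then have "c * (1 - exp (- (d\<^sup>2 / 4))) \<le> c * ((1 - e1 v) + (1 - e2 v))"
      using c by (intro mult_left_mono) auto
    then show ?thesis using True c by (simp add: c_def)
  next
    case False
    then show ?thesis using e01[of v] c by simp
  qed
  have le: "(\<integral>\<^sup>+v. ennreal (grushin_transition (h n) u v) * indicator {v. d \<le> dist u v} v \<partial>lborel)
      \<le> ennreal c * (ennreal (1 - a n) + ennreal (1 - b n))" for n
  proof -
    have "(\<integral>\<^sup>+v. ennreal (grushin_transition (h n) u v) * indicator {v. d \<le> dist u v} v \<partial>lborel)
      \<le> (\<integral>\<^sup>+v. ennreal c * (ennreal (grushin_transition (h n) u v * (1 - e1 v)) + ennreal (grushin_transition (h n) u v * (1 - e2 v))) \<partial>lborel)"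
    proof (rule nn_integral_mono)
      fix v
      let ?k = "grushin_transition (h n) u v"
      have k: "?k \<ge> 0" by (rule grushin_transition_nonneg[OF h])
      have "ennreal ?k * indicator {v. d \<le> dist u v} v = ennreal (?k * indicator {v. d \<le> dist u v} v)"
        by (auto simp: indicator_def)
      also have "\<dots> \<le> ennreal (?k * (c * ((1 - e1 v) + (1 - e2 v))))"
        by (intro ennreal_leI mult_left_mono ind k)
      also have "\<dots> = ennreal c * (ennreal (?k * (1 - e1 v)) + ennreal (?k * (1 - e2 v)))"
      proof -
        have nn: "0 \<le> ?k * (1 - e1 v)" "0 \<le> ?k * (1 - e2 v)" using k e01[of v] by auto
        have "?k * (c * ((1 - e1 v) + (1 - e2 v))) = c * (?k * (1 - e1 v) + ?k * (1 - e2 v))"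
          by (simp add: algebra_simps)
        also have "ennreal \<dots> = ennreal c * ennreal (?k * (1 - e1 v) + ?k * (1 - e2 v))"
          using c nn by (intro ennreal_mult add_nonneg_nonneg) auto
        also have "\<dots> = ennreal c * (ennreal (?k * (1 - e1 v)) + ennreal (?k * (1 - e2 v)))"
          using nn by (simp only: ennreal_plus)
        finally show ?thesis .
      qed
      finally show "ennreal ?k * indicator {v. d \<le> dist u v} v \<le> ennreal c * (ennreal (?k * (1 - e1 v)) + ennreal (?k * (1 - e2 v)))" .
    qed
    also have "\<dots> = ennreal c * ((\<integral>\<^sup>+v. ennreal (grushin_transition (h n) u v * (1 - e1 v)) \<partial>lborel)
        + (\<integral>\<^sup>+v. ennreal (grushin_transition (h n) u v * (1 - e2 v)) \<partial>lborel))"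
      by (simp add: nn_integral_cmult nn_integral_add)
    finally show ?thesis unfolding X1 X2 .
  qed
  have "(\<lambda>n. ennreal c * (ennreal (1 - a n) + ennreal (1 - b n))) \<longlonglongrightarrow> ennreal c * (ennreal (1 - 1) + ennreal (1 - 1))"
    by (intro ennreal_tendsto_cmult tendsto_add tendsto_ennrealI tendsto_intros a_lim b_lim) auto
  then have L: "(\<lambda>n. ennreal c * (ennreal (1 - a n) + ennreal (1 - b n))) \<longlonglongrightarrow> 0"
    by simp
  show ?thesis
    by (rule tendsto_sandwich[OF _ _ tendsto_const L]) (auto simp: le)
qed

section \<open>Integral operators with bistochastic kernels\<close>

definition kernel_op :: "'a measure \<Rightarrow> ('a \<Rightarrow> 'a \<Rightarrow> real) \<Rightarrow> ('a \<Rightarrow> complex) \<Rightarrow> 'a \<Rightarrow> complex" where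
  "kernel_op M k f u = (\<integral>v. of_real (k u v) * f v \<partial>M)"

section \<open>Membership and norm in L^p\<close>

lemma Lp_space_finite_iff:
  assumes "p \<ge> 0"
  shows "f \<in> Lp_space M (ennreal p) \<longleftrightarrow> f \<in> borel_measurable M \<and> integrable M (\<lambda>u. norm (f u) powr p)"
  using assms by (simp add: Lp_space_def)

lemma Lp_norm_finite:
  assumes "p \<ge> 0"
  shows "Lp_norm M (ennreal p) f = (\<integral>u. norm (f u) powr p \<partial>M) powr (1 / p)"
  using assms by (simp add: Lp_norm_def)

lemma Lp_space_measurable: "f \<in> Lp_space M p \<Longrightarrow> f \<in> borel_measurable M"
  by (simp add: Lp_space_def)

lemma Lp_infinity_AE:
  assumes "f \<in> Lp_space M \<infinity>"
  shows "AE u in M. norm (f u) \<le> Lp_norm M \<infinity> f"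
proof -
  have "esssup M (\<lambda>u. ennreal (norm (f u))) < \<infinity>"
    using assms by (simp add: Lp_space_def)
  then have e: "ennreal (Lp_norm M \<infinity> f) = esssup M (\<lambda>u. ennreal (norm (f u)))"
    by (simp add: Lp_norm_def)
  have "AE u in M. ennreal (norm (f u)) \<le> esssup M (\<lambda>u. ennreal (norm (f u)))"
    by (rule esssup_AE)
  then show ?thesis
    unfolding e[symmetric] by eventually_elim (simp add: Lp_norm_def)
qed

lemma Lp_infinityI:
  assumes [measurable]: "f \<in> borel_measurable M" and C: "AE u in M. norm (f u) \<le> C" "C \<ge> 0"
  shows "f \<in> Lp_space M \<infinity>" and "Lp_norm M \<infinity> f \<le> C"
proof -
  have le: "esssup M (\<lambda>u. ennreal (norm (f u))) \<le> ennreal C"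
    by (rule esssup_I) (use C in \<open>auto simp: ennreal_leI\<close>)
  then show "f \<in> Lp_space M \<infinity>"
    by (auto simp: Lp_space_def intro: le_less_trans[OF le])
  show "Lp_norm M \<infinity> f \<le> C"
    using enn2real_mono[OF le] C by (simp add: Lp_norm_def)
qed

lemma Lp_norm_nonneg: "0 \<le> Lp_norm M p f"
  by (simp add: Lp_norm_def)

lemma ennreal_cases_ge_1:
  fixes p :: ennreal
  assumes "1 \<le> p"
  obtains "p = \<infinity>" | q where "q \<ge> 1" "p = ennreal q"
proof (cases p)
  case (real q)
  then have "1 \<le> q" using assms by (metis ennreal_1 ennreal_le_iff)
  with real that show ?thesis by blast
qed (use that in auto)

text \<open>A convex power lies above its tangent at \<open>m\<close>. Young's inequality with the
  exponents \<open>p\<close> and \<open>p / (p - 1)\<close> proves it, and the second exponent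
  forces the separate case \<open>p = 1\<close>.\<close>

lemma powr_tangent_le:
  fixes m s p :: real
  assumes p: "p \<ge> 1" and m: "m > 0" and s: "s \<ge> 0"
  shows "m powr p + p * m powr (p - 1) * (s - m) \<le> s powr p"
proof (cases "p = 1")
  case True
  with m s show ?thesis by simp
next
  case False
  with p have p1: "p > 1" by simp
  define q where "q = p / (p - 1)"
  have q: "q > 1" "1 / p + 1 / q = 1" using p1 by (auto simp: q_def field_simps)
  have mp: "m * m powr (p - 1) = m powr p"
    using m powr_add[of m 1 "p - 1"] by simp
  have "s * m powr (p - 1) \<le> s powr p / p + (m powr (p - 1)) powr q / q"
    by (rule Youngs_inequality) (use p1 q s in auto)
  also have "(m powr (p - 1)) powr q = m powr p"
    using p1 by (simp add: powr_powr q_def)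
  finally have "p * (s * m powr (p - 1)) \<le> p * (s powr p / p + m powr p / q)"
    using p1 by (intro mult_left_mono) auto
  also have "\<dots> = s powr p + m powr p * (p / q)" using p1 by (simp add: field_simps)
  also have "p / q = p - 1" using p1 by (simp add: q_def)
  finally show ?thesis using mp by (simp add: algebra_simps)
qed

text \<open>Unit rows give Jensen's inequality and the bound at exponent infinity, unit columns
  conserve integrals, and \<open>A\<close> turns L^p functions into bounded ones. The bounds hold at
  every point, so the operators can be estimated pointwise.\<close>

locale bistochastic_kernel = sigma_finite_measure M for M :: "'a measure" +
  fixes k :: "'a \<Rightarrow> 'a \<Rightarrow> real" and A :: real
  assumes space_UNIV: "space M = UNIV"
    and measurable_kernel: "(\<lambda>(u, v). k u v) \<in> borel_measurable (M \<Otimes>\<^sub>M M)"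
    and kernel_nonneg: "0 \<le> k u v" and kernel_le: "k u v \<le> A"
    and row: "(\<integral>\<^sup>+v. ennreal (k u v) \<partial>M) = 1" and column: "(\<integral>\<^sup>+u. ennreal (k u v) \<partial>M) = 1"
begin

lemma measurable_kernel' [measurable (raw)]:
  assumes "f \<in> N \<rightarrow>\<^sub>M M" "g \<in> N \<rightarrow>\<^sub>M M"
  shows "(\<lambda>z. k (f z) (g z)) \<in> borel_measurable N"
  using measurable_compose[OF measurable_Pair[OF assms] measurable_kernel] by simp

lemma measurable_kernel_section [measurable]:
  "(\<lambda>v. k u v) \<in> borel_measurable M" "(\<lambda>v. k v u) \<in> borel_measurable M"
  by (auto intro!: measurable_kernel' simp: space_UNIV)

lemma kernel_integrable: "integrable M (\<lambda>v. k u v)" and kernel_integral: "(\<integral>v. k u v \<partial>M) = 1"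
proof -
  show "integrable M (\<lambda>v. k u v)"
    by (rule integrableI_nonneg) (auto simp: kernel_nonneg row)
  show "(\<integral>v. k u v \<partial>M) = 1"
    by (subst integral_eq_nn_integral) (auto simp: kernel_nonneg row)
qed

lemma A_nonneg: "0 \<le> A"
  using order_trans[OF kernel_nonneg kernel_le] .

lemma kernel_weighted_integrable:
  fixes f :: "'a \<Rightarrow> real"
  assumes "integrable M f"
  shows "integrable M (\<lambda>v. k u v * f v)"
proof -
  have [measurable]: "f \<in> borel_measurable M" using assms by simp
  show ?thesis
    by (rule Bochner_Integration.integrable_bound[OF integrable_mult_right[OF assms, of A]])
       (auto simp: abs_mult kernel_nonneg kernel_le A_nonneg intro!: mult_right_mono)
qed

text \<open>The tangent inequality at the mean \<open>m\<close>, integrated against the probability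
  density \<open>k u\<close>.\<close>

lemma jensen:
  fixes f :: "'a \<Rightarrow> real"
  assumes p: "p \<ge> 1" and [measurable]: "f \<in> borel_measurable M" and f: "\<And>v. 0 \<le> f v"
    and int: "integrable M (\<lambda>v. f v powr p)"
  shows "integrable M (\<lambda>v. k u v * f v)"
    and "(\<integral>v. k u v * f v \<partial>M) powr p \<le> (\<integral>v. k u v * f v powr p \<partial>M)"
proof -
  have i: "integrable M (\<lambda>v. k u v * f v powr p)" by (rule kernel_weighted_integrable[OF int])
  \<comment> \<open>Transfers integrability against the kernel from the \<open>p\<close>-th power of
    \<open>f\<close> to \<open>f\<close>.\<close>
  have le: "f v \<le> 1 + f v powr p" for v
  proof (cases "f v \<le> 1")
    case True
    then show ?thesis by (intro add_increasing2) auto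
  next
    case False
    then have "f v powr 1 \<le> f v powr p" using p by (intro powr_mono) auto
    with False show ?thesis by simp
  qed
  show i1: "integrable M (\<lambda>v. k u v * f v)"
  proof (rule Bochner_Integration.integrable_bound[OF Bochner_Integration.integrable_add[OF kernel_integrable i]])
    show "AE v in M. norm (k u v * f v) \<le> norm (k u v + k u v * f v powr p)"
    proof (intro AE_I2)
      fix v
      have "k u v * f v \<le> k u v * (1 + f v powr p)" by (intro mult_left_mono le kernel_nonneg)
      then show "norm (k u v * f v) \<le> norm (k u v + k u v * f v powr p)"
        using kernel_nonneg[of u v] f[of v] by (simp add: abs_mult algebra_simps)
    qed
  qed measurable
  define m where "m = (\<integral>v. k u v * f v \<partial>M)"
  have m0: "m \<ge> 0" unfolding m_def by (intro Bochner_Integration.integral_nonneg mult_nonneg_nonneg kernel_nonneg f)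
  have "m powr p \<le> (\<integral>v. k u v * f v powr p \<partial>M)"
  proof (cases "m = 0")
    case True
    then show ?thesis by (auto intro!: Bochner_Integration.integral_nonneg mult_nonneg_nonneg kernel_nonneg)
  next
    case False
    with m0 have m: "m > 0" by simp
    \<comment> \<open>Intercept and slope of the tangent at \<open>m\<close>.\<close>
    let ?c = "m powr p - p * m powr (p - 1) * m" and ?d = "p * m powr (p - 1)"
    have "m powr p = ?c * 1 + ?d * m" by simp
    also have "\<dots> = (\<integral>v. ?c * k u v + ?d * (k u v * f v) \<partial>M)"
      using i1 kernel_integrable[of u] kernel_integral[of u] by (simp add: m_def)
    also have "\<dots> \<le> (\<integral>v. k u v * f v powr p \<partial>M)"
    proof (rule integral_mono[OF _ i])
      show "integrable M (\<lambda>v. ?c * k u v + ?d * (k u v * f v))"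
        using i1 kernel_integrable[of u] by simp
      fix v
      have "k u v * (m powr p + p * m powr (p - 1) * (f v - m)) \<le> k u v * f v powr p"
        by (intro mult_left_mono powr_tangent_le p m f kernel_nonneg)
      then show "?c * k u v + ?d * (k u v * f v) \<le> k u v * f v powr p"
        by (simp add: algebra_simps)
    qed
    finally show ?thesis .
  qed
  then show "(\<integral>v. k u v * f v \<partial>M) powr p \<le> (\<integral>v. k u v * f v powr p \<partial>M)"
    by (simp add: m_def)
qed

lemma integrable_abs_kernel:
  assumes p: "1 \<le> p" and f: "f \<in> Lp_space M p"
  shows "integrable M (\<lambda>v. k u v * norm (f v))"
  using p
proof (cases rule: ennreal_cases_ge_1)
  case 1
  have [measurable]: "f \<in> borel_measurable M" using f by (rule Lp_space_measurable)
  show ?thesis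
  proof (rule Bochner_Integration.integrable_bound[OF integrable_mult_left[OF kernel_integrable[of u], of "Lp_norm M \<infinity> f"]])
    show "AE v in M. norm (k u v * norm (f v)) \<le> norm (k u v * Lp_norm M \<infinity> f)"
      using Lp_infinity_AE[OF f[unfolded 1]]
      by eventually_elim (auto simp: abs_mult kernel_nonneg Lp_norm_nonneg intro!: mult_left_mono)
  qed measurable
next
  case (2 q)
  then have f: "f \<in> borel_measurable M" "integrable M (\<lambda>u. norm (f u) powr q)"
    using f by (auto simp: Lp_space_finite_iff)
  show ?thesis
    by (rule jensen(1)[OF 2(1) _ _ f(2)]) (use f(1) in auto)
qed

lemma integrable_kernel:
  assumes p: "1 \<le> p" and f: "f \<in> Lp_space M p"
  shows "integrable M (\<lambda>v. of_real (k u v) * f v)"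
proof -
  have [measurable]: "f \<in> borel_measurable M" using f by (rule Lp_space_measurable)
  show ?thesis
    by (rule Bochner_Integration.integrable_bound[OF integrable_abs_kernel[OF assms, of u]])
       (auto simp: norm_mult abs_mult)
qed

lemma measurable_kernel_op [measurable]:
  assumes [measurable]: "f \<in> borel_measurable M"
  shows "kernel_op M k f \<in> borel_measurable M"
  unfolding kernel_op_def[abs_def] by measurable

lemma norm_kernel_op_le: "norm (kernel_op M k f u) \<le> (\<integral>v. k u v * norm (f v) \<partial>M)"
proof -
  have "norm (kernel_op M k f u) \<le> (\<integral>v. norm (of_real (k u v) * f v) \<partial>M)"
    unfolding kernel_op_def by (rule integral_norm_bound)
  then show ?thesis by (simp add: norm_mult kernel_nonneg)
qed

lemma norm_kernel_op_powr_le: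
  assumes p: "p \<ge> 1" and f: "f \<in> Lp_space M (ennreal p)"
  shows "norm (kernel_op M k f u) powr p \<le> (\<integral>v. k u v * norm (f v) powr p \<partial>M)"
proof -
  have f': "f \<in> borel_measurable M" "integrable M (\<lambda>u. norm (f u) powr p)"
    using f p by (auto simp: Lp_space_finite_iff)
  have "norm (kernel_op M k f u) powr p \<le> (\<integral>v. k u v * norm (f v) \<partial>M) powr p"
    using p by (intro powr_mono2 norm_kernel_op_le) auto
  also have "\<dots> \<le> (\<integral>v. k u v * norm (f v) powr p \<partial>M)"
    by (rule jensen(2)[OF p _ _ f'(2)]) (use f'(1) in auto)
  finally show ?thesis .
qed

lemma norm_kernel_op_powr_le_sup:
  assumes p: "p \<ge> 1" and f: "f \<in> Lp_space M (ennreal p)"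
  shows "norm (kernel_op M k f u) powr p \<le> A * (\<integral>v. norm (f v) powr p \<partial>M)"
proof -
  have i: "integrable M (\<lambda>u. norm (f u) powr p)"
    using f p by (auto simp: Lp_space_finite_iff)
  note norm_kernel_op_powr_le[OF assms]
  also have "(\<integral>v. k u v * norm (f v) powr p \<partial>M) \<le> (\<integral>v. A * norm (f v) powr p \<partial>M)"
    by (intro integral_mono kernel_weighted_integrable integrable_mult_right i mult_right_mono kernel_le) auto
  finally show ?thesis by simp
qed

text \<open>Jensen's inequality in each row, then Tonelli and the unit columns.\<close>

lemma kernel_op_contraction:
  assumes p: "p \<ge> 1" and f: "f \<in> Lp_space M (ennreal p)"
  shows "kernel_op M k f \<in> Lp_space M (ennreal p)"
    and "(\<integral>u. norm (kernel_op M k f u) powr p \<partial>M) \<le> (\<integral>u. norm (f u) powr p \<partial>M)"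
proof -
  interpret P: pair_sigma_finite M M ..
  have [measurable]: "f \<in> borel_measurable M" and i: "integrable M (\<lambda>u. norm (f u) powr p)"
    using f p by (auto simp: Lp_space_finite_iff)
  let ?I = "\<integral>u. norm (f u) powr p \<partial>M"
  have "(\<integral>\<^sup>+u. ennreal (norm (kernel_op M k f u) powr p) \<partial>M) \<le> (\<integral>\<^sup>+u. \<integral>\<^sup>+v. ennreal (k u v * norm (f v) powr p) \<partial>M \<partial>M)"
  proof (rule nn_integral_mono)
    fix u
    have "ennreal (norm (kernel_op M k f u) powr p) \<le> ennreal (\<integral>v. k u v * norm (f v) powr p \<partial>M)"
      by (rule ennreal_leI[OF norm_kernel_op_powr_le[OF p f]])
    also have "\<dots> = (\<integral>\<^sup>+v. ennreal (k u v * norm (f v) powr p) \<partial>M)"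
      by (rule nn_integral_eq_integral[symmetric]) (auto intro: kernel_weighted_integrable i simp: kernel_nonneg)
    finally show "ennreal (norm (kernel_op M k f u) powr p) \<le> (\<integral>\<^sup>+v. ennreal (k u v * norm (f v) powr p) \<partial>M)" .
  qed
  also have "\<dots> = (\<integral>\<^sup>+v. \<integral>\<^sup>+u. ennreal (k u v * norm (f v) powr p) \<partial>M \<partial>M)"
    by (rule P.Fubini'[symmetric]) measurable
  also have "\<dots> = (\<integral>\<^sup>+v. ennreal (norm (f v) powr p) \<partial>M)"
    by (simp add: ennreal_mult kernel_nonneg nn_integral_multc column)
  also have "\<dots> = ennreal ?I"
    by (rule nn_integral_eq_integral[OF i]) auto
  finally have le: "(\<integral>\<^sup>+u. ennreal (norm (kernel_op M k f u) powr p) \<partial>M) \<le> ennreal ?I" .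
  have "integrable M (\<lambda>u. norm (kernel_op M k f u) powr p)"
    by (rule integrableI_nonneg) (auto intro: le_less_trans[OF le])
  then show "kernel_op M k f \<in> Lp_space M (ennreal p)"
    using p by (simp add: Lp_space_finite_iff)
  have "(\<integral>u. norm (kernel_op M k f u) powr p \<partial>M) = enn2real (\<integral>\<^sup>+u. ennreal (norm (kernel_op M k f u) powr p) \<partial>M)"
    by (rule integral_eq_nn_integral) auto
  also have "\<dots> \<le> ?I"
    using enn2real_mono[OF le] by simp
  finally show "(\<integral>u. norm (kernel_op M k f u) powr p \<partial>M) \<le> ?I" .
qed

lemma norm_kernel_op_le_infinity:
  assumes f: "f \<in> Lp_space M \<infinity>"
  shows "norm (kernel_op M k f u) \<le> Lp_norm M \<infinity> f"
proof -
  have [measurable]: "f \<in> borel_measurable M" using f by (rule Lp_space_measurable)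
  note norm_kernel_op_le
  also have "(\<integral>v. k u v * norm (f v) \<partial>M) \<le> (\<integral>v. k u v * Lp_norm M \<infinity> f \<partial>M)"
  proof (rule integral_mono_AE)
    show "integrable M (\<lambda>v. k u v * norm (f v))" by (rule integrable_abs_kernel[OF _ f]) simp
    show "integrable M (\<lambda>v. k u v * Lp_norm M \<infinity> f)" by (intro integrable_mult_left kernel_integrable)
    show "AE v in M. k u v * norm (f v) \<le> k u v * Lp_norm M \<infinity> f"
      using Lp_infinity_AE[OF f] by eventually_elim (auto simp: kernel_nonneg intro!: mult_left_mono)
  qed
  finally show ?thesis by (simp add: kernel_integral)
qed

text \<open>Interpolation by hand: the power \<open>s\<close> of |K f| splits into the power
  \<open>s - q\<close>, controlled by the supremum bound, and the power \<open>q\<close>, controlled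
  by contraction. The exponents combine through (s - q) / (q s) = 1/q - 1/s.\<close>

lemma kernel_op_smoothing:
  assumes p: "1 \<le> p" "p \<le> r" and f: "f \<in> Lp_space M p" and A: "A > 0"
  shows "kernel_op M k f \<in> Lp_space M r"
    and "Lp_norm M r (kernel_op M k f) \<le> A powr (enn2real (inverse p) - enn2real (inverse r)) * Lp_norm M p f"
proof -
  have [measurable]: "f \<in> borel_measurable M" using f by (rule Lp_space_measurable)
  have "kernel_op M k f \<in> Lp_space M r \<and>
     Lp_norm M r (kernel_op M k f) \<le> A powr (enn2real (inverse p) - enn2real (inverse r)) * Lp_norm M p f"
    using p(1)
  proof (cases rule: ennreal_cases_ge_1)
    case 1
    then have r: "r = \<infinity>" using p(2) by (simp add: top_unique)
    show ?thesis
      using Lp_infinityI[of "kernel_op M k f" M "Lp_norm M \<infinity> f"] norm_kernel_op_le_infinity f A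
      by (auto simp: 1 r Lp_norm_nonneg)
  next
    case (2 q)
    then have q: "q > 0" and fq: "f \<in> Lp_space M (ennreal q)" using f by auto
    define I where "I = (\<integral>v. norm (f v) powr q \<partial>M)"
    have I: "I \<ge> 0" by (simp add: I_def)
    have invq: "enn2real (inverse p) = 1 / q"
      using q by (simp add: 2 inverse_ennreal divide_inverse)
    have normp: "Lp_norm M p f = I powr (1 / q)"
      using q by (simp add: 2 Lp_norm_finite I_def)
    have sup: "norm (kernel_op M k f u) \<le> A powr (1 / q) * I powr (1 / q)" for u
    proof -
      have "norm (kernel_op M k f u) = (norm (kernel_op M k f u) powr q) powr (1 / q)"
        using q by (simp add: powr_powr)
      also have "\<dots> \<le> (A * I) powr (1 / q)"
        using norm_kernel_op_powr_le_sup[OF 2(1) fq, of u] q by (intro powr_mono2) (auto simp: I_def)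
      finally show ?thesis using I A by (simp add: powr_mult)
    qed
    from order_trans[OF p] show ?thesis
    proof (cases rule: ennreal_cases_ge_1)
      case r: 1
      show ?thesis
        using Lp_infinityI[of "kernel_op M k f" M "A powr (1 / q) * I powr (1 / q)"] sup
        by (simp add: r invq normp)
    next
      case r: (2 s)
      then have qs: "q \<le> s" using p 2 by simp
      then have s: "s > 0" using q by simp
      have invs: "enn2real (inverse r) = 1 / s"
        using s by (simp add: r inverse_ennreal divide_inverse)
      define B where "B = A powr (1 / q) * I powr (1 / q)"
      have B: "B \<ge> 0" by (simp add: B_def)
      have pw: "norm (kernel_op M k f u) powr s \<le> B powr (s - q) * norm (kernel_op M k f u) powr q" for u
      proof -
        have "norm (kernel_op M k f u) powr s = norm (kernel_op M k f u) powr (s - q) * norm (kernel_op M k f u) powr q"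
          by (simp add: powr_add[symmetric])
        also have "\<dots> \<le> B powr (s - q) * norm (kernel_op M k f u) powr q"
          using sup qs by (intro mult_right_mono powr_mono2) (auto simp: B_def)
        finally show ?thesis .
      qed
      have iq: "integrable M (\<lambda>u. B powr (s - q) * norm (kernel_op M k f u) powr q)"
        using kernel_op_contraction(1)[OF 2(1) fq] q by (simp add: Lp_space_finite_iff)
      have int_s: "integrable M (\<lambda>u. norm (kernel_op M k f u) powr s)"
        by (rule Bochner_Integration.integrable_bound[OF iq]) (use pw in auto)
      have "(\<integral>u. norm (kernel_op M k f u) powr s \<partial>M) \<le> (\<integral>u. B powr (s - q) * norm (kernel_op M k f u) powr q \<partial>M)"
        by (rule integral_mono[OF int_s iq pw])
      also have "\<dots> \<le> B powr (s - q) * I"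
        using kernel_op_contraction(2)[OF 2(1) fq] by (simp add: I_def mult_left_mono)
      finally have "(\<integral>u. norm (kernel_op M k f u) powr s \<partial>M) powr (1 / s) \<le> (B powr (s - q) * I) powr (1 / s)"
        using s by (intro powr_mono2) auto
      also have "\<dots> = A powr (1 / q - 1 / s) * I powr (1 / q)"
      proof (cases "I = 0")
        case True
        then show ?thesis using q s by simp
      next
        case False
        then have I0: "I > 0" using I by simp
        have e: "(1 / q) * (s - q) * (1 / s) = 1 / q - 1 / s" using q s by (simp add: field_simps)
        have "(B powr (s - q) * I) powr (1 / s) = A powr ((1 / q) * (s - q) * (1 / s)) * (I powr ((1 / q) * (s - q) * (1 / s)) * I powr (1 / s))"
          using I0 A by (simp add: B_def powr_mult powr_powr mult_ac)
        also have "I powr ((1 / q) * (s - q) * (1 / s)) * I powr (1 / s) = I powr (1 / q)"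
          unfolding powr_add[symmetric] e by simp
        finally show ?thesis unfolding e .
      qed
      finally show ?thesis
        using int_s s by (simp add: r Lp_space_finite_iff Lp_norm_finite invq[unfolded 2] invs[unfolded r] normp[unfolded 2] 2)
    qed
  qed
  then show "kernel_op M k f \<in> Lp_space M r"
    and "Lp_norm M r (kernel_op M k f) \<le> A powr (enn2real (inverse p) - enn2real (inverse r)) * Lp_norm M p f"
    by auto
qed

lemma kernel_op_cong_AE:
  assumes [measurable]: "f \<in> borel_measurable M" "g \<in> borel_measurable M" and eq: "AE u in M. f u = g u"
  shows "kernel_op M k f u = kernel_op M k g u"
  unfolding kernel_op_def by (rule integral_cong_AE) (use eq in auto)

lemma kernel_op_linear:
  assumes p: "1 \<le> p" and f: "f \<in> Lp_space M p" and g: "g \<in> Lp_space M p"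
  shows "kernel_op M k (\<lambda>v. a * f v + b * g v) u = a * kernel_op M k f u + b * kernel_op M k g u"
proof -
  have "kernel_op M k (\<lambda>v. a * f v + b * g v) u = (\<integral>v. a * (of_real (k u v) * f v) + b * (of_real (k u v) * g v) \<partial>M)"
    unfolding kernel_op_def by (simp add: algebra_simps)
  also have "\<dots> = a * kernel_op M k f u + b * kernel_op M k g u"
    unfolding kernel_op_def using integrable_kernel[OF p f, of u] integrable_kernel[OF p g, of u] by simp
  finally show ?thesis .
qed

lemma Lp_operator_kernel_op:
  assumes p: "1 \<le> p" and A: "A > 0"
  shows "Lp_operator M p (kernel_op M k)"
  unfolding Lp_operator_def
proof (intro conjI ballI allI impI)
  show "kernel_op M k f \<in> Lp_space M p" if "f \<in> Lp_space M p" for f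
    using kernel_op_smoothing(1)[OF p order_refl that A] .
qed (auto simp: kernel_op_linear[OF p] intro!: kernel_op_cong_AE Lp_space_measurable AE_I2)

end

text \<open>The identity holds at every \<open>u\<close>, since the kernel law does. Fubini's
  condition is that law again, applied to |f|, together with integrability of |f| against the third
  kernel.\<close>

lemma kernel_op_compose:
  assumes "bistochastic_kernel M k1 A1" "bistochastic_kernel M k2 A2" "bistochastic_kernel M k3 A3"
    and ck: "\<And>u w. (\<integral>\<^sup>+v. ennreal (k1 u v) * ennreal (k2 v w) \<partial>M) = ennreal (k3 u w)"
    and p: "1 \<le> p" and f: "f \<in> Lp_space M p"
  shows "kernel_op M k1 (kernel_op M k2 f) u = kernel_op M k3 f u"
proof -
  interpret k1: bistochastic_kernel M k1 A1 by fact
  interpret k2: bistochastic_kernel M k2 A2 by fact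
  interpret k3: bistochastic_kernel M k3 A3 by fact
  interpret P: pair_sigma_finite M M ..
  have [measurable]: "f \<in> borel_measurable M" using f by (rule Lp_space_measurable)
  let ?g = "\<lambda>v w. of_real (k1 u v) * (of_real (k2 v w) * f w)"
  have int: "integrable (M \<Otimes>\<^sub>M M) (\<lambda>(v, w). ?g v w)"
  proof (rule integrableI_bounded)
    show m: "(\<lambda>(v, w). ?g v w) \<in> borel_measurable (M \<Otimes>\<^sub>M M)" by measurable
    have "(\<integral>\<^sup>+z. ennreal (norm (case z of (v, w) \<Rightarrow> ?g v w)) \<partial>(M \<Otimes>\<^sub>M M))
      = (\<integral>\<^sup>+w. \<integral>\<^sup>+v. ennreal (norm (?g v w)) \<partial>M \<partial>M)"
      by (subst P.nn_integral_snd[symmetric]) auto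
    also have "\<dots> = (\<integral>\<^sup>+w. ennreal (k3 u w) * ennreal (norm (f w)) \<partial>M)"
    proof (rule nn_integral_cong)
      fix w
      have "ennreal (norm (?g v w)) = ennreal (k1 u v) * ennreal (k2 v w) * ennreal (norm (f w))" for v
        by (simp add: norm_mult k1.kernel_nonneg k2.kernel_nonneg ennreal_mult mult.assoc)
      then show "(\<integral>\<^sup>+v. ennreal (norm (?g v w)) \<partial>M) = ennreal (k3 u w) * ennreal (norm (f w))"
        by (simp add: nn_integral_multc ck)
    qed
    also have "\<dots> = (\<integral>\<^sup>+w. ennreal (k3 u w * norm (f w)) \<partial>M)"
      by (simp add: ennreal_mult k3.kernel_nonneg)
    also have "\<dots> < \<infinity>"
      using k3.integrable_abs_kernel[OF p f, of u] by (simp add: nn_integral_eq_integral k3.kernel_nonneg)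
    finally show "(\<integral>\<^sup>+z. ennreal (norm (case z of (v, w) \<Rightarrow> ?g v w)) \<partial>(M \<Otimes>\<^sub>M M)) < \<infinity>" .
  qed
  have "kernel_op M k1 (kernel_op M k2 f) u = (\<integral>v. \<integral>w. ?g v w \<partial>M \<partial>M)"
    unfolding kernel_op_def by simp
  also have "\<dots> = (\<integral>w. \<integral>v. ?g v w \<partial>M \<partial>M)"
    by (rule P.Fubini_integral[OF int, symmetric])
  also have "\<dots> = (\<integral>w. of_real (k3 u w) * f w \<partial>M)"
  proof (rule Bochner_Integration.integral_cong[OF refl])
    fix w
    have "(\<integral>v. k1 u v * k2 v w \<partial>M) = enn2real (\<integral>\<^sup>+v. ennreal (k1 u v * k2 v w) \<partial>M)"
      by (rule integral_eq_nn_integral) (auto simp: k1.kernel_nonneg k2.kernel_nonneg k2.space_UNIV)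
    also have "\<dots> = k3 u w"
      by (simp add: ennreal_mult k1.kernel_nonneg k2.kernel_nonneg ck k3.kernel_nonneg)
    finally have "(\<integral>v. complex_of_real (k1 u v * k2 v w) * f w \<partial>M) = of_real (k3 u w) * f w"
      by (simp only: integral_mult_left_zero integral_complex_of_real)
    then show "(\<integral>v. ?g v w \<partial>M) = of_real (k3 u w) * f w"
      by (simp add: mult.assoc)
  qed
  finally show ?thesis by (simp add: kernel_op_def)
qed

section \<open>Strong continuity of concentrating kernels\<close>

text \<open>The \<open>p\<close>-th power of the norm with values in \<open>ennreal\<close>. It is
  meaningful for every measurable function, so estimates carry no integrability conditions.\<close>

definition Lp_mass :: "'a measure \<Rightarrow> real \<Rightarrow> ('a \<Rightarrow> complex) \<Rightarrow> ennreal" where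
  "Lp_mass M p f = (\<integral>\<^sup>+u. ennreal (norm (f u) powr p) \<partial>M)"

lemma Lp_space_iff_mass:
  assumes "p \<ge> 0"
  shows "f \<in> Lp_space M (ennreal p) \<longleftrightarrow> f \<in> borel_measurable M \<and> Lp_mass M p f < \<infinity>"
  using assms by (auto simp: Lp_space_finite_iff Lp_mass_def integrable_iff_bounded)

lemma Lp_norm_eq_mass:
  assumes "p \<ge> 0" "f \<in> borel_measurable M"
  shows "Lp_norm M (ennreal p) f = enn2real (Lp_mass M p f) powr (1 / p)"
  unfolding Lp_norm_finite[OF assms(1)] Lp_mass_def
  using assms(2) by (subst integral_eq_nn_integral) auto

text \<open>Only convergence to 0 is at stake later, so the constant \<open>2 powr p\<close> may
  take the place of Minkowski's inequality.\<close>

lemma norm_add_powr_le: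
  fixes a b :: complex
  assumes p: "p \<ge> 1"
  shows "norm (a + b) powr p \<le> 2 powr p * (norm a powr p + norm b powr p)"
proof -
  have "norm (a + b) \<le> 2 * max (norm a) (norm b)"
    using norm_triangle_ineq[of a b] by simp
  then have "norm (a + b) powr p \<le> (2 * max (norm a) (norm b)) powr p"
    using p by (intro powr_mono2) auto
  also have "\<dots> = 2 powr p * max (norm a) (norm b) powr p"
    by (simp add: powr_mult)
  also have "max (norm a) (norm b) powr p \<le> norm a powr p + norm b powr p"
    by (auto simp: max_def)
  finally show ?thesis by simp
qed

lemma Lp_mass_add_le:
  assumes p: "p \<ge> 1" and [measurable]: "f \<in> borel_measurable M" "g \<in> borel_measurable M"
  shows "Lp_mass M p (\<lambda>u. f u + g u) \<le> ennreal (2 powr p) * (Lp_mass M p f + Lp_mass M p g)"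
proof -
  have "Lp_mass M p (\<lambda>u. f u + g u) \<le> (\<integral>\<^sup>+u. ennreal (2 powr p) * (ennreal (norm (f u) powr p) + ennreal (norm (g u) powr p)) \<partial>M)"
    unfolding Lp_mass_def
    by (intro nn_integral_mono)
       (use norm_add_powr_le[OF p] in \<open>simp add: ennreal_mult[symmetric] ennreal_plus[symmetric] ennreal_leI del: ennreal_plus\<close>)
  also have "\<dots> = ennreal (2 powr p) * (Lp_mass M p f + Lp_mass M p g)"
    by (simp add: Lp_mass_def nn_integral_cmult nn_integral_add)
  finally show ?thesis .
qed

lemma Lp_mass_mult: "f \<in> borel_measurable M \<Longrightarrow> Lp_mass M p (\<lambda>u. c * f u) = ennreal (norm c powr p) * Lp_mass M p f"
  unfolding Lp_mass_def by (simp add: norm_mult powr_mult ennreal_mult nn_integral_cmult)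

lemma Lp_space_add:
  assumes p: "p \<ge> 1" and f: "f \<in> Lp_space M (ennreal p)" and g: "g \<in> Lp_space M (ennreal p)"
  shows "(\<lambda>u. f u + g u) \<in> Lp_space M (ennreal p)"
proof -
  have fg: "f \<in> borel_measurable M" "g \<in> borel_measurable M" "Lp_mass M p f < \<infinity>" "Lp_mass M p g < \<infinity>"
    using p f g by (auto simp: Lp_space_iff_mass)
  then have "Lp_mass M p (\<lambda>u. f u + g u) < \<infinity>"
    using le_less_trans[OF Lp_mass_add_le[OF p fg(1,2)]] by (simp add: ennreal_mult_less_top)
  with fg p show ?thesis by (simp add: Lp_space_iff_mass)
qed

lemma Lp_space_mult:
  assumes p: "p \<ge> 1" and f: "f \<in> Lp_space M (ennreal p)"
  shows "(\<lambda>u. c * f u) \<in> Lp_space M (ennreal p)"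
  using assms by (auto simp: Lp_space_iff_mass Lp_mass_mult ennreal_mult_less_top)

text \<open>Pointwise approximations with |F i| at most 2 |f| have the majorant 3^p |f|^p for |F i -
  f|^p, and dominated convergence applies.\<close>

lemma Lp_simple_approximation:
  assumes p: "p \<ge> 1" and f: "f \<in> Lp_space M (ennreal p)"
  obtains F where "\<And>i. simple_function M (F i)" "\<And>i. F i \<in> Lp_space M (ennreal p)"
    "(\<lambda>i. Lp_mass M p (\<lambda>u. F i u - f u)) \<longlonglongrightarrow> 0"
proof -
  have fm[measurable]: "f \<in> borel_measurable M" and fi: "Lp_mass M p f < \<infinity>"
    using p f by (auto simp: Lp_space_iff_mass)
  obtain F where F: "\<And>i. simple_function M (F i)" "\<And>x. x \<in> space M \<Longrightarrow> (\<lambda>i. F i x) \<longlonglongrightarrow> f x"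
    "\<And>i x. x \<in> space M \<Longrightarrow> dist (F i x) 0 \<le> 2 * dist (f x) 0"
    using borel_measurable_implies_sequence_metric[OF fm, of 0] by blast
  have [measurable]: "F i \<in> borel_measurable M" for i
    by (rule borel_measurable_simple_function[OF F(1)])
  have le: "norm (F i x - f x) powr p \<le> 3 powr p * norm (f x) powr p" if "x \<in> space M" for i x
  proof -
    have "norm (F i x - f x) \<le> 3 * norm (f x)"
      using norm_triangle_ineq4[of "F i x" "f x"] F(3)[OF that, of i] by simp
    then have "norm (F i x - f x) powr p \<le> (3 * norm (f x)) powr p"
      using p by (intro powr_mono2) auto
    then show ?thesis by (simp add: powr_mult)
  qed
  have FL: "F i \<in> Lp_space M (ennreal p)" for i
  proof -
    have "Lp_mass M p (F i) \<le> Lp_mass M p (\<lambda>u. 2 * f u)"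
      unfolding Lp_mass_def using F(3)[of _ i] p
      by (intro nn_integral_mono ennreal_leI powr_mono2) (auto simp: norm_mult)
    also have "\<dots> < \<infinity>" using fi by (simp add: Lp_mass_mult ennreal_mult_less_top)
    finally show ?thesis using p by (simp add: Lp_space_iff_mass)
  qed
  have "(\<lambda>i. Lp_mass M p (\<lambda>u. F i u - f u)) \<longlonglongrightarrow> (\<integral>\<^sup>+u. 0 \<partial>M)"
    unfolding Lp_mass_def
  proof (rule nn_integral_dominated_convergence[where w="\<lambda>u. ennreal (3 powr p) * ennreal (norm (f u) powr p)"])
    show "AE x in M. (\<lambda>i. ennreal (norm (F i x - f x) powr p)) \<longlonglongrightarrow> 0"
    proof (rule AE_I2)
      fix x assume x: "x \<in> space M"
      have "(\<lambda>i. norm (F i x - f x)) \<longlonglongrightarrow> 0"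
        using tendsto_norm_zero[OF Lim_null[THEN iffD1, OF F(2)[OF x]]] .
      then have "(\<lambda>i. norm (F i x - f x) powr p) \<longlonglongrightarrow> 0 powr p"
        using p by (intro tendsto_powr') auto
      then show "(\<lambda>i. ennreal (norm (F i x - f x) powr p)) \<longlonglongrightarrow> 0"
        using tendsto_ennrealI by fastforce
    qed
    show "(\<integral>\<^sup>+u. ennreal (3 powr p) * ennreal (norm (f u) powr p) \<partial>M) < \<infinity>"
      using fi by (simp add: Lp_mass_def nn_integral_cmult ennreal_mult_less_top)
  qed (use le in \<open>auto simp: ennreal_mult[symmetric] ennreal_leI\<close>)
  then have "(\<lambda>i. Lp_mass M p (\<lambda>u. F i u - f u)) \<longlonglongrightarrow> 0" by simp
  with F(1) FL that show ?thesis by blast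
qed

text \<open>Take a closed inner approximation and cut it by a large ball; by finite measure the part
  outside the ball is small.\<close>

lemma lmeasurable_inner_compact:
  fixes S :: "'a::euclidean_space set"
  assumes S: "S \<in> lmeasurable" and e: "e > 0"
  obtains C where "compact C" "C \<subseteq> S" "emeasure lebesgue (S - C) < ennreal e"
proof -
  have SL: "S \<in> sets lebesgue" using S by (rule fmeasurableD)
  have e2: "e / 2 > 0" using e by simp
  obtain T where T: "closed T" "T \<subseteq> S" "emeasure lebesgue (S - T) < ennreal (e / 2)"
    by (rule sets_lebesgue_inner_closed[OF SL e2])
  have [measurable]: "S \<in> sets lebesgue" "T \<in> sets lebesgue" using SL T by auto
  have fin: "emeasure lebesgue S < \<infinity>" using S by (auto simp: fmeasurable_def)
  have "(\<lambda>n. emeasure lebesgue (T - cball 0 (real n))) \<longlonglongrightarrow> emeasure lebesgue (\<Inter>n. T - cball 0 (real n))"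
  proof (rule Lim_emeasure_decseq)
    show "range (\<lambda>n. T - cball 0 (real n)) \<subseteq> sets lebesgue" by auto
    show "decseq (\<lambda>n. T - cball 0 (real n))"
      by (auto simp: decseq_def)
    show "emeasure lebesgue (T - cball 0 (real n)) \<noteq> \<infinity>" for n
    proof -
      have "emeasure lebesgue (T - cball 0 (real n)) \<le> emeasure lebesgue S"
        using T(2) by (intro emeasure_mono) auto
      then show ?thesis using fin by (auto simp: top_unique)
    qed
  qed
  also have "(\<Inter>n. T - cball 0 (real n)) = {}"
    by (auto simp: real_arch_simple)
  finally have "\<forall>\<^sub>F n in sequentially. emeasure lebesgue (T - cball 0 (real n)) < ennreal (e / 2)"
    using e by (auto dest: order_tendstoD(2)[where a="ennreal (e / 2)"])
  then obtain n where n: "emeasure lebesgue (T - cball 0 (real n)) < ennreal (e / 2)"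
    by (auto simp: eventually_sequentially)
  have "emeasure lebesgue (S - T \<inter> cball 0 (real n)) = emeasure lebesgue ((S - T) \<union> (T - cball 0 (real n)))"
    using T(2) by (intro arg_cong[where f="emeasure lebesgue"]) auto
  also have "\<dots> \<le> emeasure lebesgue (S - T) + emeasure lebesgue (T - cball 0 (real n))"
    by (rule emeasure_subadditive) auto
  also have "\<dots> < ennreal (e / 2) + ennreal (e / 2)"
    using T(3) n by (rule add_strict_mono)
  also have "\<dots> = ennreal e" using e by (simp flip: ennreal_plus)
  finally have "emeasure lebesgue (S - T \<inter> cball 0 (real n)) < ennreal e" .
  moreover have "compact (T \<inter> cball 0 (real n))" using T(1) by (rule closed_Int_compact) simp
  ultimately show ?thesis using that T(2) by blast
qed

text \<open>The tail condition is pointwise in \<open>u\<close>, because the spread of the heat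
  kernel in the second variable grows with |x|.\<close>

locale concentrating_kernels =
  fixes k :: "nat \<Rightarrow> 'c::euclidean_space \<Rightarrow> 'c \<Rightarrow> real" and A :: "nat \<Rightarrow> real"
  assumes bistochastic: "\<And>n. bistochastic_kernel lebesgue (k n) (A n)"
    and symmetric: "\<And>n u v. k n u v = k n v u"
    and tail: "\<And>u d. d > 0 \<Longrightarrow> (\<lambda>n. \<integral>\<^sup>+v. ennreal (k n u v) * indicator {v. d \<le> dist u v} v \<partial>lebesgue) \<longlonglongrightarrow> 0"
begin

abbreviation K :: "nat \<Rightarrow> ('c \<Rightarrow> complex) \<Rightarrow> 'c \<Rightarrow> complex" where
  "K n \<equiv> kernel_op lebesgue (k n)"

text \<open>Enclose \<open>S\<close> between a compact \<open>C\<close> and an open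
  \<open>U\<close>. Where the indicators at \<open>u\<close> and \<open>v\<close> differ, one point
  lies in the thin set \<open>U - C\<close>, or one lies in \<open>C\<close> and the other outside
  \<open>U\<close>. Unit rows and columns bound the first part by the measure of
  \<open>U - C\<close>, the tail condition handles the second.\<close>

lemma indicator_defect:
  assumes S: "S \<in> lmeasurable"
  shows "(\<lambda>n. \<integral>\<^sup>+u. \<integral>\<^sup>+v. ennreal (k n u v * \<bar>indicator S v - indicator S u\<bar>) \<partial>lebesgue \<partial>lebesgue) \<longlonglongrightarrow> 0"
proof (rule order_tendstoI)
  fix e :: ennreal assume e: "0 < e"
  obtain r :: real where r: "0 < r" "ennreal r < e"
    using dense[OF e] by (metis ennreal_cases ennreal_less_zero_iff not_less_iff_gr_or_eq order.strict_trans top.not_eq_extremum)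
  \<comment> \<open>The final bound is 6 s: twice the measure of \<open>U - C\<close>, which is at
    most 2 s, and two tail terms below s.\<close>
  define s where "s = r / 8"
  have s: "s > 0" using r by (simp add: s_def)
  have SL: "S \<in> sets lebesgue" using S by (simp add: fmeasurableD)
  obtain U where U: "open U" "S \<subseteq> U" "emeasure lebesgue (U - S) < ennreal s"
    using sets_lebesgue_outer_open[OF SL s] by blast
  obtain C where C: "compact C" "C \<subseteq> S" "emeasure lebesgue (S - C) < ennreal s"
    using lmeasurable_inner_compact[OF S s] by blast
  have [measurable]: "S \<in> sets lebesgue" "U \<in> sets lebesgue" "C \<in> sets lebesgue"
    using SL U lmeasurable_compact[OF C(1)] by (auto dest: fmeasurableD)
  have "emeasure lebesgue (U - C) = emeasure lebesgue ((U - S) \<union> (S - C))"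
    using U(2) C(2) by (intro arg_cong[where f="emeasure lebesgue"]) auto
  also have "\<dots> \<le> emeasure lebesgue (U - S) + emeasure lebesgue (S - C)"
    by (rule emeasure_subadditive) auto
  also have "\<dots> \<le> ennreal s + ennreal s" using U(3) C(3) by (intro add_mono) auto
  finally have UC: "emeasure lebesgue (U - C) \<le> ennreal (2 * s)" using s by (simp flip: ennreal_plus)
  obtain d where d: "d > 0" "\<And>x y. x \<in> C \<Longrightarrow> y \<in> - U \<Longrightarrow> d \<le> dist x y"
  proof -
    have "closed (- U)" "C \<inter> - U = {}" using U(1,2) C(2) by auto
    from separate_compact_closed[OF C(1) this] that show ?thesis by blast
  qed
  have [measurable]: "(\<lambda>x::'c. x) \<in> borel_measurable lebesgue"
    by (rule measurable_completion) simp
  define T where "T n u = (\<integral>\<^sup>+v. ennreal (k n u v) * indicator {v. d \<le> dist u v} v \<partial>lebesgue)" for n u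
  have bound: "(\<integral>\<^sup>+u. \<integral>\<^sup>+v. ennreal (k n u v * \<bar>indicator S v - indicator S u\<bar>) \<partial>lebesgue \<partial>lebesgue)
     \<le> ennreal (4 * s) + 2 * (\<integral>\<^sup>+u. T n u * indicator C u \<partial>lebesgue)" for n
  proof -
    interpret bistochastic_kernel lebesgue "k n" "A n" by (rule bistochastic)
    interpret P: pair_sigma_finite "lebesgue :: 'c measure" "lebesgue :: 'c measure" ..
    let ?k = "\<lambda>u v. ennreal (k n u v)"
    let ?D = "indicator (U - C) :: 'c \<Rightarrow> ennreal" and ?C = "indicator C :: 'c \<Rightarrow> ennreal" and ?V = "indicator (- U) :: 'c \<Rightarrow> ennreal"
    have pw: "ennreal (k n u v * \<bar>indicator S v - indicator S u\<bar>)
        \<le> (?k u v * ?D u + ?k u v * ?D v) + (?k u v * (?C u * ?V v) + ?k u v * (?C v * ?V u))" for u v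
    proof -
      have "ennreal \<bar>indicator S v - indicator S u\<bar> \<le> (?D u + ?D v) + (?C u * ?V v + ?C v * ?V u)"
        using U(2) C(2) by (auto simp: indicator_def)
      then have "?k u v * ennreal \<bar>indicator S v - indicator S u\<bar> \<le> ?k u v * ((?D u + ?D v) + (?C u * ?V v + ?C v * ?V u))"
        by (rule mult_left_mono) simp
      then show ?thesis by (simp add: ennreal_mult kernel_nonneg distrib_left)
    qed
    have "(\<integral>\<^sup>+u. \<integral>\<^sup>+v. ennreal (k n u v * \<bar>indicator S v - indicator S u\<bar>) \<partial>lebesgue \<partial>lebesgue)
      \<le> (\<integral>\<^sup>+u. \<integral>\<^sup>+v. (?k u v * ?D u + ?k u v * ?D v) + (?k u v * (?C u * ?V v) + ?k u v * (?C v * ?V u)) \<partial>lebesgue \<partial>lebesgue)"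
      by (intro nn_integral_mono pw)
    also have "\<dots> = ((\<integral>\<^sup>+u. \<integral>\<^sup>+v. ?k u v * ?D u \<partial>lebesgue \<partial>lebesgue) + (\<integral>\<^sup>+u. \<integral>\<^sup>+v. ?k u v * ?D v \<partial>lebesgue \<partial>lebesgue))
       + ((\<integral>\<^sup>+u. \<integral>\<^sup>+v. ?k u v * (?C u * ?V v) \<partial>lebesgue \<partial>lebesgue) + (\<integral>\<^sup>+u. \<integral>\<^sup>+v. ?k u v * (?C v * ?V u) \<partial>lebesgue \<partial>lebesgue))"
      by (simp add: nn_integral_add)
    also have "(\<integral>\<^sup>+u. \<integral>\<^sup>+v. ?k u v * ?D u \<partial>lebesgue \<partial>lebesgue) = emeasure lebesgue (U - C)"
      by (simp add: nn_integral_multc row)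
    also have "(\<integral>\<^sup>+u. \<integral>\<^sup>+v. ?k u v * ?D v \<partial>lebesgue \<partial>lebesgue) = (\<integral>\<^sup>+v. \<integral>\<^sup>+u. ?k u v * ?D v \<partial>lebesgue \<partial>lebesgue)"
      by (rule P.Fubini'[symmetric]) measurable
    also have "\<dots> = emeasure lebesgue (U - C)"
      by (simp add: nn_integral_multc column)
    also have "(\<integral>\<^sup>+u. \<integral>\<^sup>+v. ?k u v * (?C v * ?V u) \<partial>lebesgue \<partial>lebesgue) = (\<integral>\<^sup>+v. \<integral>\<^sup>+u. ?k u v * (?C v * ?V u) \<partial>lebesgue \<partial>lebesgue)"
      by (rule P.Fubini'[symmetric]) measurable
    \<comment> \<open>Symmetry of the kernel identifies the two terms in which \<open>C\<close> and
      the complement of \<open>U\<close> are exchanged.\<close>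
    also have "\<dots> = (\<integral>\<^sup>+u. \<integral>\<^sup>+v. ?k u v * (?C u * ?V v) \<partial>lebesgue \<partial>lebesgue)"
      by (intro nn_integral_cong) (simp add: symmetric)
    also have "(\<integral>\<^sup>+u. \<integral>\<^sup>+v. ?k u v * (?C u * ?V v) \<partial>lebesgue \<partial>lebesgue) \<le> (\<integral>\<^sup>+u. T n u * ?C u \<partial>lebesgue)"
    proof (rule nn_integral_mono)
      fix u
      have "(\<integral>\<^sup>+v. ?k u v * (?C u * ?V v) \<partial>lebesgue) \<le> (\<integral>\<^sup>+v. ?k u v * indicator {v. d \<le> dist u v} v * ?C u \<partial>lebesgue)"
        using d(2) by (intro nn_integral_mono) (auto simp: indicator_def)
      also have "\<dots> = T n u * ?C u"
        unfolding T_def by (rule nn_integral_multc) measurable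
      finally show "(\<integral>\<^sup>+v. ?k u v * (?C u * ?V v) \<partial>lebesgue) \<le> T n u * ?C u" .
    qed
    finally have "(\<integral>\<^sup>+u. \<integral>\<^sup>+v. ennreal (k n u v * \<bar>indicator S v - indicator S u\<bar>) \<partial>lebesgue \<partial>lebesgue)
       \<le> (emeasure lebesgue (U - C) + emeasure lebesgue (U - C)) + ((\<integral>\<^sup>+u. T n u * ?C u \<partial>lebesgue) + (\<integral>\<^sup>+u. T n u * ?C u \<partial>lebesgue))"
      by (simp add: add_mono)
    also have "\<dots> \<le> (ennreal (2 * s) + ennreal (2 * s)) + ((\<integral>\<^sup>+u. T n u * ?C u \<partial>lebesgue) + (\<integral>\<^sup>+u. T n u * ?C u \<partial>lebesgue))"
      by (intro add_mono UC order_refl)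
    also have "ennreal (2 * s) + ennreal (2 * s) = ennreal (4 * s)"
      using s by (simp flip: ennreal_plus)
    finally show ?thesis by (simp add: mult_2)
  qed
  have T_meas: "T n \<in> borel_measurable lebesgue" for n
  proof -
    interpret bistochastic_kernel lebesgue "k n" "A n" by (rule bistochastic)
    have [measurable]: "(\<lambda>(u, v). indicator {v. d \<le> dist u v} v :: ennreal) \<in> borel_measurable (lebesgue \<Otimes>\<^sub>M (lebesgue :: 'c measure))"
      by measurable
    show ?thesis unfolding T_def by measurable
  qed
  note [measurable] = T_meas
  have T_le: "T n u \<le> 1" for n u
  proof -
    interpret bistochastic_kernel lebesgue "k n" "A n" by (rule bistochastic)
    have "T n u \<le> (\<integral>\<^sup>+v. ennreal (k n u v) \<partial>lebesgue)"
      unfolding T_def by (intro nn_integral_mono) (auto simp: indicator_def)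
    then show ?thesis by (simp add: row)
  qed
  \<comment> \<open>The tails are at most 1 and \<open>C\<close> has finite measure, so their
    pointwise decay is enough.\<close>
  have "(\<lambda>n. \<integral>\<^sup>+u. T n u * indicator C u \<partial>lebesgue) \<longlonglongrightarrow> (\<integral>\<^sup>+u. 0 \<partial>(lebesgue :: 'c measure))"
  proof (rule nn_integral_dominated_convergence[where w="indicator C"])
    show "AE u in lebesgue. (\<lambda>n. T n u * indicator C u) \<longlonglongrightarrow> 0"
      using tail[OF d(1)] by (auto simp: T_def indicator_def)
    show "AE u in lebesgue. T n u * indicator C u \<le> indicator C u" for n
      using T_le by (auto simp: indicator_def)
    show "(\<integral>\<^sup>+u. indicator C u \<partial>lebesgue) < \<infinity>" using lmeasurable_compact[OF C(1)] by (subst nn_integral_indicator) (auto simp: fmeasurable_def)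
  qed measurable
  then have "\<forall>\<^sub>F n in sequentially. (\<integral>\<^sup>+u. T n u * indicator C u \<partial>lebesgue) < ennreal s"
    using s by (auto dest: order_tendstoD(2)[where a="ennreal s"])
  then show "\<forall>\<^sub>F n in sequentially. (\<integral>\<^sup>+u. \<integral>\<^sup>+v. ennreal (k n u v * \<bar>indicator S v - indicator S u\<bar>) \<partial>lebesgue \<partial>lebesgue) < e"
  proof eventually_elim
    case (elim n)
    note bound[of n]
    also have "ennreal (4 * s) + 2 * (\<integral>\<^sup>+u. T n u * indicator C u \<partial>lebesgue) \<le> ennreal (4 * s) + 2 * ennreal s"
      using elim by (intro add_mono mult_left_mono) auto
    also have "\<dots> = ennreal (6 * s)"
    proof -
      have e1: "ennreal s + ennreal s = ennreal (2 * s)" using s by (simp flip: ennreal_plus)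
      have e2: "ennreal (4 * s) + ennreal (2 * s) = ennreal (6 * s)" using s by (simp flip: ennreal_plus)
      show ?thesis by (simp only: mult_2[of "ennreal s"] e1 e2)
    qed
    also have "\<dots> \<le> ennreal r" using r by (intro ennreal_leI) (simp add: s_def)
    also note r(2)
    finally show ?case .
  qed
qed simp

text \<open>The difference has modulus at most 1, so its \<open>p\<close>-th power is at most the
  modulus, and the L^1 defect controls every finite \<open>p\<close>.\<close>

lemma kernel_op_indicator_tendsto:
  assumes p: "p \<ge> 1" and S: "S \<in> lmeasurable"
  shows "(\<lambda>n. Lp_mass lebesgue p (\<lambda>u. K n (indicator S) u - indicator S u)) \<longlonglongrightarrow> 0"
proof (rule tendsto_sandwich[OF _ _ tendsto_const indicator_defect[OF S]])
  have [measurable]: "S \<in> sets lebesgue" using S by (simp add: fmeasurableD)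
  have "Lp_mass lebesgue p (\<lambda>u. K n (indicator S) u - indicator S u)
     \<le> (\<integral>\<^sup>+u. \<integral>\<^sup>+v. ennreal (k n u v * \<bar>indicator S v - indicator S u\<bar>) \<partial>lebesgue \<partial>lebesgue)" for n
    unfolding Lp_mass_def
  proof (rule nn_integral_mono)
    interpret bistochastic_kernel lebesgue "k n" "A n" by (rule bistochastic)
    fix u
    let ?g = "\<lambda>v. k n u v * (indicator S v - indicator S u)"
    have i1: "integrable lebesgue (\<lambda>v. k n u v * indicator S v)"
      by (rule Bochner_Integration.integrable_bound[OF kernel_integrable[of u]]) (auto simp: indicator_def)
    have gi: "integrable lebesgue ?g"
      using Bochner_Integration.integrable_diff[OF i1 integrable_mult_left[OF kernel_integrable[of u], of "indicator S u"]]
      by (simp add: right_diff_distrib)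
    have "K n (indicator S) u = complex_of_real (\<integral>v. k n u v * indicator S v \<partial>lebesgue)"
      unfolding kernel_op_def integral_complex_of_real[symmetric]
      by (intro Bochner_Integration.integral_cong) (auto simp: indicator_def)
    moreover have "(\<integral>v. ?g v \<partial>lebesgue) = (\<integral>v. k n u v * indicator S v \<partial>lebesgue) - indicator S u"
      using i1 kernel_integrable[of u] kernel_integral[of u] by (simp add: right_diff_distrib)
    ultimately have eq: "K n (indicator S) u - indicator S u = complex_of_real (\<integral>v. ?g v \<partial>lebesgue)"
      by (auto simp: indicator_def)
    have abs: "\<bar>?g v\<bar> = k n u v * \<bar>indicator S v - indicator S u\<bar>" for v
      by (simp add: abs_mult kernel_nonneg)
    have ai: "integrable lebesgue (\<lambda>v. k n u v * \<bar>indicator S v - indicator S u\<bar>)"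
      using integrable_abs[OF gi] by (simp add: abs)
    have le: "\<bar>\<integral>v. ?g v \<partial>lebesgue\<bar> \<le> (\<integral>v. k n u v * \<bar>indicator S v - indicator S u\<bar> \<partial>lebesgue)"
      using integral_abs_bound[of lebesgue ?g] by (simp add: abs)
    also have "\<dots> \<le> (\<integral>v. k n u v \<partial>lebesgue)"
      by (intro integral_mono ai kernel_integrable) (auto simp: indicator_def kernel_nonneg)
    finally have le1: "\<bar>\<integral>v. ?g v \<partial>lebesgue\<bar> \<le> 1" by (simp add: kernel_integral)
    have "\<bar>\<integral>v. ?g v \<partial>lebesgue\<bar> powr p \<le> \<bar>\<integral>v. ?g v \<partial>lebesgue\<bar>"
      using powr_mono'[of 1 p "\<bar>\<integral>v. ?g v \<partial>lebesgue\<bar>"] p le1 by simp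
    then have "ennreal (norm (K n (indicator S) u - indicator S u) powr p)
      \<le> ennreal (\<integral>v. k n u v * \<bar>indicator S v - indicator S u\<bar> \<partial>lebesgue)"
      unfolding eq using le by (intro ennreal_leI) simp
    also have "\<dots> = (\<integral>\<^sup>+v. ennreal (k n u v * \<bar>indicator S v - indicator S u\<bar>) \<partial>lebesgue)"
      by (rule nn_integral_eq_integral[symmetric, OF ai]) (auto simp: kernel_nonneg)
    finally show "ennreal (norm (K n (indicator S) u - indicator S u) powr p)
       \<le> (\<integral>\<^sup>+v. ennreal (k n u v * \<bar>indicator S v - indicator S u\<bar>) \<partial>lebesgue)" .
  qed
  then show "\<forall>\<^sub>F n in sequentially. Lp_mass lebesgue p (\<lambda>u. K n (indicator S) u - indicator S u)
     \<le> (\<integral>\<^sup>+u. \<integral>\<^sup>+v. ennreal (k n u v * \<bar>indicator S v - indicator S u\<bar>) \<partial>lebesgue \<partial>lebesgue)"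
    by simp
qed simp

lemma kernel_op_add_tendsto:
  assumes p: "p \<ge> 1" and f: "f \<in> Lp_space lebesgue (ennreal p)" and g: "g \<in> Lp_space lebesgue (ennreal p)"
    and "(\<lambda>n. Lp_mass lebesgue p (\<lambda>u. K n f u - f u)) \<longlonglongrightarrow> 0"
    and "(\<lambda>n. Lp_mass lebesgue p (\<lambda>u. K n g u - g u)) \<longlonglongrightarrow> 0"
  shows "(\<lambda>n. Lp_mass lebesgue p (\<lambda>u. K n (\<lambda>v. a * f v + b * g v) u - (a * f u + b * g u))) \<longlonglongrightarrow> 0"
proof -
  have [measurable]: "f \<in> borel_measurable lebesgue" "g \<in> borel_measurable lebesgue"
    using f g by (auto dest: Lp_space_measurable)
  have le: "Lp_mass lebesgue p (\<lambda>u. K n (\<lambda>v. a * f v + b * g v) u - (a * f u + b * g u))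
     \<le> ennreal (2 powr p) * (ennreal (norm a powr p) * Lp_mass lebesgue p (\<lambda>u. K n f u - f u)
         + ennreal (norm b powr p) * Lp_mass lebesgue p (\<lambda>u. K n g u - g u))" for n
  proof -
    interpret bistochastic_kernel lebesgue "k n" "A n" by (rule bistochastic)
    have p1: "1 \<le> ennreal p" using p by simp
    have "K n (\<lambda>v. a * f v + b * g v) u - (a * f u + b * g u)
      = a * (K n f u - f u) + b * (K n g u - g u)" for u
      unfolding kernel_op_linear[OF p1 f g] by (simp add: algebra_simps)
    then show ?thesis
      using Lp_mass_add_le[OF p, of "\<lambda>u. a * (K n f u - f u)" lebesgue "\<lambda>u. b * (K n g u - g u)"]
      by (simp add: Lp_mass_mult)
  qed
  have "(\<lambda>n. ennreal (2 powr p) * (ennreal (norm a powr p) * Lp_mass lebesgue p (\<lambda>u. K n f u - f u)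
         + ennreal (norm b powr p) * Lp_mass lebesgue p (\<lambda>u. K n g u - g u)))
     \<longlonglongrightarrow> ennreal (2 powr p) * (ennreal (norm a powr p) * 0 + ennreal (norm b powr p) * 0)"
    by (intro ennreal_tendsto_cmult tendsto_add assms) auto
  then have L: "(\<lambda>n. ennreal (2 powr p) * (ennreal (norm a powr p) * Lp_mass lebesgue p (\<lambda>u. K n f u - f u)
         + ennreal (norm b powr p) * Lp_mass lebesgue p (\<lambda>u. K n g u - g u))) \<longlonglongrightarrow> 0"
    by simp
  show ?thesis
    by (rule tendsto_sandwich[OF _ _ tendsto_const L]) (auto simp: le)
qed

lemma kernel_op_simple_tendsto:
  assumes p: "p \<ge> 1" and F: "simple_function lebesgue F" "F \<in> Lp_space lebesgue (ennreal p)"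
  shows "(\<lambda>n. Lp_mass lebesgue p (\<lambda>u. K n F u - F u)) \<longlonglongrightarrow> 0"
proof -
  \<comment> \<open>The value 0 is left out so that the remaining level sets have finite
    measure.\<close>
  define Y where "Y = range F - {0}"
  have Y: "finite Y" using F(1) by (auto simp: Y_def simple_function_def)
  have lm: "F -` {y} \<in> lmeasurable" if "y \<in> Y" for y
  proof -
    have y: "norm y > 0" using that by (auto simp: Y_def)
    have sets: "F -` {y} \<in> sets lebesgue" using simple_functionD(2)[OF F(1), of "{y}"] by simp
    have "ennreal (norm y powr p) * emeasure lebesgue (F -` {y}) = (\<integral>\<^sup>+u. ennreal (norm y powr p) * indicator (F -` {y}) u \<partial>lebesgue)"
      using sets by (simp add: nn_integral_cmult)
    also have "\<dots> \<le> Lp_mass lebesgue p F"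
      unfolding Lp_mass_def by (intro nn_integral_mono) (auto simp: indicator_def)
    also have "\<dots> < \<infinity>" using F(2) p by (simp add: Lp_space_iff_mass)
    finally have "emeasure lebesgue (F -` {y}) < \<infinity>"
      using y by (auto simp: ennreal_mult_less_top)
    with sets show ?thesis by (simp add: fmeasurable_def)
  qed
  have ind: "indicator S \<in> Lp_space lebesgue (ennreal p)" if S: "S \<in> lmeasurable" for S :: "'c set"
  proof -
    have "Lp_mass lebesgue p (indicator S) = (\<integral>\<^sup>+u. indicator S u \<partial>lebesgue)"
      unfolding Lp_mass_def using p by (intro nn_integral_cong) (auto simp: indicator_def)
    also have "\<dots> = emeasure lebesgue S"
      using S by (intro nn_integral_indicator fmeasurableD)
    also have "\<dots> < \<infinity>" using S by (auto simp: fmeasurable_def)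
    finally show ?thesis
      using S p by (simp add: Lp_space_iff_mass fmeasurableD)
  qed
  have "(\<lambda>u. \<Sum>y\<in>Z. y * indicator (F -` {y}) u) \<in> Lp_space lebesgue (ennreal p) \<and>
     (\<lambda>n. Lp_mass lebesgue p (\<lambda>u. K n (\<lambda>v. \<Sum>y\<in>Z. y * indicator (F -` {y}) v) u - (\<Sum>y\<in>Z. y * indicator (F -` {y}) u))) \<longlonglongrightarrow> 0"
    if "Z \<subseteq> Y" for Z
    using finite_subset[OF that Y] that
  proof (induction Z rule: finite_induct)
    case empty
    show ?case using p by (simp add: Lp_space_iff_mass Lp_mass_def kernel_op_def)
  next
    case (insert y Z)
    then have y: "F -` {y} \<in> lmeasurable" by (intro lm) auto
    have IH: "(\<lambda>u. \<Sum>y\<in>Z. y * indicator (F -` {y}) u) \<in> Lp_space lebesgue (ennreal p)"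
      "(\<lambda>n. Lp_mass lebesgue p (\<lambda>u. K n (\<lambda>v. \<Sum>y\<in>Z. y * indicator (F -` {y}) v) u - (\<Sum>y\<in>Z. y * indicator (F -` {y}) u))) \<longlonglongrightarrow> 0"
      using insert by auto
    have s: "(\<Sum>y\<in>insert y Z. y * indicator (F -` {y}) u) = y * indicator (F -` {y}) u + 1 * (\<Sum>y\<in>Z. y * indicator (F -` {y}) u)" for u
      by (simp only: sum.insert[OF insert.hyps] mult_1)
    show ?case
      unfolding s
      using kernel_op_add_tendsto[OF p ind[OF y] IH(1) kernel_op_indicator_tendsto[OF p y] IH(2), of y 1]
        Lp_space_add[OF p Lp_space_mult[OF p ind[OF y], of y] Lp_space_mult[OF p IH(1), of 1]]
      by blast
  qed
  from this[OF order_refl]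
  have "(\<lambda>n. Lp_mass lebesgue p (\<lambda>u. K n (\<lambda>v. \<Sum>y\<in>Y. y * indicator (F -` {y}) v) u - (\<Sum>y\<in>Y. y * indicator (F -` {y}) u))) \<longlonglongrightarrow> 0"
    by simp
  moreover have "(\<Sum>y\<in>Y. y * indicator (F -` {y}) u) = F u" for u
  proof (cases "F u = 0")
    case True
    then have "(\<Sum>y\<in>Y. y * indicator (F -` {y}) u) = (\<Sum>y\<in>Y. 0)"
      by (intro sum.cong) (auto simp: Y_def indicator_def)
    with True show ?thesis by simp
  next
    case False
    then have "F u \<in> Y" by (simp add: Y_def)
    then have "(\<Sum>y\<in>Y. y * indicator (F -` {y}) u) = F u * indicator (F -` {F u}) u + (\<Sum>y\<in>Y - {F u}. y * indicator (F -` {y}) u)"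
      using Y by (rule sum.remove[rotated])
    also have "(\<Sum>y\<in>Y - {F u}. y * indicator (F -` {y}) u) = 0"
      by (intro sum.neutral) (auto simp: indicator_def)
    finally show ?thesis by simp
  qed
  ultimately show ?thesis by simp
qed

lemma kernel_op_Lp_tendsto:
  assumes p: "p \<ge> 1" and f: "f \<in> Lp_space lebesgue (ennreal p)"
  shows "(\<lambda>n. Lp_mass lebesgue p (\<lambda>u. K n f u - f u)) \<longlonglongrightarrow> 0"
proof (rule order_tendstoI)
  fix e :: ennreal assume e: "0 < e"
  have [measurable]: "f \<in> borel_measurable lebesgue" using f by (rule Lp_space_measurable)
  obtain F where F: "\<And>i. simple_function lebesgue (F i)" "\<And>i. F i \<in> Lp_space lebesgue (ennreal p)"
    "(\<lambda>i. Lp_mass lebesgue p (\<lambda>u. F i u - f u)) \<longlonglongrightarrow> 0"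
    using Lp_simple_approximation[OF p f] by blast
  define c where "c = ennreal (2 powr p)"
  \<comment> \<open>Two uses of \<open>Lp_mass_add_le\<close> produce the nested constants. The
    summand 0 stands for the limit in \<open>n\<close> of the term with the simple function
    \<open>F i\<close>.\<close>
  have "(\<lambda>i. c * (Lp_mass lebesgue p (\<lambda>u. F i u - f u) + c * (0 + Lp_mass lebesgue p (\<lambda>u. F i u - f u)))) \<longlonglongrightarrow> c * (0 + c * (0 + 0))"
    unfolding c_def by (intro ennreal_tendsto_cmult tendsto_add F(3) tendsto_const) auto
  then have "\<forall>\<^sub>F i in sequentially. c * (Lp_mass lebesgue p (\<lambda>u. F i u - f u) + c * (0 + Lp_mass lebesgue p (\<lambda>u. F i u - f u))) < e"
    using e by (auto dest: order_tendstoD(2))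
  then obtain i where i: "c * (Lp_mass lebesgue p (\<lambda>u. F i u - f u) + c * (0 + Lp_mass lebesgue p (\<lambda>u. F i u - f u))) < e"
    by (auto simp: eventually_sequentially)
  have [measurable]: "F i \<in> borel_measurable lebesgue" using F(2) by (rule Lp_space_measurable)
  define g where "g u = F i u - f u" for u
  have [measurable]: "g \<in> borel_measurable lebesgue" unfolding g_def by measurable
  have gL: "g \<in> Lp_space lebesgue (ennreal p)"
    using Lp_space_add[OF p F(2)[of i] Lp_space_mult[OF p f, of "- 1"]] by (simp add: g_def[abs_def])
  have le: "Lp_mass lebesgue p (\<lambda>u. K n f u - f u)
    \<le> c * (Lp_mass lebesgue p g + c * (Lp_mass lebesgue p (\<lambda>u. K n (F i) u - F i u) + Lp_mass lebesgue p g))" for n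
  proof -
    interpret bistochastic_kernel lebesgue "k n" "A n" by (rule bistochastic)
    have p1: "1 \<le> ennreal p" using p by simp
    have "K n g u = K n (F i) u - K n f u" for u
      using kernel_op_linear[OF p1 F(2)[of i] f, of 1 "- 1" u] by (simp add: g_def[abs_def])
    \<comment> \<open>With g = F - f, linearity gives K f - f = - K g + (K F - F) + g.\<close>
    then have "Lp_mass lebesgue p (\<lambda>u. K n f u - f u)
      = Lp_mass lebesgue p (\<lambda>u. (- 1) * K n g u + ((K n (F i) u - F i u) + g u))"
      by (simp add: g_def)
    also have "\<dots> \<le> c * (Lp_mass lebesgue p (\<lambda>u. (- 1) * K n g u) + Lp_mass lebesgue p (\<lambda>u. (K n (F i) u - F i u) + g u))"
      unfolding c_def by (rule Lp_mass_add_le[OF p]) measurable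
    also have "\<dots> \<le> c * (Lp_mass lebesgue p g + c * (Lp_mass lebesgue p (\<lambda>u. K n (F i) u - F i u) + Lp_mass lebesgue p g))"
    proof (intro mult_left_mono add_mono)
      have gi: "integrable lebesgue (\<lambda>u. norm (g u) powr p)" "integrable lebesgue (\<lambda>u. norm (K n g u) powr p)"
        using gL kernel_op_contraction(1)[OF p gL] p by (auto simp: Lp_space_finite_iff)
      show "Lp_mass lebesgue p (\<lambda>u. (- 1) * K n g u) \<le> Lp_mass lebesgue p g"
        using kernel_op_contraction(2)[OF p gL] gi
        by (simp add: Lp_mass_def nn_integral_eq_integral)
      show "Lp_mass lebesgue p (\<lambda>u. (K n (F i) u - F i u) + g u)
        \<le> c * (Lp_mass lebesgue p (\<lambda>u. K n (F i) u - F i u) + Lp_mass lebesgue p g)"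
        unfolding c_def by (rule Lp_mass_add_le[OF p]) measurable
    qed auto
    finally show ?thesis .
  qed
  have "(\<lambda>n. c * (Lp_mass lebesgue p g + c * (Lp_mass lebesgue p (\<lambda>u. K n (F i) u - F i u) + Lp_mass lebesgue p g)))
    \<longlonglongrightarrow> c * (Lp_mass lebesgue p g + c * (0 + Lp_mass lebesgue p g))"
    unfolding c_def by (intro ennreal_tendsto_cmult tendsto_add tendsto_const kernel_op_simple_tendsto p F) auto
  then have "\<forall>\<^sub>F n in sequentially. c * (Lp_mass lebesgue p g + c * (Lp_mass lebesgue p (\<lambda>u. K n (F i) u - F i u) + Lp_mass lebesgue p g)) < e"
    using i by (auto simp: g_def[abs_def] dest: order_tendstoD(2))
  then show "\<forall>\<^sub>F n in sequentially. Lp_mass lebesgue p (\<lambda>u. K n f u - f u) < e"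
    by eventually_elim (rule le_less_trans[OF le])
qed simp

end

section \<open>Uniform continuity in total variation\<close>

text \<open>The Mehler kernel at \<open>x = e / s\<close>, \<open>w = x + v\<close> and frequency \<open>s a\<close>, in a form that is
  continuous up to \<open>s = 0\<close>. It is used with \<open>s = 1 / (1 + |x|)\<close>, so that \<open>|e| = 1 - s\<close>.\<close>

definition rescaled_mehler :: "real \<Rightarrow> real \<Rightarrow> 'a::euclidean_space \<Rightarrow> 'a \<Rightarrow> real \<Rightarrow> real" where
  "rescaled_mehler t s e v a = sqrt (mehler_Q t (s * a)) ^ DIM('a) *
     exp (- ((t / 2 * a\<^sup>2 * (shc (t / 2 * (s * a)) / cosh (t / 2 * (s * a))) * (norm (2 *\<^sub>R e + s *\<^sub>R v))\<^sup>2
        + mehler_P (t / 2) (s * a) * (norm v)\<^sup>2) / 4))"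

text \<open>The kernel in the variables v = w - x and z = s y, without the Jacobian factor. Unlike
  the kernel it makes sense at \<open>s = 0\<close>, which stands for infinite |x|.\<close>

definition rescaled_density :: "real \<Rightarrow> real \<Rightarrow> 'a::euclidean_space \<Rightarrow> 'a \<Rightarrow> 'b::euclidean_space \<Rightarrow> real" where
  "rescaled_density t s e v z =
     (\<integral>y. rescaled_mehler t s e v (norm y) * cos (y \<bullet> z) \<partial>lborel) / (sqrt (2 * pi) ^ DIM('a) * (2 * pi) ^ DIM('b))"

lemma rescaled_mehler_eq:
  fixes v :: "'a::euclidean_space"
  assumes t: "t > 0" and s: "s > 0"
  shows "mehler t ((1 / s) *\<^sub>R e) ((1 / s) *\<^sub>R e + v) (s * a) = rescaled_mehler t s e v a"
proof -
  let ?x = "(1 / s) *\<^sub>R e"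
  let ?b = "t / 2 * (s * a)"
  have n: "(norm (?x + (?x + v)))\<^sup>2 = (norm (2 *\<^sub>R e + s *\<^sub>R v))\<^sup>2 / s\<^sup>2"
  proof -
    have "s *\<^sub>R (?x + (?x + v)) = 2 *\<^sub>R e + s *\<^sub>R v"
      using s by (simp add: scaleR_add_right scaleR_2)
    then have "\<bar>s\<bar> * norm (?x + (?x + v)) = norm (2 *\<^sub>R e + s *\<^sub>R v)"
      by (metis norm_scaleR)
    then have "s\<^sup>2 * (norm (?x + (?x + v)))\<^sup>2 = (norm (2 *\<^sub>R e + s *\<^sub>R v))\<^sup>2"
      by (metis power2_abs power_mult_distrib)
    then show ?thesis using s by (simp add: field_simps)
  qed
  \<comment> \<open>Extracting the factor \<open>?b\<close> produces a second power of
    \<open>s\<close>, which cancels the denominator in \<open>n\<close>.\<close>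
  have th: "tanh ?b = ?b * (shc ?b / cosh ?b)"
    by (simp add: shc_def tanh_def)
  have "(mehler_P t (s * a) - mehler_Q t (s * a)) * (norm (?x + (?x + v)))\<^sup>2
     = t / 2 * a\<^sup>2 * (shc ?b / cosh ?b) * (norm (2 *\<^sub>R e + s *\<^sub>R v))\<^sup>2"
    unfolding mehler_PQ_diff[OF t] n th using s by (simp add: power2_eq_square)
  moreover have "(norm (?x - (?x + v)))\<^sup>2 = (norm v)\<^sup>2" by simp
  ultimately show ?thesis
    unfolding mehler_alt mehler_PQ_sum[OF t] rescaled_mehler_def by simp
qed

lemma rescaled_mehler_pos: "t > 0 \<Longrightarrow> 0 < rescaled_mehler t s e v a"
  by (simp add: rescaled_mehler_def mehler_Q_pos)

text \<open>Independence of \<open>s\<close> and \<open>e\<close> keeps the total mass equal to one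
  in the limit \<open>s = 0\<close>.\<close>

lemma rescaled_mehler_0:
  assumes "t > 0"
  shows "rescaled_mehler t s e (v::'a::euclidean_space) 0 = mehler t 0 v 0"
  using assms by (simp add: rescaled_mehler_def mehler_0 mehler_Q_def mehler_P_def)

lemma rescaled_mehler_le_const:
  assumes t: "t > 0"
  shows "rescaled_mehler t s e (v::'a::euclidean_space) a \<le> sqrt (mehler_Q t (s * a)) ^ DIM('a)"
proof -
  have "0 \<le> t / 2 * a\<^sup>2 * (shc (t / 2 * (s * a)) / cosh (t / 2 * (s * a))) * (norm (2 *\<^sub>R e + s *\<^sub>R v))\<^sup>2"
    using t shc_pos[of "t / 2 * (s * a)", THEN less_imp_le] by simp
  moreover have "0 \<le> mehler_P (t / 2) (s * a) * (norm v)\<^sup>2"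
    using t mehler_P_pos[of "t / 2" "s * a"] by simp
  ultimately show ?thesis
    unfolding rescaled_mehler_def using mehler_Q_pos[OF t, of "s * a"]
    by (intro mult_left_le) auto
qed

text \<open>A lower bound 1 / (1 + b) for \<open>shc b / cosh b\<close>. It follows from cosh b - b
  shc b = exp(-b), which is at most 1 and hence at most \<open>shc b\<close>.\<close>

lemma cosh_le_shc: "b \<ge> 0 \<Longrightarrow> cosh b \<le> (1 + b) * shc b"
proof -
  assume b: "b \<ge> 0"
  have "cosh b - b * shc b = exp (- b)"
    by (simp add: shc_def cosh_minus_sinh[symmetric])
  also have "\<dots> \<le> 1" using b by simp
  also have "1 \<le> shc b" by (rule shc_ge_1)
  finally show ?thesis by (simp add: algebra_simps)
qed

text \<open>A dominating function that is uniform in \<open>s\<close>. When \<open>s (2 + |v|) \<ge> 1\<close> the prefactor decays;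
  otherwise \<open>|2 e + s v| \<ge> 1\<close> and the exponent does, since
  \<open>a\<^sup>2 / (1 + \<beta> a) \<ge> a / \<beta> - 1 / \<beta>\<^sup>2\<close>.\<close>

lemma rescaled_mehler_le:
  fixes v e :: "'a::euclidean_space"
  assumes c: "0 < c" "c \<le> t" and s: "0 \<le> s" "s \<le> 1" and e: "norm e = 1 - s" and a: "a \<ge> 0"
  shows "rescaled_mehler t s e v a
    \<le> sqrt (2 / c) ^ DIM('a) * exp (1 / (2 * c)) * (exp (- (c / (4 * (2 + norm v)) * a)) + exp (- (1 / 4 * a)))"
    (is "_ \<le> ?K * (?A + ?B)")
proof -
  have t: "t > 0" using c by simp
  have K: "sqrt (2 / c) ^ DIM('a) \<le> ?K" using c by (simp add: mult_le_cancel_left1)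
  have K0: "0 \<le> sqrt (2 / c) ^ DIM('a)" using c by simp
  show ?thesis
  \<comment> \<open>The threshold is where 2 (1 - s) - s |v|, the lower bound for |2 e + s v|,
    equals 1.\<close>
  proof (cases "s * (2 + norm v) \<ge> 1")
    case True
    have "rescaled_mehler t s e v a \<le> sqrt (mehler_Q t (s * a)) ^ DIM('a)"
      by (rule rescaled_mehler_le_const[OF t])
    also have "\<dots> \<le> sqrt (2 / t) ^ DIM('a) * exp (- (t / 4 * (s * a)))"
      using s a by (intro sqrt_mehler_Q_power_le t mult_nonneg_nonneg)
    also have "\<dots> \<le> sqrt (2 / c) ^ DIM('a) * ?A"
    proof (intro mult_mono power_mono real_sqrt_le_mono)
      show "2 / t \<le> 2 / c" using c by (intro divide_left_mono) auto
      have "c / (4 * (2 + norm v)) = c / 4 * (1 / (2 + norm v))" by simp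
      also have "\<dots> \<le> t / 4 * s"
        using True c s by (intro mult_mono) (auto simp: divide_le_eq add_pos_nonneg)
      finally have "c / (4 * (2 + norm v)) * a \<le> t / 4 * s * a" using a by (rule mult_right_mono)
      then show "exp (- (t / 4 * (s * a))) \<le> ?A" by (simp add: mult.assoc)
    qed (use t K0 in auto)
    also have "\<dots> \<le> ?K * ?A" using K by (intro mult_right_mono) auto
    also have "\<dots> \<le> ?K * (?A + ?B)" using c by (intro mult_left_mono) auto
    finally show ?thesis .
  next
    case False
    define b where "b = t / 2 * (s * a)"
    have b: "b \<ge> 0" using t s a by (simp add: b_def)
    have "norm (2 *\<^sub>R e) - norm (s *\<^sub>R v) \<le> norm (2 *\<^sub>R e + s *\<^sub>R v)"
      by (rule norm_diff_ineq)
    moreover have "norm (2 *\<^sub>R e) - norm (s *\<^sub>R v) = 2 - s * (2 + norm v)"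
      using s e by (simp add: algebra_simps)
    ultimately have n1: "1 \<le> norm (2 *\<^sub>R e + s *\<^sub>R v)" using False by linarith
    then have n: "1 \<le> (norm (2 *\<^sub>R e + s *\<^sub>R v))\<^sup>2" by (rule one_le_power)
    have r: "1 / (1 + t / 2 * a) \<le> shc b / cosh b"
    proof -
      have "1 / (1 + t / 2 * a) \<le> 1 / (1 + b)"
              proof (rule frac_le)
        show "1 + b \<le> 1 + t / 2 * a"
          using t a s mult_left_le[of s "t / 2 * a"] by (simp add: b_def mult_ac)
      qed (use b in auto)
      also have "\<dots> \<le> shc b / cosh b"
      proof -
        have "cosh b / (1 + b) \<le> shc b"
          using cosh_le_shc[OF b] b by (simp add: pos_divide_le_eq mult.commute)
        then show ?thesis using cosh_real_pos[of b] by (simp add: pos_le_divide_eq)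
      qed
      finally show ?thesis .
    qed
    \<comment> \<open>Division with remainder: t a^2 / 8 = (a/4 - 1/(2t)) (1 + t a / 2) + 1/(2t).
      The factor \<open>t / 8\<close> collects \<open>t / 2\<close> and the outer 1/4 of the
      exponent.\<close>
    have "a / 4 - 1 / (2 * t) \<le> t / 8 * a\<^sup>2 * (1 / (1 + t / 2 * a))"
    proof -
      have p: "1 + t / 2 * a > 0" using t a by (simp add: add_pos_nonneg)
      have "(a / 4 - 1 / (2 * t)) * (1 + t / 2 * a) = t / 8 * a\<^sup>2 - 1 / (2 * t)"
        using t by (simp add: field_simps power2_eq_square)
      also have "\<dots> \<le> t / 8 * a\<^sup>2" using t by simp
      finally have "a / 4 - 1 / (2 * t) \<le> t / 8 * a\<^sup>2 / (1 + t / 2 * a)"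
        by (simp only: pos_le_divide_eq[OF p])
      then show ?thesis by simp
    qed
    also have "\<dots> \<le> t / 8 * a\<^sup>2 * ((shc b / cosh b) * (norm (2 *\<^sub>R e + s *\<^sub>R v))\<^sup>2)"
      using r n t a order_trans[OF r mult_left_mono[OF n, of "shc b / cosh b", simplified]] cosh_real_pos[of b]
      by (intro mult_left_mono) (auto simp: less_imp_le divide_nonneg_pos)
    also have "\<dots> \<le> (t / 2 * a\<^sup>2 * (shc b / cosh b) * (norm (2 *\<^sub>R e + s *\<^sub>R v))\<^sup>2 + mehler_P (t / 2) (s * a) * (norm v)\<^sup>2) / 4"
      using mehler_P_pos[of "t / 2" "s * a"] t by (simp add: field_simps)
    finally have ex: "a / 4 - 1 / (2 * t) \<le> (t / 2 * a\<^sup>2 * (shc b / cosh b) * (norm (2 *\<^sub>R e + s *\<^sub>R v))\<^sup>2 + mehler_P (t / 2) (s * a) * (norm v)\<^sup>2) / 4" .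
    have "1 / (2 * t) \<le> 1 / (2 * c)" using c by (intro divide_left_mono) auto
    with ex have ex': "- ((t / 2 * a\<^sup>2 * (shc b / cosh b) * (norm (2 *\<^sub>R e + s *\<^sub>R v))\<^sup>2 + mehler_P (t / 2) (s * a) * (norm v)\<^sup>2) / 4)
        \<le> 1 / (2 * c) + - (1 / 4 * a)" by linarith
    have "rescaled_mehler t s e v a \<le> sqrt (2 / c) ^ DIM('a) * exp (1 / (2 * c) + - (1 / 4 * a))"
      unfolding rescaled_mehler_def b_def[symmetric]
    proof (intro mult_mono power_mono real_sqrt_le_mono)
      have "mehler_Q t (s * a) \<le> 1 / t" by (rule mehler_Q_le[OF t])
      also have "\<dots> \<le> 2 / c" using c by (simp add: frac_le)
      finally show "mehler_Q t (s * a) \<le> 2 / c" .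
      show "exp (- ((t / 2 * a\<^sup>2 * (shc b / cosh b) * (norm (2 *\<^sub>R e + s *\<^sub>R v))\<^sup>2 + mehler_P (t / 2) (s * a) * (norm v)\<^sup>2) / 4))
        \<le> exp (1 / (2 * c) + - (1 / 4 * a))" using ex' by simp
    qed (use mehler_Q_pos[OF t, of "s * a"] K0 in auto)
    also have "\<dots> = ?K * ?B" by (simp only: exp_add mult.assoc)
    also have "\<dots> \<le> ?K * (?A + ?B)" using c by (intro mult_left_mono) auto
    finally show ?thesis .
  qed
qed

lemma continuous_on_rescaled_mehler:
  assumes t: "t > 0"
  shows "continuous_on UNIV (\<lambda>z::'b::euclidean_space. rescaled_mehler t s e v (norm z))"
proof -
  have "mehler_H t a \<noteq> 0" "mehler_H (t / 2) a \<noteq> 0" for a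
    using mehler_H_nonzero[of t a] mehler_H_nonzero[of "t / 2" a] t by auto
  moreover have "continuous_on UNIV (\<lambda>z::'b. mehler_H t (s * norm z))" for t
    unfolding mehler_H_def by (intro continuous_intros)
  moreover have "cosh x \<noteq> 0" for x :: real using cosh_real_pos[of x] by linarith
  ultimately show ?thesis
    unfolding rescaled_mehler_def mehler_P_def mehler_Q_def by (intro continuous_intros) auto
qed

lemma rescaled_bound_integrable:
  assumes "c > 0"
  shows "integrable lborel (\<lambda>z::'b::euclidean_space. K * (exp (- (c / (4 * (2 + norm v)) * norm z)) + exp (- (1 / 4 * norm z))))"
  using assms
  by (intro integrable_mult_right Bochner_Integration.integrable_add exp_neg_norm_integrable) (auto simp: add_pos_nonneg)

lemma rescaled_mehler_integrable:
  fixes e v :: "'a::euclidean_space"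
  assumes t: "t > 0" and s: "0 \<le> s" "s \<le> 1" and e: "norm e = 1 - s"
  shows "integrable lborel (\<lambda>z::'b::euclidean_space. rescaled_mehler t s e v (norm z))"
proof (rule Bochner_Integration.integrable_bound[OF rescaled_bound_integrable[OF t]])
  show "(\<lambda>z::'b. rescaled_mehler t s e v (norm z)) \<in> borel_measurable lborel"
    by (simp add: borel_measurable_continuous_onI[OF continuous_on_rescaled_mehler[OF t]])
  show "AE z in lborel. norm (rescaled_mehler t s e v (norm (z::'b)))
    \<le> norm (sqrt (2 / t) ^ DIM('a) * exp (1 / (2 * t)) * (exp (- (t / (4 * (2 + norm v)) * norm z)) + exp (- (1 / 4 * norm z))))"
  proof (rule AE_I2)
    fix z :: 'b
    have "norm (rescaled_mehler t s e v (norm z)) = rescaled_mehler t s e v (norm z)"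
      using rescaled_mehler_pos[OF t, of s e v "norm z"] by simp
    also note rescaled_mehler_le[OF t order_refl s e norm_ge_zero]
    also note abs_ge_self
    finally show "norm (rescaled_mehler t s e v (norm z))
      \<le> norm (sqrt (2 / t) ^ DIM('a) * exp (1 / (2 * t)) * (exp (- (t / (4 * (2 + norm v)) * norm z)) + exp (- (1 / 4 * norm z))))"
      by simp
  qed
qed

lemma rescaled_mehler_tendsto:
  assumes T: "T \<longlonglongrightarrow> t" and S: "S \<longlonglongrightarrow> s" and E: "E \<longlonglongrightarrow> e" and t: "t > 0"
  shows "(\<lambda>n. rescaled_mehler (T n) (S n) (E n) v a) \<longlonglongrightarrow> rescaled_mehler t s e v a"
proof -
  have nz: "t * shc (t * (s * a)) \<noteq> 0" "t / 2 * shc (t / 2 * (s * a)) \<noteq> 0" "cosh x \<noteq> 0" for x :: real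
    using t by auto
  show ?thesis
    unfolding rescaled_mehler_def mehler_P_def mehler_Q_def mehler_H_def
    by (intro tendsto_intros T S E nz) auto
qed

lemma rescaled_density_tendsto:
  fixes e v :: "'a::euclidean_space" and z :: "'b::euclidean_space"
  assumes T: "T \<longlonglongrightarrow> t" and S: "S \<longlonglongrightarrow> s" and E: "E \<longlonglongrightarrow> e" and t: "t > 0"
    and s: "\<And>n. 0 \<le> S n" "\<And>n. S n \<le> 1" and e: "\<And>n. norm (E n) = 1 - S n" and c: "0 < c" "\<And>n. c \<le> T n"
  shows "(\<lambda>n. rescaled_density (T n) (S n) (E n) v z) \<longlonglongrightarrow> rescaled_density t s e v z"
proof -
  have Tpos: "T n > 0" for n using c(1) c(2)[of n] by simp
  have m: "(\<lambda>y::'b. rescaled_mehler t s e v (norm y)) \<in> borel_measurable borel" if "t > 0" for t s e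
    using continuous_on_rescaled_mehler[OF that] by (rule borel_measurable_continuous_onI)
  note [measurable] = m[OF t] m[OF Tpos]
  have "(\<lambda>n. \<integral>y. rescaled_mehler (T n) (S n) (E n) v (norm y) * cos (y \<bullet> z) \<partial>lborel)
    \<longlonglongrightarrow> (\<integral>y. rescaled_mehler t s e v (norm y) * cos (y \<bullet> z) \<partial>lborel)"
  proof (rule integral_dominated_convergence[OF _ _ rescaled_bound_integrable[OF c(1)]])
    show "AE y in lborel. norm (rescaled_mehler (T n) (S n) (E n) v (norm y) * cos (y \<bullet> z))
      \<le> sqrt (2 / c) ^ DIM('a) * exp (1 / (2 * c)) * (exp (- (c / (4 * (2 + norm v)) * norm y)) + exp (- (1 / 4 * norm y)))" for n
    proof (rule AE_I2)
      fix y :: 'b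
      have "norm (rescaled_mehler (T n) (S n) (E n) v (norm y) * cos (y \<bullet> z)) \<le> rescaled_mehler (T n) (S n) (E n) v (norm y)"
        using rescaled_mehler_pos[OF Tpos, of n "S n" "E n" v "norm y"] by (simp add: abs_mult mult_left_le)
      also note rescaled_mehler_le[OF c s e norm_ge_zero]
      finally show "norm (rescaled_mehler (T n) (S n) (E n) v (norm y) * cos (y \<bullet> z))
        \<le> sqrt (2 / c) ^ DIM('a) * exp (1 / (2 * c)) * (exp (- (c / (4 * (2 + norm v)) * norm y)) + exp (- (1 / 4 * norm y)))" .
    qed
  qed (auto intro!: tendsto_mult tendsto_const rescaled_mehler_tendsto T S E t)
  then show ?thesis
    unfolding rescaled_density_def by (intro tendsto_divide tendsto_const) auto
qed

text \<open>The power of \<open>s\<close> is the Jacobian of scaling the frequency by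
  \<open>s\<close>.\<close>

lemma grushin_density_rescaled:
  fixes e v :: "'a::euclidean_space" and z :: "'b::euclidean_space"
  assumes t: "t > 0" and s: "s > 0"
  shows "grushin_density t ((1 / s) *\<^sub>R e) ((1 / s) *\<^sub>R e + v) ((1 / s) *\<^sub>R z) = s ^ DIM('b) * rescaled_density t s e v z"
proof -
  let ?x = "(1 / s) *\<^sub>R e"
  have "(\<integral>y. mehler t ?x (?x + v) (norm y) * cos (y \<bullet> ((1 / s) *\<^sub>R z)) \<partial>lborel)
    = \<bar>s\<bar> ^ DIM('b) *\<^sub>R (\<integral>y. mehler t ?x (?x + v) (norm (0 + s *\<^sub>R y)) * cos ((0 + s *\<^sub>R y) \<bullet> ((1 / s) *\<^sub>R z)) \<partial>lborel)"
    using s by (intro lborel_affine_integral) auto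
  also have "\<dots> = s ^ DIM('b) * (\<integral>y. rescaled_mehler t s e v (norm y) * cos (y \<bullet> z) \<partial>lborel)"
    using s by (simp add: rescaled_mehler_eq[OF t s])
  finally show ?thesis
    by (simp add: grushin_density_def rescaled_density_def)
qed

lemma rescaled_density_nonneg:
  fixes e v :: "'a::euclidean_space" and z :: "'b::euclidean_space"
  assumes "t > 0" "s > 0"
  shows "0 \<le> rescaled_density t s e v z"
  using grushin_density_nonneg[OF assms(1), of "(1 / s) *\<^sub>R e" "(1 / s) *\<^sub>R e + v" "(1 / s) *\<^sub>R z"]
    zero_less_power[OF assms(2), of "DIM('b)"]
  unfolding grushin_density_rescaled[OF assms] by (simp add: zero_le_mult_iff)

lemma rescaled_density_measurable:
  assumes t: "t > 0"
  shows "(\<lambda>p. rescaled_density t s (e::'a::euclidean_space) (fst p) (snd p :: 'b::euclidean_space)) \<in> borel_measurable (lborel \<Otimes>\<^sub>M lborel)"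
  unfolding rescaled_density_def rescaled_mehler_def mehler_P_def mehler_Q_def mehler_H_def
  by measurable

text \<open>Nonnegativity is a hypothesis because it is obtained from the kernel if
  \<open>s > 0\<close>, but only as a limit if \<open>s = 0\<close>. The mass is again read off at
  frequency 0.\<close>

lemma nn_integral_rescaled_density:
  fixes e :: "'a::euclidean_space"
  assumes t: "t > 0" and s: "0 \<le> s" "s \<le> 1" and e: "norm e = 1 - s"
    and nonneg: "\<And>v (z::'b::euclidean_space). 0 \<le> rescaled_density t s e v z"
  shows "(\<integral>\<^sup>+p. ennreal (rescaled_density t s e (fst p) (snd p :: 'b)) \<partial>(lborel \<Otimes>\<^sub>M lborel)) = 1"
proof -
  let ?C = "sqrt (2 * pi) ^ DIM('a) * (2 * pi) ^ DIM('b)"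
  have C: "?C > 0" by simp
  have inner: "(\<integral>\<^sup>+z. ennreal (rescaled_density t s e v (z::'b)) \<partial>lborel) = ennreal (mehler t 0 v 0 / sqrt (2 * pi) ^ DIM('a))" for v
  proof -
    have i: "integrable lborel (\<lambda>z::'b. rescaled_mehler t s e v (norm z) / ?C)"
      by (intro integrable_divide rescaled_mehler_integrable t s e)
    have cont: "continuous_on UNIV (\<lambda>z::'b. rescaled_mehler t s e v (norm z) / ?C)"
      using C by (intro continuous_intros continuous_on_rescaled_mehler t) auto
    have b: "\<bar>rescaled_mehler t s e v (norm z) / ?C\<bar> \<le> sqrt (1 / t) ^ DIM('a) / ?C" for z :: 'b
      using order_trans[OF rescaled_mehler_le_const[OF t] sqrt_mehler_Q_power_le_const[OF t], of s e v "norm z"]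
        rescaled_mehler_pos[OF t, of s e v "norm z"] C
      by (simp add: abs_of_pos divide_right_mono del: mult_pos_pos)
    have f: "(\<integral>z. of_real (rescaled_mehler t s e v (norm z) / ?C) * cis (z \<bullet> y) \<partial>lborel) = complex_of_real (rescaled_density t s e v y)" for y :: 'b
      by (subst fourier_even_eq_cos[OF i]) (simp_all add: rescaled_density_def)
    note inv = fourier_inversion_nonneg[OF i cont b nonneg f]
    have "complex_of_real (\<integral>y. rescaled_density t s e v (y::'b) \<partial>lborel) = complex_of_real (mehler t 0 v 0 / sqrt (2 * pi) ^ DIM('a))"
      using inv(2)[of 0] by (simp add: integral_complex_of_real rescaled_mehler_0[OF t])
    then show ?thesis
      using inv(1) nonneg by (simp only: of_real_eq_iff) (simp add: nn_integral_eq_integral)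
  qed
  have "(\<integral>\<^sup>+p. ennreal (rescaled_density t s e (fst p) (snd p :: 'b)) \<partial>(lborel \<Otimes>\<^sub>M lborel))
     = (\<integral>\<^sup>+v. \<integral>\<^sup>+z. ennreal (rescaled_density t s e v (z::'b)) \<partial>lborel \<partial>lborel)"
    using rescaled_density_measurable[OF t, of s e, where 'b='b]
    by (subst lborel.nn_integral_fst[symmetric]) auto
  also have "\<dots> = (\<integral>\<^sup>+v. ennreal (mehler t 0 v 0 / sqrt (2 * pi) ^ DIM('a)) \<partial>(lborel :: 'a measure))"
    by (simp only: inner)
  also have "\<dots> = 1"
    using mehler_0_total[OF t, of "0::'a"]
    by (subst nn_integral_eq_integral) (auto simp: has_bochner_integral_iff mehler_pos[OF t, THEN less_imp_le])
  finally show ?thesis .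
qed

text \<open>Pointwise convergence and equal total masses give convergence in L^1. The limit
  \<open>s = 0\<close> is included, which is the purpose of the rescaling.\<close>

lemma rescaled_density_scheffe:
  fixes e :: "'a::euclidean_space"
  assumes T: "T \<longlonglongrightarrow> t" and S: "S \<longlonglongrightarrow> s" and E: "E \<longlonglongrightarrow> e"
    and s: "\<And>n. 0 < S n" "\<And>n. S n \<le> 1" and e: "\<And>n. norm (E n) = 1 - S n" and c: "0 < c" "\<And>n. c \<le> T n"
  shows "(\<lambda>n. \<integral>\<^sup>+p. ennreal (norm (rescaled_density (T n) (S n) (E n) (fst p) (snd p :: 'b::euclidean_space)
            - rescaled_density t s e (fst p) (snd p))) \<partial>(lborel \<Otimes>\<^sub>M lborel)) \<longlonglongrightarrow> 0"
proof -
  have Tpos: "T n > 0" for n using c(1) c(2)[of n] by simp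
  have "c \<le> t" by (rule LIMSEQ_le_const[OF T]) (use c in auto)
  with c have t: "t > 0" by simp
  have s0: "0 \<le> s" by (rule LIMSEQ_le_const[OF S]) (use s in \<open>auto intro: less_imp_le\<close>)
  have s1: "s \<le> 1" by (rule LIMSEQ_le_const2[OF S]) (use s in auto)
  have "(\<lambda>n. 1 - S n) \<longlonglongrightarrow> norm e" using tendsto_norm[OF E] by (simp add: e)
  moreover have "(\<lambda>n. 1 - S n) \<longlonglongrightarrow> 1 - s" by (intro tendsto_intros S)
  ultimately have e': "norm e = 1 - s" by (rule LIMSEQ_unique)
  have lim: "(\<lambda>n. rescaled_density (T n) (S n) (E n) v z) \<longlonglongrightarrow> rescaled_density t s e v z" for v and z :: 'b
    by (rule rescaled_density_tendsto[OF T S E t less_imp_le[OF s(1)] s(2) e c])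
  \<comment> \<open>The limit \<open>s\<close> may be 0, where no heat kernel corresponds to the
    density, so nonnegativity is inherited from the sequence.\<close>
  have nonneg: "0 \<le> rescaled_density t s e v z" for v and z :: 'b
    by (rule LIMSEQ_le_const[OF lim]) (auto intro: rescaled_density_nonneg Tpos s)
  note total = nn_integral_rescaled_density[OF t s0 s1 e' nonneg]
  have total_n: "(\<integral>\<^sup>+p. ennreal (rescaled_density (T n) (S n) (E n) (fst p) (snd p :: 'b)) \<partial>(lborel \<Otimes>\<^sub>M lborel)) = 1" for n
    by (rule nn_integral_rescaled_density[OF Tpos less_imp_le[OF s(1)] s(2) e rescaled_density_nonneg[OF Tpos s(1)]])
  show ?thesis
  proof (rule Scheffe_lemma2)
    show "(\<lambda>p. rescaled_density (T n) (S n) (E n) (fst p) (snd p :: 'b)) \<in> borel_measurable (lborel \<Otimes>\<^sub>M lborel)" for n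
      by (rule rescaled_density_measurable[OF Tpos])
    show "integrable (lborel \<Otimes>\<^sub>M lborel) (\<lambda>p. rescaled_density t s e (fst p) (snd p :: 'b))"
      by (rule integrableI_nonneg) (auto simp: nonneg total intro: rescaled_density_measurable[OF t])
    show "(\<integral>\<^sup>+p. ennreal (norm (rescaled_density (T n) (S n) (E n) (fst p) (snd p :: 'b))) \<partial>(lborel \<Otimes>\<^sub>M lborel))
      \<le> (\<integral>\<^sup>+p. ennreal (norm (rescaled_density t s e (fst p) (snd p :: 'b))) \<partial>(lborel \<Otimes>\<^sub>M lborel))" for n
      using total total_n[of n] by (simp add: nonneg rescaled_density_nonneg Tpos s)
  qed (simp add: lim)
qed

text \<open>Shifting by x and scaling by \<open>1 / s\<close> preserve the L^1 distance: the
  Jacobian cancels the power of \<open>s\<close> in \<open>grushin_density_rescaled\<close>.\<close>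

lemma nn_integral_transition_diff_rescaled:
  fixes u :: "'a::euclidean_space \<times> 'b::euclidean_space"
  assumes t: "t > 0" "t' > 0" and s: "s > 0"
  shows "(\<integral>\<^sup>+v. ennreal \<bar>grushin_transition t u v - grushin_transition t' u v\<bar> \<partial>lborel)
     = (\<integral>\<^sup>+p. ennreal (norm (rescaled_density t s (s *\<^sub>R fst u) (fst p) (snd p :: 'b) - rescaled_density t' s (s *\<^sub>R fst u) (fst p) (snd p)))
          \<partial>(lborel \<Otimes>\<^sub>M lborel))"
proof -
  let ?x = "fst u" and ?e = "s *\<^sub>R fst u"
  let ?g = "\<lambda>w y. ennreal \<bar>grushin_density t ?x w y - grushin_density t' ?x w (y::'b)\<bar>"
  have "(\<integral>\<^sup>+v. ennreal \<bar>grushin_transition t u v - grushin_transition t' u v\<bar> \<partial>lborel) = (\<integral>\<^sup>+w. \<integral>\<^sup>+y. ?g w y \<partial>lborel \<partial>lborel)"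
    by (subst nn_integral_lborel_prod_shift[where y="snd u"], measurable) (simp add: grushin_transition_def)
  also have "\<dots> = (\<integral>\<^sup>+v. \<integral>\<^sup>+y. ?g (?x + 1 *\<^sub>R v) y \<partial>lborel \<partial>lborel)"
    by (subst lborel_affine_nn_integral[where c=1 and t="?x"]) simp_all
  also have "\<dots> = (\<integral>\<^sup>+v. \<integral>\<^sup>+z. ennreal (norm (rescaled_density t s ?e v (z::'b) - rescaled_density t' s ?e v z)) \<partial>lborel \<partial>lborel)"
  proof (rule nn_integral_cong)
    fix v :: 'a
    have sc: "grushin_density r ?x (?x + v) ((1 / s) *\<^sub>R z) = s ^ DIM('b) * rescaled_density r s ?e v z" if "r > 0" for r and z :: 'b
      using grushin_density_rescaled[OF that s, of ?e v z] s by simp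
    have "(\<integral>\<^sup>+y. ?g (?x + v) y \<partial>lborel) = ennreal (\<bar>1 / s\<bar> ^ DIM('b)) * (\<integral>\<^sup>+z. ?g (?x + v) (0 + (1 / s) *\<^sub>R z) \<partial>lborel)"
      using s by (intro lborel_affine_nn_integral) auto
    also have "\<dots> = (\<integral>\<^sup>+z. ennreal (\<bar>1 / s\<bar> ^ DIM('b)) * ?g (?x + v) (0 + (1 / s) *\<^sub>R z) \<partial>lborel)"
      by (rule nn_integral_cmult[symmetric]) measurable
    also have "\<dots> = (\<integral>\<^sup>+z. ennreal (norm (rescaled_density t s ?e v (z::'b) - rescaled_density t' s ?e v z)) \<partial>lborel)"
    proof (rule nn_integral_cong)
      fix z :: 'b
      have "\<bar>1 / s\<bar> ^ DIM('b) * \<bar>s ^ DIM('b) * rescaled_density t s ?e v z - s ^ DIM('b) * rescaled_density t' s ?e v z\<bar>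
         = \<bar>rescaled_density t s ?e v z - rescaled_density t' s ?e v z\<bar>"
        using s by (simp add: abs_mult power_abs power_divide flip: right_diff_distrib)
      then show "ennreal (\<bar>1 / s\<bar> ^ DIM('b)) * ?g (?x + v) (0 + (1 / s) *\<^sub>R z) = ennreal (norm (rescaled_density t s ?e v z - rescaled_density t' s ?e v z))"
        by (simp only: add_0 sc[OF t(1)] sc[OF t(2)] real_norm_def ennreal_mult[symmetric] abs_ge_zero zero_le_power)
    qed
    finally show "(\<integral>\<^sup>+y. ?g (?x + 1 *\<^sub>R v) y \<partial>lborel) = (\<integral>\<^sup>+z. ennreal (norm (rescaled_density t s ?e v (z::'b) - rescaled_density t' s ?e v z)) \<partial>lborel)"
      by simp
  qed
  also have "\<dots> = (\<integral>\<^sup>+p. ennreal (norm (rescaled_density t s ?e (fst p) (snd p :: 'b) - rescaled_density t' s ?e (fst p) (snd p))) \<partial>(lborel \<Otimes>\<^sub>M lborel))"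
    using rescaled_density_measurable[OF t(1), of s ?e, where 'b='b] rescaled_density_measurable[OF t(2), of s ?e, where 'b='b]
    by (subst lborel.nn_integral_fst[symmetric]) auto
  finally show ?thesis .
qed

text \<open>Otherwise offending points \<open>u n\<close> exist along a subsequence. Their
  parameters lie in a compact set, and along a convergent subsequence
  \<open>rescaled_density_scheffe\<close> contradicts their choice.\<close>

lemma grushin_transition_uniformly_continuous:
  assumes T: "T \<longlonglongrightarrow> t" and Tpos: "\<And>n. T n > 0" and t: "t > 0" and eps: "\<epsilon> > 0"
  shows "\<forall>\<^sub>F n in sequentially. \<forall>u::'a::euclidean_space \<times> 'b::euclidean_space.
     (\<integral>\<^sup>+v. ennreal \<bar>grushin_transition (T n) u v - grushin_transition t u v\<bar> \<partial>lborel) \<le> ennreal \<epsilon>"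
proof (rule ccontr)
  let ?d = "\<lambda>n (u::'a \<times> 'b). \<integral>\<^sup>+v. ennreal \<bar>grushin_transition (T n) u v - grushin_transition t u v\<bar> \<partial>lborel"
  assume "\<not> (\<forall>\<^sub>F n in sequentially. \<forall>u. ?d n u \<le> ennreal \<epsilon>)"
  then have inf: "infinite {n. \<exists>u. \<not> ?d n u \<le> ennreal \<epsilon>}"
    by (simp only: not_eventually not_all cofinite_eq_sequentially[symmetric] frequently_cofinite not_False_eq_True)
  define r where "r = enumerate {n. \<exists>u. \<not> ?d n u \<le> ennreal \<epsilon>}"
  have r: "strict_mono r" unfolding r_def by (rule strict_mono_enumerate[OF inf])
  have "\<exists>u. \<not> ?d (r n) u \<le> ennreal \<epsilon>" for n
    using enumerate_in_set[OF inf, of n] by (simp add: r_def)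
  then obtain u where u: "\<And>n. \<not> ?d (r n) (u n) \<le> ennreal \<epsilon>" by metis
  define S where "S n = 1 / (1 + norm (fst (u n)))" for n
  define E where "E n = S n *\<^sub>R fst (u n)" for n
  have p: "1 + norm (fst (u n)) > 0" for n by (simp add: add_pos_nonneg)
  have S: "0 < S n" "S n \<le> 1" for n using p[of n] by (auto simp: S_def)
  have En: "norm (E n) = 1 - S n" for n using p[of n] S(1)[of n] by (simp add: E_def S_def field_simps)
  have mem: "\<forall>n. (S n, E n) \<in> {0..1} \<times> cball 0 1"
    using S En by (auto simp: less_imp_le)
  have "compact ({0..1::real} \<times> cball (0::'a) 1)" by (intro compact_Times compact_cball) simp
  then have sc: "seq_compact ({0..1::real} \<times> cball (0::'a) 1)" by (rule compact_imp_seq_compact)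
  obtain l q where q: "l \<in> {0..1::real} \<times> cball (0::'a) 1" "strict_mono q" "((\<lambda>n. (S n, E n)) \<circ> q) \<longlonglongrightarrow> l"
    by (rule seq_compactE[OF sc mem])
  have Sq: "(\<lambda>n. S (q n)) \<longlonglongrightarrow> fst l" and Eq: "(\<lambda>n. E (q n)) \<longlonglongrightarrow> snd l"
    using tendsto_fst[OF q(3)] tendsto_snd[OF q(3)] by (simp_all add: o_def)
  have Tq: "(\<lambda>n. T (r (q n))) \<longlonglongrightarrow> t"
    using LIMSEQ_subseq_LIMSEQ[OF T strict_mono_o[OF r q(2)]] by (simp add: o_def)
  \<comment> \<open>Eventually \<open>t / 2\<close> is a lower bound, and only finitely many
    positive values remain.\<close>
  obtain c where c: "c > 0" "\<And>n. c \<le> T n"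
  proof -
    have "\<forall>\<^sub>F n in sequentially. t / 2 < T n" using T t by (intro order_tendstoD(1)) auto
    then obtain N where N: "\<And>n. n \<ge> N \<Longrightarrow> t / 2 < T n" by (auto simp: eventually_sequentially)
    let ?c = "Min (insert (t / 2) (T ` {..N}))"
    have "?c > 0" using t Tpos by simp
    moreover have "?c \<le> T n" for n
    proof (cases "n \<le> N")
      case True
      then show ?thesis by (intro Min_le) auto
    next
      case False
      have "?c \<le> t / 2" by (intro Min_le) auto
      with N[of n] False show ?thesis by simp
    qed
    ultimately show ?thesis using that by blast
  qed
  let ?D = "\<lambda>t s e (p :: 'a \<times> 'b). rescaled_density t s e (fst p) (snd p)"
  have A: "(\<lambda>n. \<integral>\<^sup>+p. ennreal (norm (?D (T (r (q n))) (S (q n)) (E (q n)) p - ?D t (fst l) (snd l) p)) \<partial>(lborel \<Otimes>\<^sub>M lborel)) \<longlonglongrightarrow> 0"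
    by (rule rescaled_density_scheffe[OF Tq Sq Eq S En c])
  \<comment> \<open>The kernel at time \<open>t\<close> also moves with the points, so it is
    compared with the same limit through the constant sequence of times.\<close>
  have B: "(\<lambda>n. \<integral>\<^sup>+p. ennreal (norm (?D t (S (q n)) (E (q n)) p - ?D t (fst l) (snd l) p)) \<partial>(lborel \<Otimes>\<^sub>M lborel)) \<longlonglongrightarrow> 0"
    by (rule rescaled_density_scheffe[OF tendsto_const Sq Eq S En t order_refl])
  have le: "?d (r (q n)) (u (q n)) \<le> (\<integral>\<^sup>+p. ennreal (norm (?D (T (r (q n))) (S (q n)) (E (q n)) p - ?D t (fst l) (snd l) p)) \<partial>(lborel \<Otimes>\<^sub>M lborel))
       + (\<integral>\<^sup>+p. ennreal (norm (?D t (S (q n)) (E (q n)) p - ?D t (fst l) (snd l) p)) \<partial>(lborel \<Otimes>\<^sub>M lborel))" for n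
  proof -
    note [measurable] = rescaled_density_measurable[OF Tpos, where 'b='b and 'a='a] rescaled_density_measurable[OF t, where 'b='b and 'a='a]
    have "?d (r (q n)) (u (q n)) = (\<integral>\<^sup>+p. ennreal (norm (?D (T (r (q n))) (S (q n)) (E (q n)) p - ?D t (S (q n)) (E (q n)) p)) \<partial>(lborel \<Otimes>\<^sub>M lborel))"
      unfolding E_def by (rule nn_integral_transition_diff_rescaled[OF Tpos t S(1)])
    also have "\<dots> \<le> (\<integral>\<^sup>+p. ennreal (norm (?D (T (r (q n))) (S (q n)) (E (q n)) p - ?D t (fst l) (snd l) p))
         + ennreal (norm (?D t (S (q n)) (E (q n)) p - ?D t (fst l) (snd l) p)) \<partial>(lborel \<Otimes>\<^sub>M lborel))"
      by (intro nn_integral_mono) (simp flip: ennreal_plus)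
    also have "\<dots> = (\<integral>\<^sup>+p. ennreal (norm (?D (T (r (q n))) (S (q n)) (E (q n)) p - ?D t (fst l) (snd l) p)) \<partial>(lborel \<Otimes>\<^sub>M lborel))
       + (\<integral>\<^sup>+p. ennreal (norm (?D t (S (q n)) (E (q n)) p - ?D t (fst l) (snd l) p)) \<partial>(lborel \<Otimes>\<^sub>M lborel))"
      by (rule nn_integral_add) measurable
    finally show ?thesis .
  qed
  have "(\<lambda>n. ?d (r (q n)) (u (q n))) \<longlonglongrightarrow> 0"
    by (rule tendsto_sandwich[OF _ _ tendsto_const tendsto_add[OF A B, unfolded add_0_right]]) (use le in auto)
  then have "\<forall>\<^sub>F n in sequentially. ?d (r (q n)) (u (q n)) < ennreal \<epsilon>"
    using eps by (intro order_tendstoD(2)) auto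
  then obtain n where "?d (r (q n)) (u (q n)) < ennreal \<epsilon>" by (auto simp: eventually_sequentially)
  then show False using u[of "q n"] by simp
qed

section \<open>The Grushin semigroup\<close>

lemma sigma_finite_lebesgue: "sigma_finite_measure (lebesgue :: 'a::euclidean_space measure)"
proof
  obtain A :: "'a set set" where A: "countable A" "A \<subseteq> sets lborel" "\<Union>A = space lborel" "\<forall>a\<in>A. emeasure lborel a \<noteq> \<infinity>"
    using lborel.sigma_finite_countable by blast
  show "\<exists>A::'a set set. countable A \<and> A \<subseteq> sets lebesgue \<and> \<Union>A = space lebesgue \<and> (\<forall>a\<in>A. emeasure lebesgue a \<noteq> \<infinity>)"
  proof (intro exI[of _ A] conjI ballI)
    show "A \<subseteq> sets lebesgue" using A(2) by auto
    show "emeasure lebesgue a \<noteq> \<infinity>" if "a \<in> A" for a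
    proof -
      have "a \<in> sets lborel" using A(2) that by blast
      then have "emeasure lebesgue a = emeasure lborel a" by simp
      then show ?thesis using A(4) that by simp
    qed
  qed (use A in auto)
qed

text \<open>The type arguments carry the two dimensions, which \<open>t\<close> does not
  determine.\<close>

definition grushin_density_bound :: "'a::euclidean_space itself \<Rightarrow> 'b::euclidean_space itself \<Rightarrow> real \<Rightarrow> real" where
  "grushin_density_bound _ _ t = sqrt (2 / t) ^ DIM('a) * (8 * real DIM('b) / t) ^ DIM('b)"

lemma grushin_density_bound_pos: "t > 0 \<Longrightarrow> grushin_density_bound TYPE('a::euclidean_space) TYPE('b::euclidean_space) t > 0"
  by (simp add: grushin_density_bound_def)

lemma grushin_density_bound_antimono:
  assumes "0 < s" "s \<le> t"
  shows "grushin_density_bound TYPE('a::euclidean_space) TYPE('b::euclidean_space) t \<le> grushin_density_bound TYPE('a) TYPE('b) s"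
  unfolding grushin_density_bound_def using assms
  by (intro mult_mono power_mono real_sqrt_le_mono divide_left_mono) auto

lemma grushin_density_bound_eq:
  assumes t: "t > 0"
  shows "grushin_density_bound TYPE('a::euclidean_space) TYPE('b::euclidean_space) t
    = grushin_density_bound TYPE('a) TYPE('b) 1 * t powr (- ((real DIM('a) + 2 * real DIM('b)) / 2))"
proof -
  have e: "- ((real DIM('a) + 2 * real DIM('b)) / 2) = - (real DIM('a) / 2) + - real DIM('b)"
    by (simp add: field_simps)
  have "t powr (- ((real DIM('a) + 2 * real DIM('b)) / 2)) = 1 / sqrt t ^ DIM('a) * (1 / t ^ DIM('b))"
    unfolding e powr_add powr_minus_divide using t
    by (simp add: sqrt_power_eq_powr powr_realpow)
  then show ?thesis
    by (simp add: grushin_density_bound_def real_sqrt_divide power_divide)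
qed

lemma bistochastic_grushin_transition:
  assumes t: "t > 0"
  shows "bistochastic_kernel lebesgue (grushin_transition t :: 'a::euclidean_space \<times> 'b::euclidean_space \<Rightarrow> _)
    (grushin_density_bound TYPE('a) TYPE('b) t)"
proof -
  interpret sigma_finite_measure "lebesgue :: ('a \<times> 'b) measure" by (rule sigma_finite_lebesgue)
  let ?k = "grushin_transition t :: 'a \<times> 'b \<Rightarrow> _"
  have [measurable]: "(\<lambda>x::'a \<times> 'b. x) \<in> borel_measurable lebesgue"
    by (rule measurable_completion) simp
  have row: "(\<integral>\<^sup>+v. ennreal (?k u v) \<partial>lebesgue) = 1" for u
    using nn_integral_grushin_transition[OF t] by (simp add: nn_integral_completion)
  show ?thesis
  proof
    show "(\<lambda>(u, v). ?k u v) \<in> borel_measurable (lebesgue \<Otimes>\<^sub>M lebesgue)"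
      unfolding split_beta by (intro borel_measurable_grushin_transition) measurable
    show "(\<integral>\<^sup>+u. ennreal (?k u v) \<partial>lebesgue) = 1" for v
      using row[of v] by (simp add: grushin_transition_commute[of t v])
    show "?k u v \<le> grushin_density_bound TYPE('a) TYPE('b) t" for u v
      unfolding grushin_transition_def grushin_density_bound_def by (rule grushin_density_le[OF t])
  qed (auto simp: row grushin_transition_nonneg t)
qed

abbreviation grushin_op :: "real \<Rightarrow> ('a::euclidean_space \<times> 'b::euclidean_space \<Rightarrow> complex) \<Rightarrow> 'a \<times> 'b \<Rightarrow> complex" where
  "grushin_op t \<equiv> kernel_op lebesgue (grushin_transition t)"

lemma grushin_op_compose:
  fixes f :: "'a::euclidean_space \<times> 'b::euclidean_space \<Rightarrow> complex"
  assumes t: "t > 0" and s: "s > 0" and p: "1 \<le> p" and f: "f \<in> Lp_space lebesgue p"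
  shows "grushin_op t (grushin_op s f) u = grushin_op (t + s) f u"
  by (rule kernel_op_compose[OF bistochastic_grushin_transition[OF t] bistochastic_grushin_transition[OF s]
        bistochastic_grushin_transition[OF add_pos_pos[OF t s]] _ p f])
     (simp add: nn_integral_completion grushin_transition_chapman_kolmogorov[OF t s])

lemma concentrating_grushin_transition:
  assumes h: "\<And>n. h n > 0" and h0: "h \<longlonglongrightarrow> 0"
  shows "concentrating_kernels (\<lambda>n. grushin_transition (h n) :: 'a::euclidean_space \<times> 'b::euclidean_space \<Rightarrow> _)
    (\<lambda>n. grushin_density_bound TYPE('a) TYPE('b) (h n))"
proof (rule concentrating_kernels.intro)
  show "bistochastic_kernel lebesgue (grushin_transition (h n) :: 'a \<times> 'b \<Rightarrow> _) (grushin_density_bound TYPE('a) TYPE('b) (h n))" for n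
    by (rule bistochastic_grushin_transition[OF h])
  show "(\<lambda>n. \<integral>\<^sup>+v. ennreal (grushin_transition (h n) u v) * indicator {v. d \<le> dist u v} v \<partial>lebesgue) \<longlonglongrightarrow> 0"
    if "d > 0" for u :: "'a \<times> 'b" and d
    using grushin_transition_tail[OF h h0 that, of u] by (simp add: nn_integral_completion)
qed (rule grushin_transition_commute)

lemma grushin_op_measurable:
  fixes f :: "'a::euclidean_space \<times> 'b::euclidean_space \<Rightarrow> complex"
  assumes "t > 0" "f \<in> Lp_space lebesgue p"
  shows "grushin_op t f \<in> borel_measurable lebesgue"
proof -
  interpret bistochastic_kernel lebesgue "grushin_transition t :: 'a \<times> 'b \<Rightarrow> _" "grushin_density_bound TYPE('a) TYPE('b) t"
    by (rule bistochastic_grushin_transition[OF assms(1)])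
  show ?thesis by (rule measurable_kernel_op[OF Lp_space_measurable[OF assms(2)]])
qed

section \<open>Continuity in time\<close>

lemma grushin_op_tendsto_0:
  fixes f :: "'a::euclidean_space \<times> 'b::euclidean_space \<Rightarrow> complex"
  assumes h: "\<And>n. h n > 0" and h0: "h \<longlonglongrightarrow> 0" and p: "p \<ge> 1" and f: "f \<in> Lp_space lebesgue (ennreal p)"
  shows "(\<lambda>n. Lp_norm lebesgue (ennreal p) (\<lambda>u. grushin_op (h n) f u - f u)) \<longlonglongrightarrow> 0"
proof -
  interpret concentrating_kernels "\<lambda>n. grushin_transition (h n) :: 'a \<times> 'b \<Rightarrow> _" "\<lambda>n. grushin_density_bound TYPE('a) TYPE('b) (h n)"
    by (rule concentrating_grushin_transition[OF h h0])
  have [measurable]: "f \<in> borel_measurable lebesgue" using f by (rule Lp_space_measurable)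
  note [measurable] = grushin_op_measurable[OF h f]
  have "(\<lambda>n. enn2real (Lp_mass lebesgue p (\<lambda>u. grushin_op (h n) f u - f u)) powr (1 / p)) \<longlonglongrightarrow> 0 powr (1 / p)"
    using kernel_op_Lp_tendsto[OF p f] p
    by (intro tendsto_powr' tendsto_enn2real tendsto_const) auto
  then show ?thesis
    using p by (simp add: Lp_norm_eq_mass)
qed

text \<open>By the semigroup law the difference is, up to sign, the operator at the earlier time
  applied to the increment over the elapsed time.\<close>

lemma grushin_op_difference:
  fixes f :: "'a::euclidean_space \<times> 'b::euclidean_space \<Rightarrow> complex"
  assumes t: "t > 0" and s: "s > 0" and ne: "t \<noteq> s" and p: "1 \<le> p" and f: "f \<in> Lp_space lebesgue p"
  shows "norm (grushin_op t f u - grushin_op s f u)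
    = norm (grushin_op (min t s) (\<lambda>v. grushin_op \<bar>t - s\<bar> f v - f v) u)"
proof -
  define m where "m = min t s"
  define h where "h = \<bar>t - s\<bar>"
  have m: "m > 0" and h: "h > 0" using t s ne by (auto simp: m_def h_def)
  interpret bistochastic_kernel lebesgue "grushin_transition m :: 'a \<times> 'b \<Rightarrow> _" "grushin_density_bound TYPE('a) TYPE('b) m"
    by (rule bistochastic_grushin_transition[OF m])
  interpret H: bistochastic_kernel lebesgue "grushin_transition h :: 'a \<times> 'b \<Rightarrow> _" "grushin_density_bound TYPE('a) TYPE('b) h"
    by (rule bistochastic_grushin_transition[OF h])
  have hf: "grushin_op h f \<in> Lp_space lebesgue p"
    by (rule H.kernel_op_smoothing(1)[OF p order_refl f grushin_density_bound_pos[OF h]])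
  have "grushin_op m (\<lambda>v. grushin_op h f v - f v) u = grushin_op (m + h) f u - grushin_op m f u"
    using kernel_op_linear[OF p hf f, of 1 "- 1" u] grushin_op_compose[OF m h p f, of u] by simp
  then show ?thesis
    using ne unfolding m_def[symmetric] h_def[symmetric]
    by (cases "t < s") (auto simp: m_def h_def norm_minus_commute)
qed

lemma Lp_norm_cong: "(\<And>u. norm (f u) = norm (g u)) \<Longrightarrow> Lp_norm M p f = Lp_norm M p g"
  by (simp add: Lp_norm_def)

lemma exponent_gap_nonneg:
  fixes p r :: ennreal
  assumes "1 \<le> p" "p \<le> r"
  shows "0 \<le> enn2real (inverse p) - enn2real (inverse r)"
  using assms(1)
proof (cases rule: ennreal_cases_ge_1)
  case 1
  with assms(2) show ?thesis by (simp add: top_unique)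
next
  case (2 q)
  from order_trans[OF assms] show ?thesis
  proof (cases rule: ennreal_cases_ge_1)
    case 1
    then show ?thesis by simp
  next
    case s: (2 s)
    with 2 assms have "q \<le> s" by simp
    with 2 s show ?thesis by (simp add: inverse_ennreal divide_simps)
  qed
qed

text \<open>The operator at the earlier time smooths from L^q to L^r with a constant that is uniform
  while this time is at least \<open>t / 2\<close>; the increment it acts on tends to 0 in
  L^q.\<close>

lemma grushin_op_tendsto_finite:
  fixes f :: "'a::euclidean_space \<times> 'b::euclidean_space \<Rightarrow> complex"
  assumes T: "T \<longlonglongrightarrow> t" and Tpos: "\<And>n. T n > 0" "\<And>n. T n \<noteq> t" and t: "t > 0"
    and q: "q \<ge> 1" and r: "ennreal q \<le> r" and f: "f \<in> Lp_space lebesgue (ennreal q)"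
  shows "(\<lambda>n. Lp_norm lebesgue r (\<lambda>u. grushin_op (T n) f u - grushin_op t f u)) \<longlonglongrightarrow> 0"
proof -
  have p1: "1 \<le> ennreal q" using q by simp
  let ?d = "enn2real (inverse (ennreal q)) - enn2real (inverse r)"
  let ?A = "grushin_density_bound TYPE('a) TYPE('b)"
  let ?g = "\<lambda>n v. grushin_op \<bar>T n - t\<bar> f v - f v"
  have h: "\<bar>T n - t\<bar> > 0" for n using Tpos(2)[of n] by simp
  have h0: "(\<lambda>n. \<bar>T n - t\<bar>) \<longlonglongrightarrow> 0"
    using T by (simp add: LIM_zero tendsto_rabs_zero)
  have "\<forall>\<^sub>F n in sequentially. t / 2 < T n" using T t by (intro order_tendstoD(1)) auto
  then have le: "\<forall>\<^sub>F n in sequentially. Lp_norm lebesgue r (\<lambda>u. grushin_op (T n) f u - grushin_op t f u)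
    \<le> ?A (t / 2) powr ?d * Lp_norm lebesgue (ennreal q) (?g n)"
  proof eventually_elim
    case (elim n)
    let ?m = "min (T n) t"
    have m: "?m > 0" "t / 2 \<le> ?m" using elim t by auto
    interpret bistochastic_kernel lebesgue "grushin_transition ?m :: 'a \<times> 'b \<Rightarrow> _" "?A ?m"
      by (rule bistochastic_grushin_transition[OF m(1)])
    interpret H: bistochastic_kernel lebesgue "grushin_transition \<bar>T n - t\<bar> :: 'a \<times> 'b \<Rightarrow> _" "?A \<bar>T n - t\<bar>"
      by (rule bistochastic_grushin_transition[OF h])
    have hf: "grushin_op \<bar>T n - t\<bar> f \<in> Lp_space lebesgue (ennreal q)"
      by (rule H.kernel_op_smoothing(1)[OF p1 order_refl f grushin_density_bound_pos[OF h]])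
    have g: "?g n \<in> Lp_space lebesgue (ennreal q)"
      using Lp_space_add[OF q hf Lp_space_mult[OF q f, of "- 1"]] by simp
    have "Lp_norm lebesgue r (\<lambda>u. grushin_op (T n) f u - grushin_op t f u) = Lp_norm lebesgue r (grushin_op ?m (?g n))"
      by (intro Lp_norm_cong, subst grushin_op_difference[OF Tpos(1) t Tpos(2) p1 f])
         simp
    also have "\<dots> \<le> ?A ?m powr ?d * Lp_norm lebesgue (ennreal q) (?g n)"
      by (rule kernel_op_smoothing(2)[OF p1 r g grushin_density_bound_pos[OF m(1)]])
    also have "\<dots> \<le> ?A (t / 2) powr ?d * Lp_norm lebesgue (ennreal q) (?g n)"
      using m t grushin_density_bound_pos[OF m(1), where 'a='a and 'b='b]
      by (intro mult_right_mono powr_mono2 exponent_gap_nonneg p1 r grushin_density_bound_antimono Lp_norm_nonneg) auto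
    finally show ?case .
  qed
  have "(\<lambda>n. ?A (t / 2) powr ?d * Lp_norm lebesgue (ennreal q) (?g n)) \<longlonglongrightarrow> ?A (t / 2) powr ?d * 0"
    by (intro tendsto_mult tendsto_const grushin_op_tendsto_0 h h0 q f)
  then have "(\<lambda>n. ?A (t / 2) powr ?d * Lp_norm lebesgue (ennreal q) (?g n)) \<longlonglongrightarrow> 0" by simp
  from tendsto_sandwich[OF _ le tendsto_const this] show ?thesis
    by (simp add: Lp_norm_nonneg)
qed

text \<open>At exponent infinity the increment over a short time need not tend to 0 in norm. Instead
  the difference is bounded by the norm of \<open>f\<close> times the total variation distance of
  the kernels, uniformly in \<open>u\<close>.\<close>

lemma grushin_op_tendsto_infinity:
  fixes f :: "'a::euclidean_space \<times> 'b::euclidean_space \<Rightarrow> complex"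
  assumes T: "T \<longlonglongrightarrow> t" and Tpos: "\<And>n. T n > 0" and t: "t > 0" and f: "f \<in> Lp_space lebesgue \<infinity>"
  shows "(\<lambda>n. Lp_norm lebesgue \<infinity> (\<lambda>u. grushin_op (T n) f u - grushin_op t f u)) \<longlonglongrightarrow> 0"
proof (rule tendstoI)
  fix e :: real assume e: "e > 0"
  define F where "F = Lp_norm lebesgue \<infinity> f"
  have F: "F \<ge> 0" by (simp add: F_def Lp_norm_nonneg)
  \<comment> \<open>Positive even if \<open>F = 0\<close>, so that division by it is
    harmless.\<close>
  define G where "G = F + 1"
  have G: "G > 0" "F \<le> G" using F by (auto simp: G_def)
  define \<epsilon> where "\<epsilon> = e / 2 / G"
  have eps: "\<epsilon> > 0" using e G by (simp add: \<epsilon>_def)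
  have "F * \<epsilon> \<le> G * \<epsilon>" using eps G by (intro mult_right_mono) auto
  also have "\<dots> = e / 2" using G by (simp add: \<epsilon>_def)
  finally have Fe: "F * \<epsilon> < e" using e by simp
  have [measurable]: "f \<in> borel_measurable lebesgue" using f by (rule Lp_space_measurable)
  note [measurable] = grushin_op_measurable[OF Tpos f] grushin_op_measurable[OF t f]
  show "\<forall>\<^sub>F n in sequentially. dist (Lp_norm lebesgue \<infinity> (\<lambda>u. grushin_op (T n) f u - grushin_op t f u)) 0 < e"
    using grushin_transition_uniformly_continuous[OF T Tpos t eps, where 'a='a and 'b='b]
  proof eventually_elim
    case (elim n)
    interpret n: bistochastic_kernel lebesgue "grushin_transition (T n) :: 'a \<times> 'b \<Rightarrow> _" "grushin_density_bound TYPE('a) TYPE('b) (T n)"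
      by (rule bistochastic_grushin_transition[OF Tpos])
    interpret t: bistochastic_kernel lebesgue "grushin_transition t :: 'a \<times> 'b \<Rightarrow> _" "grushin_density_bound TYPE('a) TYPE('b) t"
      by (rule bistochastic_grushin_transition[OF t])
    have "norm (grushin_op (T n) f u - grushin_op t f u) \<le> F * \<epsilon>" for u
    proof -
      let ?k = "\<lambda>v. grushin_transition (T n) u v - grushin_transition t u v"
      have ki: "integrable lebesgue ?k"
        by (intro Bochner_Integration.integrable_diff n.kernel_integrable t.kernel_integrable)
      have i: "integrable lebesgue (\<lambda>v. of_real (?k v) * f v)"
        using Bochner_Integration.integrable_diff[OF n.integrable_kernel[OF _ f, of u] t.integrable_kernel[OF _ f, of u]]
        by (simp add: left_diff_distrib)
      have "grushin_op (T n) f u - grushin_op t f u = (\<integral>v. of_real (?k v) * f v \<partial>lebesgue)"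
        unfolding kernel_op_def using n.integrable_kernel[OF _ f, of u] t.integrable_kernel[OF _ f, of u]
        by (simp add: left_diff_distrib)
      also have "norm \<dots> \<le> (\<integral>v. norm (of_real (?k v) * f v) \<partial>lebesgue)"
        by (rule integral_norm_bound)
      also have "\<dots> \<le> (\<integral>v. \<bar>?k v\<bar> * F \<partial>lebesgue)"
      proof (rule integral_mono_AE)
        show "integrable lebesgue (\<lambda>v. norm (of_real (?k v) * f v))" using i by (rule integrable_norm)
        show "integrable lebesgue (\<lambda>v. \<bar>?k v\<bar> * F)" by (intro integrable_mult_left integrable_abs ki)
        show "AE v in lebesgue. norm (of_real (?k v) * f v) \<le> \<bar>?k v\<bar> * F"
          using Lp_infinity_AE[OF f] unfolding F_def[symmetric]
          by eventually_elim (auto simp: norm_mult simp flip: of_real_diff intro!: mult_left_mono)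
      qed
      also have "\<dots> = (\<integral>v. \<bar>?k v\<bar> \<partial>lebesgue) * F" by simp
      also have "\<dots> \<le> \<epsilon> * F"
      proof (intro mult_right_mono F)
        have "ennreal (\<integral>v. \<bar>?k v\<bar> \<partial>lebesgue) = (\<integral>\<^sup>+v. ennreal \<bar>?k v\<bar> \<partial>lebesgue)"
          by (rule nn_integral_eq_integral[symmetric]) (auto intro: integrable_abs ki)
        also have "\<dots> \<le> ennreal \<epsilon>" using elim[rule_format, of u] by (simp only: nn_integral_completion)
        finally show "(\<integral>v. \<bar>?k v\<bar> \<partial>lebesgue) \<le> \<epsilon>" using eps by (simp add: ennreal_le_iff)
      qed
      finally show ?thesis by (simp add: mult.commute)
    qed
    then have "Lp_norm lebesgue \<infinity> (\<lambda>u. grushin_op (T n) f u - grushin_op t f u) \<le> F * \<epsilon>"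
      using F eps by (intro Lp_infinityI) auto
    with Fe show ?case by (simp add: Lp_norm_nonneg)
  qed
qed

lemma grushin_op_tendsto:
  fixes f :: "'a::euclidean_space \<times> 'b::euclidean_space \<Rightarrow> complex"
  assumes t: "t > 0" and p: "1 \<le> p" "p \<le> r" and f: "f \<in> Lp_space lebesgue p"
  shows "((\<lambda>s. Lp_norm lebesgue r (\<lambda>u. grushin_op s f u - grushin_op t f u)) \<longlongrightarrow> 0) (at t)"
proof -
  \<comment> \<open>Restricting to positive times lets every approximating sequence consist of
    integral operators; near a positive \<open>t\<close> the filter is unchanged.\<close>
  have "((\<lambda>s. Lp_norm lebesgue r (\<lambda>u. grushin_op s f u - grushin_op t f u)) \<longlongrightarrow> 0) (at t within {0<..})"
    unfolding tendsto_at_iff_sequentially o_def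
  proof (intro allI impI)
    fix T assume T: "\<forall>i. T i \<in> {0<..} - {t}" "T \<longlonglongrightarrow> t"
    show "(\<lambda>n. Lp_norm lebesgue r (\<lambda>u. grushin_op (T n) f u - grushin_op t f u)) \<longlonglongrightarrow> 0"
      using p(1)
    proof (cases rule: ennreal_cases_ge_1)
      case 1
      then have "r = \<infinity>" using p(2) by (simp add: top_unique)
      moreover have "T n > 0" for n using T(1) by simp
      ultimately show ?thesis
        using grushin_op_tendsto_infinity[OF T(2) _ t f[unfolded 1]] by simp
    next
      case (2 q)
      with T t p f show ?thesis
        by (intro grushin_op_tendsto_finite[where q=q]) auto
    qed
  qed
  then show ?thesis using t by (simp add: at_within_open[of t "{0<..}"])
qed

section \<open>Identification with the operators of the statement\<close>

lemma grushin_integrand_eq: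
  fixes \<phi> :: "(real^'n) \<times> (real^'k) \<Rightarrow> complex"
  assumes "t > 0"
  shows "grushin_integrand t \<phi> u = (\<lambda>v. of_real (grushin_transition t u v) * \<phi> v)"
proof
  fix v
  show "grushin_integrand t \<phi> u v = of_real (grushin_transition t u v) * \<phi> v"
    by (cases u, cases v) (simp add: grushin_integrand_def grushin_transition_def grushin_kernel_eq_density[OF assms])
qed

lemma grushin_semigroup_eq_op:
  fixes \<phi> :: "(real^'n) \<times> (real^'k) \<Rightarrow> complex"
  assumes "t > 0"
  shows "grushin_semigroup t \<phi> = grushin_op t \<phi>"
  using assms by (simp add: grushin_semigroup_def grushin_integrand_eq kernel_op_def fun_eq_iff)

lemma grushin_semigroup_0 [simp]: "grushin_semigroup 0 \<phi> = \<phi>"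
  by (simp add: grushin_semigroup_def)

text \<open>Integrability of the integrand and membership in L^r are asserted explicitly, because
  the integral and \<open>Lp_norm\<close> return some value for every function.\<close>

theorem theorem2p6:
  shows
    "(\<forall>p\<ge>1.
        (\<forall>t>0. \<forall>\<phi> \<in> Lp_space (lebesgue :: ((real^'n) \<times> (real^'k)) measure) p. \<forall>u.
           integrable lebesgue (grushin_integrand t \<phi> u)) \<and>
        (\<forall>t\<ge>0. Lp_operator (lebesgue :: ((real^'n) \<times> (real^'k)) measure) p (grushin_semigroup t)) \<and>
        (\<forall>\<phi> \<in> Lp_space (lebesgue :: ((real^'n) \<times> (real^'k)) measure) p.
           grushin_semigroup 0 \<phi> = \<phi>) \<and>
        (\<forall>t\<ge>0. \<forall>s\<ge>0. \<forall>\<phi> \<in> Lp_space (lebesgue :: ((real^'n) \<times> (real^'k)) measure) p.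
           AE u in lebesgue.
             grushin_semigroup (t + s) \<phi> u = grushin_semigroup t (grushin_semigroup s \<phi>) u))
     \<and>
     (\<forall>p r. 1 \<le> p \<and> p \<le> r \<longrightarrow>
        (\<exists>C>0. \<forall>\<phi> \<in> Lp_space (lebesgue :: ((real^'n) \<times> (real^'k)) measure) p. \<forall>t>0.
           grushin_semigroup t \<phi> \<in> Lp_space lebesgue r \<and>
           Lp_norm lebesgue r (grushin_semigroup t \<phi>)
             \<le> C * t powr (- ((real CARD('n) + 2 * real CARD('k)) / 2)
                            * (enn2real (inverse p) - enn2real (inverse r)))
                 * Lp_norm lebesgue p \<phi>))
     \<and>
     (\<forall>p r. 1 \<le> p \<and> p \<le> r \<longrightarrow>
        (\<forall>t\<^sub>0>0. \<forall>\<phi> \<in> Lp_space (lebesgue :: ((real^'n) \<times> (real^'k)) measure) p.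
           ((\<lambda>t. Lp_norm lebesgue r
                  (\<lambda>u. grushin_semigroup t \<phi> u - grushin_semigroup t\<^sub>0 \<phi> u)) \<longlongrightarrow> 0) (at t\<^sub>0)))
     \<and>
     (\<forall>p. 1 \<le> p \<and> p < \<infinity> \<longrightarrow>
        (\<forall>\<phi> \<in> Lp_space (lebesgue :: ((real^'n) \<times> (real^'k)) measure) p.
           ((\<lambda>t. Lp_norm lebesgue p
                  (\<lambda>u. grushin_semigroup t \<phi> u - grushin_semigroup 0 \<phi> u)) \<longlongrightarrow> 0) (at_right 0)))"
proof (intro conjI allI impI ballI; (elim conjE)?)
  fix p :: ennreal and t :: real and \<phi> :: "(real^'n) \<times> (real^'k) \<Rightarrow> complex" and u
  assume p: "1 \<le> p" and t: "0 < t" and \<phi>: "\<phi> \<in> Lp_space lebesgue p"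
  interpret bistochastic_kernel lebesgue "grushin_transition t :: (real^'n) \<times> (real^'k) \<Rightarrow> _" "grushin_density_bound TYPE(real^'n) TYPE(real^'k) t"
    by (rule bistochastic_grushin_transition[OF t])
  show "integrable lebesgue (grushin_integrand t \<phi> u)"
    unfolding grushin_integrand_eq[OF t] by (rule integrable_kernel[OF p \<phi>])
next
  fix p :: ennreal and t :: real
  assume p: "1 \<le> p" and t: "0 \<le> t"
  show "Lp_operator (lebesgue :: ((real^'n) \<times> (real^'k)) measure) p (grushin_semigroup t)"
  proof (cases "t = 0")
    case True
    then show ?thesis by (auto simp: Lp_operator_def)
  next
    case False
    with t have t: "t > 0" by simp
    interpret bistochastic_kernel lebesgue "grushin_transition t :: (real^'n) \<times> (real^'k) \<Rightarrow> _" "grushin_density_bound TYPE(real^'n) TYPE(real^'k) t"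
      by (rule bistochastic_grushin_transition[OF t])
    have "grushin_semigroup t = (grushin_op t :: (_ \<Rightarrow> complex) \<Rightarrow> (real^'n) \<times> (real^'k) \<Rightarrow> complex)"
      using grushin_semigroup_eq_op[OF t] by blast
    then show ?thesis
      using Lp_operator_kernel_op[OF p grushin_density_bound_pos[OF t]] by simp
  qed
next
  fix p :: ennreal and t s :: real and \<phi> :: "(real^'n) \<times> (real^'k) \<Rightarrow> complex"
  assume p: "1 \<le> p" and t: "0 \<le> t" and s: "0 \<le> s" and \<phi>: "\<phi> \<in> Lp_space lebesgue p"
  show "AE u in lebesgue. grushin_semigroup (t + s) \<phi> u = grushin_semigroup t (grushin_semigroup s \<phi>) u"
  \<comment> \<open>At time 0 the operator is the identity by definition and not an integral
    operator, so the kernel law only covers two positive times.\<close>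
  proof (cases "t = 0 \<or> s = 0")
    case False
    with t s have ts: "t > 0" "s > 0" by auto
    then show ?thesis
      using grushin_op_compose[OF ts p \<phi>] by (simp add: grushin_semigroup_eq_op)
  qed auto
next
  fix p r :: ennreal
  assume p: "1 \<le> p" "p \<le> r"
  let ?A = "grushin_density_bound TYPE(real^'n) TYPE(real^'k)"
  let ?d = "enn2real (inverse p) - enn2real (inverse r)"
  show "\<exists>C>0. \<forall>\<phi> \<in> Lp_space (lebesgue :: ((real^'n) \<times> (real^'k)) measure) p. \<forall>t>0.
           grushin_semigroup t \<phi> \<in> Lp_space lebesgue r \<and>
           Lp_norm lebesgue r (grushin_semigroup t \<phi>)
             \<le> C * t powr (- ((real CARD('n) + 2 * real CARD('k)) / 2) * ?d) * Lp_norm lebesgue p \<phi>"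
  \<comment> \<open>The kernel bound at time 1 raised to the power 1/p - 1/r;
    \<open>grushin_density_bound_eq\<close> supplies the power of \<open>t\<close>.\<close>
  proof (intro exI[of _ "?A 1 powr ?d"] conjI ballI allI impI)
    show "0 < ?A 1 powr ?d" using grushin_density_bound_pos[of 1, where 'a="real^'n" and 'b="real^'k"] by simp
    fix \<phi> :: "(real^'n) \<times> (real^'k) \<Rightarrow> complex" and t :: real
    assume \<phi>: "\<phi> \<in> Lp_space lebesgue p" and t: "0 < t"
    interpret bistochastic_kernel lebesgue "grushin_transition t :: (real^'n) \<times> (real^'k) \<Rightarrow> _" "?A t"
      by (rule bistochastic_grushin_transition[OF t])
    note smooth = kernel_op_smoothing[OF p \<phi> grushin_density_bound_pos[OF t]]
    show "grushin_semigroup t \<phi> \<in> Lp_space lebesgue r"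
      using smooth(1) t by (simp add: grushin_semigroup_eq_op)
    have "?A t powr ?d = (?A 1 * t powr (- ((real CARD('n) + 2 * real CARD('k)) / 2))) powr ?d"
      by (subst grushin_density_bound_eq[OF t]) simp
    also have "\<dots> = ?A 1 powr ?d * t powr (- ((real CARD('n) + 2 * real CARD('k)) / 2) * ?d)"
      using grushin_density_bound_pos[of 1, where 'a="real^'n" and 'b="real^'k"]
      by (simp add: powr_mult powr_powr)
    finally show "Lp_norm lebesgue r (grushin_semigroup t \<phi>)
        \<le> ?A 1 powr ?d * t powr (- ((real CARD('n) + 2 * real CARD('k)) / 2) * ?d) * Lp_norm lebesgue p \<phi>"
      using smooth(2) t by (simp add: grushin_semigroup_eq_op)
  qed
next
  fix p r :: ennreal and t\<^sub>0 :: real and \<phi> :: "(real^'n) \<times> (real^'k) \<Rightarrow> complex"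
  assume p: "1 \<le> p" "p \<le> r" and t: "0 < t\<^sub>0" and \<phi>: "\<phi> \<in> Lp_space lebesgue p"
  \<comment> \<open>The identification with \<open>grushin_op\<close> holds for positive times only,
    and these fill a neighbourhood of \<open>t\<^sub>0\<close>.\<close>
  have "\<forall>\<^sub>F t in at t\<^sub>0. t > 0"
    using t by (intro order_tendstoD(1)[OF tendsto_ident_at])
  then have "\<forall>\<^sub>F t in at t\<^sub>0. Lp_norm lebesgue r (\<lambda>u. grushin_op t \<phi> u - grushin_op t\<^sub>0 \<phi> u)
      = Lp_norm lebesgue r (\<lambda>u. grushin_semigroup t \<phi> u - grushin_semigroup t\<^sub>0 \<phi> u)"
    by eventually_elim (simp add: grushin_semigroup_eq_op t)
  from Lim_transform_eventually[OF grushin_op_tendsto[OF t p \<phi>] this]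
  show "((\<lambda>t. Lp_norm lebesgue r (\<lambda>u. grushin_semigroup t \<phi> u - grushin_semigroup t\<^sub>0 \<phi> u)) \<longlongrightarrow> 0) (at t\<^sub>0)" .
next
  fix p :: ennreal and \<phi> :: "(real^'n) \<times> (real^'k) \<Rightarrow> complex"
  assume p: "1 \<le> p" "p < \<infinity>" and \<phi>: "\<phi> \<in> Lp_space lebesgue p"
  from p(1) show "((\<lambda>t. Lp_norm lebesgue p (\<lambda>u. grushin_semigroup t \<phi> u - grushin_semigroup 0 \<phi> u)) \<longlongrightarrow> 0) (at_right 0)"
  proof (cases rule: ennreal_cases_ge_1)
    case (2 q)
    show ?thesis
      unfolding tendsto_at_iff_sequentially o_def
    proof (intro allI impI)
      fix T :: "nat \<Rightarrow> real" assume T: "\<forall>i. T i \<in> {0<..} - {0}" "T \<longlonglongrightarrow> 0"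
      then have Tpos: "T i > 0" for i by simp
      show "(\<lambda>n. Lp_norm lebesgue p (\<lambda>u. grushin_semigroup (T n) \<phi> u - grushin_semigroup 0 \<phi> u)) \<longlonglongrightarrow> 0"
        using grushin_op_tendsto_0[OF Tpos T(2) 2(1) \<phi>[unfolded 2(2)]] Tpos
        by (simp add: grushin_semigroup_eq_op 2(2))
    qed
  qed (use p in simp)
qed simp

end
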